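(* Let $\alpha>0$ be fixed and let the target parameter $\theta_0$ be an interior point of $\Theta$. Suppose the following conditions hold in a neighborhood $B\subseteq\Theta_G$ of $\theta_0$ (that is, for all $\theta\in B$): 1. The integral $\int_{\mathcal X}f^{1+\alpha}(x;\theta)\,dx$ is twice continuously differentiable with respect to $\theta$ in $B$, and the derivative can be taken under the integral sign. 2. For each $j=1,\dots,p$ there is a constant $C_j<\infty$ such that $S_j^2(x;\theta)f^{2\alpha}(x;\theta)<C_j$ for a.e. $x$. 3. There are functions $\phi_{jk}$ such that $|i_{jk}(x;\theta)f^\alpha(x;\theta)|\le\phi_{jk}(x)$ for $j,k=1,\dots,p$, and $$\int_{\mathcal X}\phi_{jk}(x)f(x;\theta)\,dx<\infty\quad\text{and}\quad\int_{\mathcal X}\phi_{jk}(x)g(x)\,dx<\infty.$$ Then the MDPDE is asymptotically normal: any sequence of MDPDEs $\hat\theta_{\alpha,n}$ that is consistent for $\theta_0$ (i.e. $\hat\theta_{\alpha,n}\to\theta_0$ in probability) is such that $$\sqrt n\,(\hat\theta_{\alpha,n}-\theta_0)\rightsquigarrow N_p\bigl(0,\ J_\alpha^{-1}(\theta_0)K_\alpha(\theta_0)J_\alpha^{-1}(\theta_0)\bigr)\quad\text{as } n\to\infty,$$ where $\rightsquigarrow$ denotes convergence in distribution.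
   Context: $G$ is a probability distribution with support $\mathcal X$ and density $g$; $X_1,X_2,\dots$ are i.i.d. from $G$. $\{f(x;\theta):\theta\in\Theta\}$, $x\in\mathcal X$, $\Theta\subseteq\mathbb R^p$, $p\ge1$, is an identifiable parametric family of probability densities on $\mathcal X$ ($f(x;\theta_1)=f(x;\theta_2)$ for a.e. $x$ implies $\theta_1=\theta_2$); $g$ need not belong to the family. As a standing assumption, $\Theta$ carries a metric $d$ making it compact. For the fixed $\alpha>0$ define $m:\mathcal X\times\Theta\to\mathbb R$ by $$m(x,\theta)=\Bigl(1+\tfrac1\alpha\Bigr)f^\alpha(x;\theta)-\int_{\mathcal X}f^{1+\alpha}(y;\theta)\,dy,\qquad m_n(\theta)=\frac1n\sum_{i=1}^n m(X_i,\theta).$$ Let $\Theta_G=\{\theta\in\Theta:\int_{\mathcal X}|m(x,\theta)|g(x)\,dx<\infty\}$, $M(\theta)=\int_{\mathcal X}m(x,\theta)g(x)\,dx=(1+\frac1\alpha)\int_{\mathcal X}f^\alpha(x;\theta)g(x)\,dx-\int_{\mathcal X}f^{1+\alpha}(x;\theta)\,dx$ for $\theta\in\Theta_G$, and $M(\theta)=-\infty$ for $\theta\in\Theta\setminus\Theta_G$. The target parameter $\theta_0\in\Theta$ is the unique point with $-\infty<M(\theta_0)=\sup_{\theta\in\Theta}M(\theta)<\infty$. A minimum density power divergence estimator (MDPDE) $\hat\theta_{\alpha,n}$ is an estimator, based on $X_1,\dots,X_n$, that maximizes $m_n(\theta)$ over $\Theta$. $\mathsf D_\theta$ and $\mathsf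 H_\theta$ denote the derivative (row vector) and the Hessian matrix in $\theta$. The score is $S(x;\theta)=(\mathsf D_\theta\log f(x;\theta))^t$ with components $S_j(x;\theta)$, and the information matrix is $i(x;\theta)=-\mathsf H_\theta\log f(x;\theta)$ with entries $i_{jk}(x;\theta)$; these derivatives are assumed to exist where used. Define the $p\times p$ matrices $$K_\alpha(\theta)=\int_{\mathcal X}S(x;\theta)S^t(x;\theta)f^{2\alpha}(x;\theta)g(x)\,dx-U_\alpha(\theta)U_\alpha^t(\theta),\quad U_\alpha(\theta)=\int_{\mathcal X}S(x;\theta)f^\alpha(x;\theta)g(x)\,dx,$$ $$J_\alpha(\theta)=\int_{\mathcal X}S(x;\theta)S^t(x;\theta)f^{1+\alpha}(x;\theta)\,dx+\int_{\mathcal X}\{i(x;\theta)-\alpha S(x;\theta)S^t(x;\theta)\}[g(x)-f(x;\theta)]f^\alpha(x;\theta)\,dx.$$ $J_\alpha(\theta_0)$ is taken to be invertible, as the notation $J_\alpha^{-1}(\theta_0)$ presupposes. Condition 1 refers to the first and second derivatives of $f^{1+\alpha}(x;\theta)$ in $\theta$. *)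

theory Defs
  imports "HOL-Probability.Probability"
begin

text \<open>
  The sample space is a Polish space with a \<open>\<sigma>\<close>-finite Borel measure \<open>\<nu>\<close> with respect to which
  densities are taken; \<open>\<nu> = lborel\<close> on \<open>real ^ 'q\<close> is the case of Lebesgue densities.
  The definitions below take as parameter the measure \<open>\<mu>\<close> that represents \<open>dx\<close> on \<open>\<X>\<close>. It is meant
  to be \<open>completion (restrict_space \<nu> \<X>)\<close>: a score that exists only for almost every \<open>x\<close> need not
  be Borel measurable on the exceptional null set, and the Bochner integral of a
  non-measurable function is \<open>0\<close> by convention.
\<close>

definition topological_support :: "'x::topological_space measure \<Rightarrow> 'x set" where
  "topological_support G = {x. \<forall>U. open U \<longrightarrow> x \<in> U \<longrightarrow> 0 < emeasure G U}"

definition gradient :: "(real ^ 'p \<Rightarrow> real) \<Rightarrow> real ^ 'p \<Rightarrow> real ^ 'p" where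
  "gradient h \<theta> = (\<chi> j. frechet_derivative h (at \<theta>) (axis j 1))"

definition hessian :: "(real ^ 'p \<Rightarrow> real) \<Rightarrow> real ^ 'p \<Rightarrow> real ^ 'p ^ 'p" where
  "hessian h \<theta> = jacobian (gradient h) (at \<theta>)"

text \<open>Only used for open \<open>B\<close>.\<close>

definition twice_differentiable_on :: "(real ^ 'p \<Rightarrow> real) \<Rightarrow> (real ^ 'p) set \<Rightarrow> bool" where
  "twice_differentiable_on h B \<longleftrightarrow>
     (\<forall>\<theta>\<in>B. h differentiable (at \<theta>) \<and> gradient h differentiable (at \<theta>))"

definition twice_cont_differentiable_on :: "(real ^ 'p \<Rightarrow> real) \<Rightarrow> (real ^ 'p) set \<Rightarrow> bool" where
  "twice_cont_differentiable_on h B \<longleftrightarrow>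
     twice_differentiable_on h B \<and> continuous_on B (hessian h)"

definition outer :: "real ^ 'p \<Rightarrow> real ^ 'p \<Rightarrow> real ^ 'p ^ 'p" where
  "outer v w = (\<chi> j k. v $ j * w $ k)"

definition score :: "('x \<Rightarrow> real ^ 'p \<Rightarrow> real) \<Rightarrow> 'x \<Rightarrow> real ^ 'p \<Rightarrow> real ^ 'p" where
  "score f x \<theta> = gradient (\<lambda>t. ln (f x t)) \<theta>"

definition information :: "('x \<Rightarrow> real ^ 'p \<Rightarrow> real) \<Rightarrow> 'x \<Rightarrow> real ^ 'p \<Rightarrow> real ^ 'p ^ 'p" where
  "information f x \<theta> = - hessian (\<lambda>t. ln (f x t)) \<theta>"

definition dpd_integral :: "'x measure \<Rightarrow> ('x \<Rightarrow> real ^ 'p \<Rightarrow> real) \<Rightarrow> real \<Rightarrow> real ^ 'p \<Rightarrow> real" where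
  "dpd_integral \<mu> f \<alpha> \<theta> = (LINT y|\<mu>. f y \<theta> powr (1 + \<alpha>))"

definition dpd_m :: "'x measure \<Rightarrow> ('x \<Rightarrow> real ^ 'p \<Rightarrow> real) \<Rightarrow> real \<Rightarrow> 'x \<Rightarrow> real ^ 'p \<Rightarrow> real" where
  "dpd_m \<mu> f \<alpha> x \<theta> = (1 + 1 / \<alpha>) * f x \<theta> powr \<alpha> - dpd_integral \<mu> f \<alpha> \<theta>"

text \<open>The sample is \<open>xs 0, \<dots>, xs (n - 1)\<close>.\<close>

definition dpd_mn ::
  "'x measure \<Rightarrow> ('x \<Rightarrow> real ^ 'p \<Rightarrow> real) \<Rightarrow> real \<Rightarrow> nat \<Rightarrow> (nat \<Rightarrow> 'x) \<Rightarrow> real ^ 'p \<Rightarrow> real" where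
  "dpd_mn \<mu> f \<alpha> n xs \<theta> = (1 / real n) * (\<Sum>i<n. dpd_m \<mu> f \<alpha> (xs i) \<theta>)"

definition Theta_G ::
  "'x measure \<Rightarrow> ('x \<Rightarrow> real) \<Rightarrow> ('x \<Rightarrow> real ^ 'p \<Rightarrow> real) \<Rightarrow> real \<Rightarrow> (real ^ 'p) set \<Rightarrow> (real ^ 'p) set"
where
  "Theta_G \<mu> g f \<alpha> \<Theta> = {\<theta> \<in> \<Theta>. integrable \<mu> (\<lambda>x. dpd_m \<mu> f \<alpha> x \<theta> * g x)}"

definition dpd_M ::
  "'x measure \<Rightarrow> ('x \<Rightarrow> real) \<Rightarrow> ('x \<Rightarrow> real ^ 'p \<Rightarrow> real) \<Rightarrow> real \<Rightarrow> (real ^ 'p) set \<Rightarrow> real ^ 'p \<Rightarrow> ereal"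
where
  "dpd_M \<mu> g f \<alpha> \<Theta> \<theta> =
     (if \<theta> \<in> Theta_G \<mu> g f \<alpha> \<Theta> then ereal (LINT x|\<mu>. dpd_m \<mu> f \<alpha> x \<theta> * g x) else -\<infinity>)"

definition dpd_U ::
  "'x measure \<Rightarrow> ('x \<Rightarrow> real) \<Rightarrow> ('x \<Rightarrow> real ^ 'p \<Rightarrow> real) \<Rightarrow> real \<Rightarrow> real ^ 'p \<Rightarrow> real ^ 'p" where
  "dpd_U \<mu> g f \<alpha> \<theta> = (LINT x|\<mu>. (f x \<theta> powr \<alpha> * g x) *\<^sub>R score f x \<theta>)"

definition dpd_K ::
  "'x measure \<Rightarrow> ('x \<Rightarrow> real) \<Rightarrow> ('x \<Rightarrow> real ^ 'p \<Rightarrow> real) \<Rightarrow> real \<Rightarrow> real ^ 'p \<Rightarrow> real ^ 'p ^ 'p" where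
  "dpd_K \<mu> g f \<alpha> \<theta> =
     (LINT x|\<mu>. (f x \<theta> powr (2 * \<alpha>) * g x) *\<^sub>R outer (score f x \<theta>) (score f x \<theta>))
     - outer (dpd_U \<mu> g f \<alpha> \<theta>) (dpd_U \<mu> g f \<alpha> \<theta>)"

definition dpd_J ::
  "'x measure \<Rightarrow> ('x \<Rightarrow> real) \<Rightarrow> ('x \<Rightarrow> real ^ 'p \<Rightarrow> real) \<Rightarrow> real \<Rightarrow> real ^ 'p \<Rightarrow> real ^ 'p ^ 'p" where
  "dpd_J \<mu> g f \<alpha> \<theta> =
     (LINT x|\<mu>. (f x \<theta> powr (1 + \<alpha>)) *\<^sub>R outer (score f x \<theta>) (score f x \<theta>))
     + (LINT x|\<mu>. ((g x - f x \<theta>) * f x \<theta> powr \<alpha>) *\<^sub>R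
          (information f x \<theta> - \<alpha> *\<^sub>R outer (score f x \<theta>) (score f x \<theta>)))"

text \<open>
  An estimator is a measurable function \<open>T\<close> of the first \<open>n\<close> observations. Maximality is required
  almost surely only, because observations may leave \<open>\<X>\<close> with probability zero.
\<close>

definition is_mdpde ::
  "'w measure \<Rightarrow> (nat \<Rightarrow> 'w \<Rightarrow> 'x::topological_space) \<Rightarrow> 'x measure \<Rightarrow> ('x \<Rightarrow> real ^ 'p \<Rightarrow> real) \<Rightarrow> real \<Rightarrow>
     (real ^ 'p) set \<Rightarrow> nat \<Rightarrow> ((nat \<Rightarrow> 'x) \<Rightarrow> real ^ 'p) \<Rightarrow> bool" where
  "is_mdpde P X \<mu> f \<alpha> \<Theta> n T \<longleftrightarrow>
     T \<in> borel_measurable (\<Pi>\<^sub>M i\<in>{..<n}. borel) \<and>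
     (AE \<omega> in P. let xs = (\<lambda>i\<in>{..<n}. X i \<omega>) in
        T xs \<in> \<Theta> \<and> (\<forall>\<theta>\<in>\<Theta>. dpd_mn \<mu> f \<alpha> n xs \<theta> \<le> dpd_mn \<mu> f \<alpha> n xs (T xs)))"

definition tendsto_in_prob :: "'w measure \<Rightarrow> (nat \<Rightarrow> 'w \<Rightarrow> 'a::metric_space) \<Rightarrow> 'a \<Rightarrow> bool" where
  "tendsto_in_prob P Y c \<longleftrightarrow>
     (\<forall>\<epsilon>>0. (\<lambda>n. measure P {\<omega> \<in> space P. dist (Y n \<omega>) c > \<epsilon>}) \<longlonglongrightarrow> 0)"

text \<open>\<open>weak_conv_m\<close> of the library is restricted to laws on the real line.\<close>

definition converges_in_distribution ::
  "'w measure \<Rightarrow> (nat \<Rightarrow> 'w \<Rightarrow> 'a::topological_space) \<Rightarrow> 'a measure \<Rightarrow> bool" where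
  "converges_in_distribution P Z N \<longleftrightarrow>
     (\<forall>h :: 'a \<Rightarrow> real. continuous_on UNIV h \<longrightarrow> bounded (range h) \<longrightarrow>
        (\<lambda>n. LINT \<omega>|P. h (Z n \<omega>)) \<longlonglongrightarrow> (LINT y|N. h y))"

definition std_normal_vec :: "(real ^ 'p) measure" where
  "std_normal_vec = distr (\<Pi>\<^sub>M i\<in>(UNIV :: 'p set). density lborel (\<lambda>x. ennreal (std_normal_density x)))
     borel (\<lambda>z. \<chi> i. z i)"

text \<open>\<open>N\<close> is the law \<open>N\<^sub>p(m, \<Sigma>)\<close>, i.e. the law of \<open>m + A Z\<close> with \<open>Z\<close> standard normal and
  \<open>A A\<^sup>t = \<Sigma>\<close>; \<open>\<Sigma>\<close> may be singular. The law does not depend on the choice of \<open>A\<close>.\<close>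

definition is_multivariate_normal :: "(real ^ 'p) measure \<Rightarrow> real ^ 'p \<Rightarrow> real ^ 'p ^ 'p \<Rightarrow> bool" where
  "is_multivariate_normal N m \<Sigma> \<longleftrightarrow>
     (\<exists>A :: real ^ 'p ^ 'p. A ** transpose A = \<Sigma> \<and>
        N = distr std_normal_vec borel (\<lambda>z. m + A *v z))"

end

theory Submission
  imports Defs
begin

text \<open>
  Differentiating the criterion turns the MDPDE into a root of an estimating equation. For
  \<open>\<Psi> x \<theta> = (1 + 1/\<alpha>) \<nabla>f\<^sup>\<alpha>(x;\<theta>) - \<nabla>\<integral>f\<^sup>1\<^sup>+\<^sup>\<alpha>(y;\<theta>)dy\<close> the gradient of the criterion is the sample mean of
  \<open>\<Psi> (X i) \<theta>\<close>. With probability tending to one the estimator lies in a ball around \<open>\<theta>\<^sub>0\<close> inside \<open>B\<close>,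
  so it is an interior maximiser and the mean of \<open>\<Psi>\<close> vanishes there. Linearising \<open>\<Psi>\<close> at \<open>\<theta>\<^sub>0\<close> gives
  \<open>\<surd>n (\<theta>\<^sub>n - \<theta>\<^sub>0) \<approx> - V\<^sup>-\<^sup>1 n\<^sup>-\<^sup>1\<^sup>/\<^sup>2 \<Sum>\<Psi> (X i) \<theta>\<^sub>0\<close>, where \<open>V\<close> is the mean of the derivative of \<open>\<Psi>\<close>
  (\<open>Z_estimator_asymptotically_normal\<close>). Here \<open>\<Psi>\<close> has mean zero at \<open>\<theta>\<^sub>0\<close> because \<open>\<theta>\<^sub>0\<close> maximises \<open>M\<close>
  (\<open>gradient_I\<close>), its covariance is \<open>(1 + \<alpha>)\<^sup>2 K\<close> (\<open>integral_outer_\<Psi>\<close>), and \<open>V = - (1 + \<alpha>) J\<close>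
  (\<open>integral_D\<Psi>\<close>). The scalars cancel in the sandwich \<open>V\<^sup>-\<^sup>1 Cov V\<^sup>-\<^sup>T\<close>, and \<open>J\<close> is symmetric, which
  leaves \<open>J\<^sup>-\<^sup>1 K J\<^sup>-\<^sup>1\<close>.

  The linearisation needs an integrable bound for the Hessian
  \<open>\<alpha> f\<^sup>\<alpha> (\<alpha> S S\<^sup>t - i)\<close> of \<open>f\<^sup>\<alpha>\<close>. The hypotheses bound \<open>f\<^sup>2\<^sup>\<alpha> S\<^sub>j\<^sup>2\<close> and dominate \<open>f\<^sup>\<alpha> i\<close>, but they say
  nothing about \<open>f\<^sup>\<alpha> S\<^sub>j\<^sup>2\<close>, which differs from the first by the unbounded factor \<open>f\<^sup>-\<^sup>\<alpha>\<close>. That quantity is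
  nevertheless controlled, because it is, up to a constant, the squared slope of the positive
  function \<open>y = f\<^sup>\<alpha>\<^sup>/\<^sup>2\<close> on a line: the bound on \<open>f\<^sup>\<alpha> i\<close> forces \<open>y\<close> to be convex wherever this slope is
  large, so a large slope persists, and then \<open>y y'\<close>, which is \<open>f\<^sup>\<alpha> S\<^sub>j\<close> up to a constant, would exceed
  its bound (\<open>exp_weighted_landau_inequality\<close>, \<open>hessian_powr_bound\<close>).

  The second derivatives of \<open>ln f\<close> exist but need not be continuous in \<open>\<theta>\<close>. The remainder of the
  linearisation is therefore measured, for each \<open>x\<close>, by the largest relative error on a ball of
  radius \<open>\<delta>\<close>. Differentiability at \<open>\<theta>\<^sub>0\<close> makes this error vanish pointwise as \<open>\<delta> \<rightarrow> 0\<close>, domination makes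
  its mean vanish, and Markov's inequality carries this over to sample means
  (\<open>integral_linearization_error_tendsto_0\<close>, \<open>score_linearization\<close>).

  Convergence in distribution in \<open>\<real>\<^sup>p\<close> is reduced to the one-dimensional central limit theorem: its
  test functions are replaced by trigonometric sums
  (\<open>converges_in_distribution_of_characteristic_functions\<close>), and each of those involves only linear
  functionals of the sample mean.

  Finally, the derivatives in \<open>\<theta>\<close> exist for almost every \<open>x\<close> only, so that the score is measurable for
  the completed measure and not necessarily Borel. Limits of difference quotients provide Borel
  functions that agree with the derivatives almost everywhere, and these can be composed with the
  observations.
\<close>

section \<open>A Landau inequality with exponential weight\<close>

text \<open>
  If the squared slope at \<open>0\<close> exceeds \<open>\<kappa>\<close>, then \<open>y'' > 0\<close> there, so the slope grows and stays at least
  \<open>y'(0)\<close> on the whole interval. Then \<open>y(r) \<ge> r y'(0)\<close>, and \<open>r y'(0)\<^sup>2 \<le> y(r) y'(r) \<le> c\<close>.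
\<close>

lemma slope_bound_of_convexity_defect:
  fixes y y1 y2 :: "real \<Rightarrow> real"
  assumes r: "0 < r" and \<kappa>: "0 \<le> \<kappa>" and c: "0 \<le> c"
    and y: "\<And>t. 0 \<le> t \<Longrightarrow> t \<le> r \<Longrightarrow> (y has_real_derivative y1 t) (at t)"
    and y1: "\<And>t. 0 \<le> t \<Longrightarrow> t \<le> r \<Longrightarrow> (y1 has_real_derivative y2 t) (at t)"
    and pos: "\<And>t. 0 \<le> t \<Longrightarrow> t \<le> r \<Longrightarrow> 0 < y t"
    and defect: "\<And>t. 0 \<le> t \<Longrightarrow> t \<le> r \<Longrightarrow> (y1 t)\<^sup>2 - \<kappa> \<le> y t * y2 t"
    and bound: "\<And>t. 0 \<le> t \<Longrightarrow> t \<le> r \<Longrightarrow> y t * y1 t \<le> c"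
    and q: "0 \<le> y1 0"
  shows "(y1 0)\<^sup>2 \<le> \<kappa> + c / r"
proof (rule ccontr)
  assume "\<not> ?thesis"
  then have big: "(y1 0)\<^sup>2 > \<kappa> + c / r" by simp
  moreover have "c / r \<ge> 0" using c r by simp
  ultimately have big': "(y1 0)\<^sup>2 > \<kappa>" by linarith
  have mono: "y1 0 \<le> y1 t" if t: "0 \<le> t" "t \<le> r" for t
  proof (rule ccontr)
    assume "\<not> ?thesis"
    then have less: "y1 t < y1 0" by simp
    have "continuous_on {0..t} y1"
      by (rule DERIV_continuous_on[where D=y2]) (use y1 t in \<open>auto intro: has_field_derivative_at_within\<close>)
    \<comment> \<open>At a maximum of the slope before \<open>t\<close> the slope would be increasing.\<close>
    then obtain m where m: "m \<in> {0..t}" "\<And>s. s \<in> {0..t} \<Longrightarrow> y1 s \<le> y1 m"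
      using continuous_attains_sup[of "{0..t}" y1] t by auto
    have m0: "y1 0 \<le> y1 m" using m t by auto
    then have "m < t" using less m by (cases "m = t") auto
    have "(y1 0)\<^sup>2 \<le> (y1 m)\<^sup>2" using m0 q by (intro power_mono) auto
    then have "0 < y m * y2 m" using defect[of m] m t big' by auto
    then have "0 < y2 m" using pos[of m] m t by (simp add: zero_less_mult_iff)
    from DERIV_pos_inc_right[OF y1[of m] this] m t obtain e where
      e: "e > 0" "\<And>h. h > 0 \<Longrightarrow> h < e \<Longrightarrow> y1 m < y1 (m + h)" by auto
    define h where "h = min (e/2) (t - m)"
    have "h > 0" "h < e" "m + h \<in> {0..t}" using e(1) \<open>m < t\<close> m by (auto simp: h_def min_def)
    then show False using e(2)[of h] m(2)[of "m + h"] by auto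
  qed
  have "\<exists>z. z > 0 \<and> z < r \<and> y r - y 0 = (r - 0) * y1 z"
    using r y by (intro MVT2) auto
  then obtain z where z: "0 < z" "z < r" "y r - y 0 = r * y1 z" by auto
  have "y r \<ge> r * y1 0"
    using z mono[of z] pos[of 0] r
    by (smt (verit) mult_left_mono)
  moreover have "y1 r \<ge> y1 0" using mono[of r] r by auto
  ultimately have "r * y1 0 * y1 0 \<le> y r * y1 r"
    using q r pos[of r] by (intro mult_mono) auto
  also have "\<dots> \<le> c" using bound[of r] r by auto
  finally have "(y1 0)\<^sup>2 \<le> c / r" using r by (simp add: field_simps power2_eq_square)
  then show False using big \<kappa> by linarith
qed

text \<open>
  Landau's inequality bounds a first derivative by the function and its second derivative. This
  variant applies to a logarithm \<open>u\<close> whose derivatives are bounded only after multiplication by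
  \<open>e\<^sup>\<alpha>\<^sup>u\<close>, and it gains a factor \<open>e\<^sup>-\<^sup>\<alpha>\<^sup>u\<close> over the square of the first bound. The function
  \<open>y = e\<^sup>\<alpha>\<^sup>u\<^sup>/\<^sup>2\<close> satisfies \<open>y y'' \<ge> y'\<^sup>2 - \<alpha>\<phi>/2\<close> and \<open>2 y y' \<le> \<alpha>c\<close>, and
  \<open>y'\<^sup>2\<close> is the quantity to be bounded, up to the factor \<open>\<alpha>\<^sup>2/4\<close>.
\<close>

lemma exp_weighted_landau_inequality:
  fixes u u1 u2 :: "real \<Rightarrow> real"
  assumes r: "0 < r" and \<alpha>: "0 < \<alpha>"
    and u: "\<And>t. \<bar>t\<bar> \<le> r \<Longrightarrow> (u has_real_derivative u1 t) (at t)"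
    and u1: "\<And>t. \<bar>t\<bar> \<le> r \<Longrightarrow> (u1 has_real_derivative u2 t) (at t)"
    and b1: "\<And>t. \<bar>t\<bar> \<le> r \<Longrightarrow> \<bar>u1 t * exp (\<alpha> * u t)\<bar> \<le> c"
    and b2: "\<And>t. \<bar>t\<bar> \<le> r \<Longrightarrow> \<bar>u2 t * exp (\<alpha> * u t)\<bar> \<le> \<phi>"
  shows "(u1 0)\<^sup>2 * exp (\<alpha> * u 0) \<le> 2 / \<alpha> * (\<phi> + c / r)"
proof -
  have c0: "0 \<le> c" using b1[of 0] r by linarith
  have p0: "0 \<le> \<phi>" using b2[of 0] r by linarith
  have main: "(v1 0)\<^sup>2 * exp (\<alpha> * v 0) \<le> 2 / \<alpha> * (\<phi> + c / r)"
    if v: "\<And>t. 0 \<le> t \<Longrightarrow> t \<le> r \<Longrightarrow> (v has_real_derivative v1 t) (at t)"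
    and v1: "\<And>t. 0 \<le> t \<Longrightarrow> t \<le> r \<Longrightarrow> (v1 has_real_derivative v2 t) (at t)"
    and c1: "\<And>t. 0 \<le> t \<Longrightarrow> t \<le> r \<Longrightarrow> \<bar>v1 t * exp (\<alpha> * v t)\<bar> \<le> c"
    and c2: "\<And>t. 0 \<le> t \<Longrightarrow> t \<le> r \<Longrightarrow> \<bar>v2 t * exp (\<alpha> * v t)\<bar> \<le> \<phi>"
    and q: "0 \<le> v1 0" for v v1 v2 :: "real \<Rightarrow> real"
  proof -
    define y where "y t = exp (\<alpha> / 2 * v t)" for t
    define y1 where "y1 t = \<alpha> / 2 * v1 t * y t" for t
    define y2 where "y2 t = \<alpha> / 2 * v2 t * y t + (\<alpha> / 2 * v1 t)\<^sup>2 * y t" for t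
    have yy: "y t * y t = exp (\<alpha> * v t)" for t
      by (simp add: y_def flip: exp_add)
    have dy: "(y has_real_derivative y1 t) (at t)" if "0 \<le> t" "t \<le> r" for t
      unfolding y_def y1_def by (auto intro!: derivative_eq_intros v that)
    have dy1: "(y1 has_real_derivative y2 t) (at t)" if "0 \<le> t" "t \<le> r" for t
      unfolding y1_def y2_def
      by (auto intro!: derivative_eq_intros v1 dy that simp: y1_def power2_eq_square algebra_simps)
    have "(y1 0)\<^sup>2 \<le> \<alpha> / 2 * \<phi> + (\<alpha> / 2 * c) / r"
    proof (rule slope_bound_of_convexity_defect[OF r _ _ dy dy1])
      fix t :: real assume t: "0 \<le> t" "t \<le> r"
      show "0 < y t" by (simp add: y_def)
      have "y t * y2 t = \<alpha> / 2 * (v2 t * (y t * y t)) + (y1 t)\<^sup>2"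
        by (simp add: y2_def y1_def power2_eq_square algebra_simps)
      moreover have "\<alpha> / 2 * (v2 t * (y t * y t)) \<ge> \<alpha> / 2 * (- \<phi>)"
        using c2[OF t] \<alpha> unfolding yy by (intro mult_left_mono) auto
      ultimately show "(y1 t)\<^sup>2 - \<alpha> / 2 * \<phi> \<le> y t * y2 t" by simp
      have "y t * y1 t = \<alpha> / 2 * (v1 t * (y t * y t))"
        by (simp add: y1_def algebra_simps)
      also have "\<dots> \<le> \<alpha> / 2 * c"
        using c1[OF t] \<alpha> unfolding yy by (intro mult_left_mono) auto
      finally show "y t * y1 t \<le> \<alpha> / 2 * c" .
    qed (use \<alpha> c0 p0 q in \<open>auto simp: y1_def y_def\<close>)
    moreover have "(y1 0)\<^sup>2 = (\<alpha> / 2)\<^sup>2 * ((v1 0)\<^sup>2 * exp (\<alpha> * v 0))"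
      unfolding yy[symmetric] by (simp add: y1_def power2_eq_square algebra_simps)
    moreover have "\<alpha> / 2 * \<phi> + (\<alpha> / 2 * c) / r = (\<alpha> / 2)\<^sup>2 * (2 / \<alpha> * (\<phi> + c / r))"
      using \<alpha> r by (simp add: field_simps power2_eq_square)
    ultimately have "(\<alpha> / 2)\<^sup>2 * ((v1 0)\<^sup>2 * exp (\<alpha> * v 0)) \<le> (\<alpha>/2)\<^sup>2 * (2 / \<alpha> * (\<phi> + c / r))"
      by simp
    then show ?thesis using \<alpha> by (subst (asm) mult_le_cancel_left_pos) auto
  qed
  show ?thesis
  proof (cases "0 \<le> u1 0")
    case True
    show ?thesis by (rule main[of u u1 u2]) (use u u1 b1 b2 True in auto)
  next
    case False
    have "(- u1 (- 0))\<^sup>2 * exp (\<alpha> * u (- 0)) \<le> 2 / \<alpha> * (\<phi> + c / r)"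
    proof (rule main[of "\<lambda>t. u (- t)" "\<lambda>t. - u1 (- t)" "\<lambda>t. u2 (- t)"])
      fix t :: real assume t: "0 \<le> t" "t \<le> r"
      have "(u has_real_derivative u1 (- t)) (at (- t))" using u[of "-t"] t by simp
      then show "((\<lambda>t. u (- t)) has_real_derivative - u1 (- t)) (at t)"
        by (simp add: DERIV_mirror)
      have "(u1 has_real_derivative u2 (- t)) (at (- t))" using u1[of "-t"] t by simp
      then have "((\<lambda>t. u1 (- t)) has_real_derivative - u2 (- t)) (at t)"
        by (simp add: DERIV_mirror)
      from DERIV_minus[OF this] show "((\<lambda>t. - u1 (- t)) has_real_derivative u2 (- t)) (at t)" by simp
      show "\<bar>- u1 (- t) * exp (\<alpha> * u (- t))\<bar> \<le> c" using b1[of "-t"] t by simp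
      show "\<bar>u2 (- t) * exp (\<alpha> * u (- t))\<bar> \<le> \<phi>" using b2[of "-t"] t by simp
    qed (use False in auto)
    then show ?thesis by simp
  qed
qed

section \<open>Gradients and Hessians\<close>

lemma has_derivative_gradient:
  assumes "h differentiable (at \<theta>)"
  shows "(h has_derivative (\<lambda>v. gradient h \<theta> \<bullet> v)) (at \<theta>)"
proof -
  have d: "(h has_derivative frechet_derivative h (at \<theta>)) (at \<theta>)"
    using assms by (simp add: frechet_derivative_works)
  interpret bounded_linear "frechet_derivative h (at \<theta>)" by (rule has_derivative_bounded_linear[OF d])
  have "frechet_derivative h (at \<theta>) v = gradient h \<theta> \<bullet> v" for v
  proof -
    have "frechet_derivative h (at \<theta>) v = frechet_derivative h (at \<theta>) (\<Sum>j\<in>UNIV. v $ j *\<^sub>R axis j 1)"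
      using basis_expansion[of v] by (simp add: scalar_mult_eq_scaleR)
    also have "\<dots> = gradient h \<theta> \<bullet> v"
      by (simp add: sum scaleR gradient_def inner_vec_def mult.commute)
    finally show ?thesis .
  qed
  then show ?thesis using d by (metis (no_types, lifting) ext)
qed

lemma gradient_eqI:
  assumes "(h has_derivative (\<lambda>v. w \<bullet> v)) (at \<theta>)"
  shows "gradient h \<theta> = w"
  unfolding gradient_def frechet_derivative_at[OF assms, symmetric]
  by (simp add: vec_eq_iff inner_axis)

lemma has_derivative_hessian:
  assumes "gradient h differentiable (at \<theta>)"
  shows "(gradient h has_derivative (\<lambda>v. hessian h \<theta> *v v)) (at \<theta>)"
  using assms unfolding hessian_def by (simp add: jacobian_works)

lemma hessian_eqI:
  assumes "(gradient h has_derivative (\<lambda>v. A *v v)) (at \<theta>)"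
  shows "hessian h \<theta> = A"
  unfolding hessian_def jacobian_def frechet_derivative_at[OF assms, symmetric]
  by (simp add: matrix_of_matrix_vector_mul)

text \<open>
  By the mean value theorem the mixed second difference is \<open>t\<close> times a difference of two gradients,
  and differentiability of the gradient at \<open>a\<close> linearises the latter.
\<close>

lemma second_difference_approximation:
  fixes h :: "real ^ 'p \<Rightarrow> real"
  assumes \<epsilon>: "0 < \<epsilon>" and t: "0 < t" and td: "2 * t < \<delta>"
    and diff: "\<And>x. norm (x - a) < \<delta> \<Longrightarrow> h differentiable (at x)"
    and lin: "\<And>y. norm y < \<delta> \<Longrightarrow> norm (gradient h (a + y) - gradient h a - H *v y) \<le> \<epsilon> * norm y"
    and v: "norm v = 1" and w: "norm w = 1"
  shows "\<bar>h (a + t *\<^sub>R v + t *\<^sub>R w) - h (a + t *\<^sub>R v) - h (a + t *\<^sub>R w) + h a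
           - t\<^sup>2 * ((H *v w) \<bullet> v)\<bar> \<le> 3 * \<epsilon> * t\<^sup>2"
proof -
  define F where "F s = h (a + s *\<^sub>R v + t *\<^sub>R w) - h (a + s *\<^sub>R v)" for s
  define F' where "F' s = gradient h (a + s *\<^sub>R v + t *\<^sub>R w) \<bullet> v - gradient h (a + s *\<^sub>R v) \<bullet> v" for s
  have n1: "norm (s *\<^sub>R v + t *\<^sub>R w) \<le> 2 * t" "norm (s *\<^sub>R v) \<le> t" if "0 \<le> s" "s \<le> t" for s
    using norm_triangle_ineq[of "s *\<^sub>R v" "t *\<^sub>R w"] that v w t by auto
  have dF: "(F has_real_derivative F' s) (at s)" if s: "0 \<le> s" "s \<le> t" for s
  proof -
    have 1: "((\<lambda>s. h (a + s *\<^sub>R v + t *\<^sub>R w)) has_derivative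
        (\<lambda>x. gradient h (a + s *\<^sub>R v + t *\<^sub>R w) \<bullet> (x *\<^sub>R v))) (at s)"
      by (rule has_derivative_compose[OF _ has_derivative_gradient[OF diff], where f="\<lambda>s. a + s *\<^sub>R v + t *\<^sub>R w"])
         (use n1[OF s] td in \<open>auto intro!: derivative_eq_intros simp: add.assoc\<close>)
    have 2: "((\<lambda>s. h (a + s *\<^sub>R v)) has_derivative
        (\<lambda>x. gradient h (a + s *\<^sub>R v) \<bullet> (x *\<^sub>R v))) (at s)"
      by (rule has_derivative_compose[OF _ has_derivative_gradient[OF diff], where f="\<lambda>s. a + s *\<^sub>R v"])
         (use n1[OF s] td t in \<open>auto intro!: derivative_eq_intros simp: add.assoc\<close>)
    show ?thesis
      unfolding F_def[abs_def] has_field_derivative_def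
      by (rule has_derivative_eq_rhs[OF has_derivative_diff[OF 1 2]]) (auto simp: F'_def algebra_simps)
  qed
  have "\<exists>z. z > 0 \<and> z < t \<and> F t - F 0 = (t - 0) * F' z"
    using t dF by (intro MVT2) auto
  then obtain s where s: "0 < s" "s < t" "F t - F 0 = t * F' s" by auto
  define R where "R y = gradient h (a + y) - gradient h a - H *v y" for y
  have R: "norm (R (s *\<^sub>R v + t *\<^sub>R w)) \<le> \<epsilon> * (2 * t)" "norm (R (s *\<^sub>R v)) \<le> \<epsilon> * t"
    using lin[of "s *\<^sub>R v + t *\<^sub>R w"] lin[of "s *\<^sub>R v"] n1[of s] s td t \<epsilon>
    unfolding R_def by (smt (verit) mult_left_mono)+
  have "F' s - t * ((H *v w) \<bullet> v) = (R (s *\<^sub>R v + t *\<^sub>R w) - R (s *\<^sub>R v)) \<bullet> v"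
    by (simp add: F'_def R_def algebra_simps matrix_vector_right_distrib inner_simps
        matrix_vector_mult_scaleR)
  then have "\<bar>F' s - t * ((H *v w) \<bullet> v)\<bar> \<le> norm (R (s *\<^sub>R v + t *\<^sub>R w) - R (s *\<^sub>R v)) * norm v"
    by (simp add: Cauchy_Schwarz_ineq2)
  also have "\<dots> \<le> \<epsilon> * (2 * t) + \<epsilon> * t"
    using R norm_triangle_ineq4[of "R (s *\<^sub>R v + t *\<^sub>R w)" "R (s *\<^sub>R v)"] v by simp
  finally have *: "\<bar>F' s - t * ((H *v w) \<bullet> v)\<bar> \<le> 3 * \<epsilon> * t" by simp
  have "h (a + t *\<^sub>R v + t *\<^sub>R w) - h (a + t *\<^sub>R v) - h (a + t *\<^sub>R w) + h a
           - t\<^sup>2 * ((H *v w) \<bullet> v) = t * (F' s - t * ((H *v w) \<bullet> v))"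
    using s(3) by (simp add: F_def power2_eq_square algebra_simps)
  also have "\<bar>\<dots>\<bar> \<le> t * (3 * \<epsilon> * t)"
    using * t by (simp add: abs_mult)
  finally show ?thesis by (simp add: power2_eq_square algebra_simps)
qed

text \<open>
  The mixed second difference is symmetric in the two directions and approximates both mixed
  derivatives at \<open>a\<close>.
\<close>

lemma hessian_symmetric:
  fixes h :: "real ^ 'p \<Rightarrow> real"
  assumes S: "open S" "a \<in> S" and diff: "\<And>x. x \<in> S \<Longrightarrow> h differentiable (at x)"
    and grad: "gradient h differentiable (at a)"
  shows "transpose (hessian h a) = hessian h a"
proof -
  let ?H = "hessian h a"
  have sym: "(?H *v w) \<bullet> v = (?H *v v) \<bullet> w" if v: "norm v = 1" and w: "norm w = 1" for v w
  proof -
    have "\<bar>(?H *v w) \<bullet> v - (?H *v v) \<bullet> w\<bar> \<le> e" if e: "0 < e" for e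
    proof -
      obtain d1 where d1: "d1 > 0" "\<And>x. norm (x - a) < d1 \<Longrightarrow> x \<in> S"
        using S by (metis open_contains_ball dist_norm mem_ball norm_minus_commute subsetD)
      have "e / 6 > 0" using e by simp
      with has_derivative_hessian[OF grad, unfolded has_derivative_at_alt]
      obtain d2 where d2: "d2 > 0" "\<And>y. norm (y - a) < d2 \<Longrightarrow>
          norm (gradient h y - gradient h a - ?H *v (y - a)) \<le> e / 6 * norm (y - a)"
        by meson
      define d where "d = min d1 d2"
      have d: "d > 0" using d1 d2 by (simp add: d_def)
      have lin: "norm (gradient h (a + y) - gradient h a - ?H *v y) \<le> e / 6 * norm y" if "norm y < d" for y
        using d2(2)[of "a + y"] that by (simp add: d_def)
      have df: "h differentiable (at x)" if "norm (x - a) < d" for x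
        using diff d1(2) that by (simp add: d_def)
      define t where "t = d / 3"
      have t: "0 < t" "2 * t < d" using d by (auto simp: t_def)
      have 1: "\<bar>h (a + t *\<^sub>R v + t *\<^sub>R w) - h (a + t *\<^sub>R v) - h (a + t *\<^sub>R w) + h a
          - t\<^sup>2 * ((?H *v w) \<bullet> v)\<bar> \<le> 3 * (e / 6) * t\<^sup>2"
        by (rule second_difference_approximation[OF \<open>e/6 > 0\<close> t df lin v w])
      have 2: "\<bar>h (a + t *\<^sub>R w + t *\<^sub>R v) - h (a + t *\<^sub>R w) - h (a + t *\<^sub>R v) + h a
          - t\<^sup>2 * ((?H *v v) \<bullet> w)\<bar> \<le> 3 * (e / 6) * t\<^sup>2"
        by (rule second_difference_approximation[OF \<open>e/6 > 0\<close> t df lin w v])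
      have "t\<^sup>2 * \<bar>(?H *v w) \<bullet> v - (?H *v v) \<bullet> w\<bar> = \<bar>t\<^sup>2 * ((?H *v w) \<bullet> v) - t\<^sup>2 * ((?H *v v) \<bullet> w)\<bar>"
        using t by (simp add: abs_mult flip: right_diff_distrib)
      also have "\<dots> \<le> t\<^sup>2 * e"
      proof -
        define \<Delta> where "\<Delta> = h (a + t *\<^sub>R v + t *\<^sub>R w) - h (a + t *\<^sub>R v) - h (a + t *\<^sub>R w) + h a"
        have "h (a + t *\<^sub>R w + t *\<^sub>R v) - h (a + t *\<^sub>R w) - h (a + t *\<^sub>R v) + h a = \<Delta>"
          by (simp add: \<Delta>_def add.assoc add.commute[of "t *\<^sub>R w"])
        then have "\<bar>\<Delta> - t\<^sup>2 * ((?H *v v) \<bullet> w)\<bar> \<le> 3 * (e / 6) * t\<^sup>2"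
          using 2 by simp
        moreover have "\<bar>\<Delta> - t\<^sup>2 * ((?H *v w) \<bullet> v)\<bar> \<le> 3 * (e / 6) * t\<^sup>2"
          unfolding \<Delta>_def by (rule 1)
        moreover have "3 * (e / 6) * t\<^sup>2 = t\<^sup>2 * e / 2" by simp
        ultimately show ?thesis by linarith
      qed
      finally show ?thesis using t by simp
    qed
    then show ?thesis by (metis abs_le_zero_iff dense_ge eq_iff_diff_eq_0 )
  qed
  show ?thesis
  proof (simp add: vec_eq_iff transpose_def, intro allI)
    fix i j
    have "(?H *v axis i 1) \<bullet> axis j 1 = (?H *v axis j 1) \<bullet> axis i 1" by (rule sym) auto
    then show "?H $ j $ i = ?H $ i $ j" by (simp add: inner_axis matrix_vector_mul_component)
  qed
qed

section \<open>Inverses and factorisations of matrices\<close>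

lemma norm_matrix_vector_mult_le:
  fixes A :: "real ^ 'n ^ 'm"
  shows "norm (A *v x) \<le> (\<Sum>i\<in>UNIV. \<Sum>j\<in>UNIV. \<bar>A $ i $ j\<bar>) * norm x"
  using onorm[OF matrix_vector_mul_bounded_linear, of A x] onorm_le_matrix_component_sum[of A]
  by (meson mult_right_mono norm_ge_zero order_trans)

lemma power2_norm_vec: "(norm z)\<^sup>2 = (\<Sum>j\<in>UNIV. (z $ j)\<^sup>2)" for z :: "real ^ 'n"
  unfolding power2_norm_eq_inner inner_vec_def by (simp add: power2_eq_square)

lemma matrix_inv_mult:
  assumes "invertible A"
  shows "A ** matrix_inv A = mat 1" "matrix_inv A ** A = mat 1"
  using someI_ex[OF assms[unfolded invertible_def]] by (simp_all add: matrix_inv_def)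

lemma matrix_inv_unique:
  fixes A B :: "real ^ 'n ^ 'n"
  assumes "A ** B = mat 1" "B ** A = mat 1"
  shows "matrix_inv A = B"
proof -
  have "invertible A" using assms by (auto simp: invertible_def)
  then have "matrix_inv A = matrix_inv A ** (A ** B)" by (simp add: assms)
  also have "\<dots> = B" using matrix_inv_mult(2)[OF \<open>invertible A\<close>] by (simp add: matrix_mul_assoc)
  finally show ?thesis .
qed

lemma matrix_inv_scaleR:
  fixes A :: "real ^ 'n ^ 'n"
  assumes "invertible A" "c \<noteq> 0"
  shows "invertible (c *\<^sub>R A)" "matrix_inv (c *\<^sub>R A) = (1 / c) *\<^sub>R matrix_inv A"
proof -
  have *: "c *\<^sub>R A ** (1 / c) *\<^sub>R matrix_inv A = mat 1" "(1 / c) *\<^sub>R matrix_inv A ** c *\<^sub>R A = mat 1"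
    using assms(2) matrix_inv_mult[OF assms(1)] by (simp_all add: matrix_scalar_ac scalar_matrix_assoc flip: scalar_mult_eq_scaleR)
  then show "invertible (c *\<^sub>R A)" unfolding invertible_def by blast
  show "matrix_inv (c *\<^sub>R A) = (1 / c) *\<^sub>R matrix_inv A" by (rule matrix_inv_unique[OF *])
qed

lemma transpose_matrix_inv:
  fixes A :: "real ^ 'n ^ 'n"
  assumes "invertible A" "transpose A = A"
  shows "transpose (matrix_inv A) = matrix_inv A"
proof (rule matrix_inv_unique[symmetric])
  show "A ** transpose (matrix_inv A) = mat 1" "transpose (matrix_inv A) ** A = mat 1"
    using matrix_inv_mult[OF assms(1)] assms(2) by (metis matrix_transpose_mul transpose_mat)+
qed

text \<open>
  Elimination step of the Cholesky factorisation: subtracting the normalised square of row \<open>i\<close> clears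
  this row, and the Schur complement that remains is again positive semidefinite. If the diagonal
  entry is zero, then so is the whole row, and the division by zero below returns the zero vector.
\<close>

lemma psd_rank_one_sum:
  fixes K :: "real ^ 'p ^ 'p"
  assumes "finite I" and "transpose K = K" and "\<And>z. 0 \<le> z \<bullet> (K *v z)"
    and "\<And>i j. i \<notin> I \<Longrightarrow> K $ i $ j = 0"
  shows "\<exists>a :: 'p \<Rightarrow> real ^ 'p. K = (\<Sum>i\<in>I. outer (a i) (a i))"
  using assms
proof (induction I arbitrary: K rule: finite_induct)
  case empty
  then show ?case by (auto simp: vec_eq_iff)
next
  case (insert i I)
  have symc: "K $ j $ k = K $ k $ j" for j k
    using insert.prems(1) by (metis transpose_def vec_lambda_beta)
  define k where "k = K *v axis i 1"
  have kj: "k $ j = K $ j $ i" for j by (simp add: k_def matrix_vector_mul_component inner_axis)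
  define \<kappa> where "\<kappa> = K $ i $ i"
  have quad: "(z + s *\<^sub>R axis i 1) \<bullet> (K *v (z + s *\<^sub>R axis i 1)) = z \<bullet> (K *v z) + 2 * s * (z \<bullet> k) + s\<^sup>2 * \<kappa>"
    for z s
  proof -
    have "axis i 1 \<bullet> (K *v z) = (K *v axis i 1) \<bullet> z"
      using dot_lmul_matrix[of "axis i 1" K z] insert.prems(1)
      by (metis transpose_matrix_vector)
    then have a: "axis i 1 \<bullet> (K *v z) = z \<bullet> k" by (simp add: k_def inner_commute)
    have b: "axis i 1 \<bullet> k = \<kappa>" by (simp add: \<kappa>_def kj inner_axis' inner_axis)
    have c: "K *v (z + s *\<^sub>R axis i 1) = K *v z + s *\<^sub>R k"
      by (simp add: k_def matrix_vector_right_distrib matrix_vector_mult_scaleR)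
    show ?thesis unfolding c using a b by (simp add: inner_simps power2_eq_square algebra_simps)
  qed
  have k0: "k $ j = 0" if "\<kappa> = 0" for j
  proof (rule ccontr)
    assume ne: "k $ j \<noteq> 0"
    \<comment> \<open>The form at \<open>axis j 1 + s axis i 1\<close> is affine in \<open>s\<close>; this \<open>s\<close> gives it the value \<open>-1\<close>.\<close>
    define q where "q = axis j 1 \<bullet> (K *v axis j 1)"
    have "0 \<le> q + 2 * (- (q + 1) / (2 * k $ j)) * k $ j"
      using insert.prems(2)[of "axis j 1 + (- (q + 1) / (2 * k $ j)) *\<^sub>R axis i 1"]
      unfolding quad that q_def[symmetric] by (simp add: inner_axis' )
    also have "\<dots> = -1" using ne by (simp add: field_simps)
    finally show False by simp
  qed
  have \<kappa>0: "0 \<le> \<kappa>"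
    using insert.prems(2)[of "0 + 1 *\<^sub>R axis i 1"] unfolding quad by simp
  define b where "b = (1 / sqrt \<kappa>) *\<^sub>R k"
  define K' where "K' = K - outer b b"
  have bb: "b $ j * b $ l = k $ j * k $ l / \<kappa>" for j l
    using \<kappa>0 by (simp add: b_def)
  have K'c: "K' $ j $ l = K $ j $ l - k $ j * k $ l / \<kappa>" for j l
    by (simp add: K'_def outer_def bb)
  have "\<exists>a. K' = (\<Sum>i\<in>I. outer (a i) (a i))"
  proof (rule insert.IH)
    show "transpose K' = K'"
      by (simp add: vec_eq_iff transpose_def K'c symc mult.commute)
    show "0 \<le> z \<bullet> (K' *v z)" for z
    proof -
      have ob: "outer b b *v z = (b \<bullet> z) *\<^sub>R b"
        by (simp add: vec_eq_iff outer_def matrix_vector_mult_def inner_vec_def sum_distrib_left sum_distrib_right mult_ac)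
      have "z \<bullet> (K' *v z) = z \<bullet> (K *v z) - (b \<bullet> z)\<^sup>2"
        by (simp add: K'_def matrix_vector_mult_diff_rdistrib ob inner_simps power2_eq_square inner_commute)
      also have "(b \<bullet> z)\<^sup>2 = (z \<bullet> k)\<^sup>2 / \<kappa>"
        using \<kappa>0 by (simp add: b_def power_divide inner_commute)
      also have "z \<bullet> (K *v z) - (z \<bullet> k)\<^sup>2 / \<kappa> =
          (z + (- (z \<bullet> k) / \<kappa>) *\<^sub>R axis i 1) \<bullet> (K *v (z + (- (z \<bullet> k) / \<kappa>) *\<^sub>R axis i 1))"
        unfolding quad by (cases "\<kappa> = 0") (simp_all add: field_simps power2_eq_square)
      also have "\<dots> \<ge> 0" by (rule insert.prems(2))
      finally show ?thesis .
    qed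
    show "K' $ j $ l = 0" if "j \<notin> I" for j l
    proof (cases "j = i")
      case True
      then show ?thesis
        using k0[of l] kj[of j] kj[of l] symc[of j l] by (cases "\<kappa> = 0") (auto simp: K'c \<kappa>_def)
    next
      case False
      then have "K $ j $ l = 0" "K $ j $ i = 0" using that insert.prems(3) by auto
      then show ?thesis by (simp add: K'c kj)
    qed
  qed
  then obtain a where a: "K' = (\<Sum>i\<in>I. outer (a i) (a i))" by blast
  have "K = (\<Sum>l\<in>insert i I. outer ((a(i := b)) l) ((a(i := b)) l))"
  proof -
    have "(\<Sum>l\<in>I. outer ((a(i := b)) l) ((a(i := b)) l)) = K'"
      unfolding a using insert.hyps by (intro sum.cong) auto
    then show ?thesis using insert.hyps by (simp add: K'_def)
  qed
  then show ?case by blast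
qed

lemma psd_matrix_factorization:
  fixes K :: "real ^ 'p ^ 'p"
  assumes "transpose K = K" and "\<And>z. 0 \<le> z \<bullet> (K *v z)"
  obtains A :: "real ^ 'p ^ 'p" where "A ** transpose A = K"
proof -
  obtain a :: "'p \<Rightarrow> real ^ 'p" where a: "K = (\<Sum>i\<in>UNIV. outer (a i) (a i))"
    using psd_rank_one_sum[of UNIV K] assms by auto
  have "(\<chi> j i. a i $ j) ** transpose (\<chi> j i. a i $ j) = K"
    by (simp add: a vec_eq_iff matrix_matrix_mult_def transpose_def outer_def)
  then show thesis using that by blast
qed

section \<open>Integration of vectors and matrices\<close>

lemma borel_measurable_vecI:
  fixes f :: "'a \<Rightarrow> 'b::euclidean_space ^ 'n"
  assumes "\<And>i. (\<lambda>x. f x $ i) \<in> borel_measurable M"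
  shows "f \<in> borel_measurable M"
proof (rule borel_measurable_euclidean_space[THEN iffD2], intro ballI)
  fix b :: "'b ^ 'n" assume "b \<in> Basis"
  then obtain i u where "b = axis i u" by (auto simp: Basis_vec_def)
  then show "(\<lambda>x. f x \<bullet> b) \<in> borel_measurable M"
    using borel_measurable_inner[OF assms[of i] borel_measurable_const[of u]] by (simp add: inner_axis)
qed

lemma measurable_vec_nth:
  fixes F :: "'a \<Rightarrow> 'b::euclidean_space ^ 'n"
  assumes "F \<in> borel_measurable M"
  shows "(\<lambda>x. F x $ i) \<in> borel_measurable M"
  by (rule measurable_compose[OF assms]) (intro borel_measurable_continuous_onI linear_continuous_on bounded_linear_vec_nth)

lemma integrable_vecI:
  fixes f :: "'a \<Rightarrow> 'b::euclidean_space ^ 'n"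
  assumes "\<And>i. integrable M (\<lambda>x. f x $ i)"
  shows "integrable M f"
proof -
  have "linear (axis i :: 'b \<Rightarrow> 'b ^ 'n)" for i
    by (rule linearI) (auto simp: vec_eq_iff axis_def)
  then have bl: "bounded_linear (axis i :: 'b \<Rightarrow> 'b ^ 'n)" for i
    by (rule linear_conv_bounded_linear[THEN iffD1])
  have "f = (\<lambda>x. \<Sum>i\<in>UNIV. axis i (f x $ i))"
    by (auto simp: fun_eq_iff vec_eq_iff axis_def if_distrib[of "\<lambda>v. v $ _"] cong: if_cong)
  moreover have "integrable M (\<lambda>x. \<Sum>i\<in>UNIV. axis i (f x $ i))"
    by (intro Bochner_Integration.integrable_sum integrable_bounded_linear[OF bl] assms)
  ultimately show ?thesis by simp
qed

lemma integral_vec_nth: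
  fixes f :: "'a \<Rightarrow> 'b::euclidean_space ^ 'n"
  assumes "integrable M f"
  shows "(LINT x|M. f x) $ i = (LINT x|M. f x $ i)"
  using integral_bounded_linear[OF bounded_linear_vec_nth assms, of i] by simp

lemma integral_components:
  fixes H :: "'a \<Rightarrow> real ^ 'n ^ 'm"
  assumes "integrable M H"
  shows "integrable M (\<lambda>x. H x $ i $ j)" "(LINT x|M. H x) $ i $ j = (LINT x|M. H x $ i $ j)"
proof -
  have row: "integrable M (\<lambda>x. H x $ i)"
    using integrable_bounded_linear[OF bounded_linear_vec_nth assms] by simp
  show "integrable M (\<lambda>x. H x $ i $ j)" using integrable_bounded_linear[OF bounded_linear_vec_nth row] by simp
  show "(LINT x|M. H x) $ i $ j = (LINT x|M. H x $ i $ j)" by (simp add: integral_vec_nth assms row)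
qed

lemma (in prob_space) integrable_of_square_norm:
  fixes y :: "'a \<Rightarrow> real ^ 'n"
  assumes [measurable]: "y \<in> borel_measurable M" and sq: "integrable M (\<lambda>x. (norm (y x))\<^sup>2)"
  shows "integrable M y"
proof -
  have "integrable M (\<lambda>x. norm (y x))"
    by (rule square_integrable_imp_integrable) (use sq in auto)
  then show ?thesis by (simp add: integrable_norm_iff)
qed

lemma integrable_outer:
  fixes y :: "'a \<Rightarrow> real ^ 'p"
  assumes [measurable]: "y \<in> borel_measurable M" and sq: "integrable M (\<lambda>x. (norm (y x))\<^sup>2)"
  shows "integrable M (\<lambda>x. outer (y x) (y x))"
proof (intro integrable_vecI)
  fix i j
  have [measurable]: "(\<lambda>x. y x $ k) \<in> borel_measurable M" for k
    by (rule measurable_compose[OF assms(1)]) (intro borel_measurable_continuous_onI continuous_intros)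
  have "\<bar>y x $ i * y x $ j\<bar> \<le> (norm (y x))\<^sup>2" for x
    unfolding abs_mult power2_eq_square by (intro mult_mono component_le_norm_cart) auto
  then show "integrable M (\<lambda>x. outer (y x) (y x) $ i $ j)"
    unfolding outer_def by (intro Bochner_Integration.integrable_bound[OF sq]) auto
qed

text \<open>
  Second moment matrices are Gram matrices, with \<open>z\<^sup>t E[y y\<^sup>t] z = E[(z \<bullet> y)\<^sup>2]\<close>.
\<close>

lemma integral_outer_psd:
  fixes y :: "'a \<Rightarrow> real ^ 'p"
  assumes int: "integrable M (\<lambda>x. outer (y x) (y x))"
  shows "transpose (LINT x|M. outer (y x) (y x)) = (LINT x|M. outer (y x) (y x))"
    and "0 \<le> z \<bullet> ((LINT x|M. outer (y x) (y x)) *v z)"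
proof -
  have e: "(LINT x|M. outer (y x) (y x)) $ j $ k = (LINT x|M. y x $ j * y x $ k)" for j k
    by (simp add: integral_components(2)[OF int]) (simp add: outer_def)
  show "transpose (LINT x|M. outer (y x) (y x)) = (LINT x|M. outer (y x) (y x))"
    by (simp add: vec_eq_iff transpose_def e mult.commute)
  have ent': "integrable M (\<lambda>x. y x $ j * y x $ k)" for j k using integral_components(1)[OF int, of j k] by (simp add: outer_def)
  have "z \<bullet> ((LINT x|M. outer (y x) (y x)) *v z) = (\<Sum>j\<in>UNIV. \<Sum>k\<in>UNIV. z $ j * z $ k * (LINT x|M. y x $ j * y x $ k))"
    by (simp add: inner_vec_def matrix_vector_mult_def e sum_distrib_left mult_ac)
  also have "\<dots> = (LINT x|M. (\<Sum>j\<in>UNIV. \<Sum>k\<in>UNIV. z $ j * z $ k * (y x $ j * y x $ k)))"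
    using ent' by simp
  also have "(\<lambda>x. \<Sum>j\<in>UNIV. \<Sum>k\<in>UNIV. z $ j * z $ k * (y x $ j * y x $ k)) = (\<lambda>x. (z \<bullet> y x)\<^sup>2)"
    by (simp add: fun_eq_iff inner_vec_def power2_eq_square sum_product mult_ac)
  also have "(LINT x|M. (z \<bullet> y x)\<^sup>2) \<ge> 0" by simp
  finally show "0 \<le> z \<bullet> ((LINT x|M. outer (y x) (y x)) *v z)" .
qed

section \<open>Convergence in distribution and trigonometric sums\<close>

text \<open>
  A phase \<open>b\<close> makes sines, cosines and constants instances of one generator, and the class is closed
  under products by the addition theorem.
\<close>

inductive trig_sum :: "(real ^ 'p \<Rightarrow> real) \<Rightarrow> bool" where
  cosine: "trig_sum (\<lambda>x. a * cos (t \<bullet> x + b))"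
| add: "trig_sum f \<Longrightarrow> trig_sum g \<Longrightarrow> trig_sum (\<lambda>x. f x + g x)"

lemma trig_sum_mult:
  fixes f g :: "real ^ 'p \<Rightarrow> real"
  assumes "trig_sum f" "trig_sum g"
  shows "trig_sum (\<lambda>x. f x * g x)"
  using assms(1)
proof induction
  case (cosine a t b)
  show ?case using assms(2)
  proof induction
    case (cosine a' t' b')
    have "(\<lambda>x. a * cos (t \<bullet> x + b) * (a' * cos (t' \<bullet> x + b'))) =
      (\<lambda>x. (a * a' / 2) * cos ((t - t') \<bullet> x + (b - b')) + (a * a' / 2) * cos ((t + t') \<bullet> x + (b + b')))"
    proof
      fix x :: "real ^ 'p"
      have "cos (t \<bullet> x + b) * cos (t' \<bullet> x + b') =
        (cos ((t \<bullet> x + b) - (t' \<bullet> x + b')) + cos ((t \<bullet> x + b) + (t' \<bullet> x + b'))) / 2"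
        by (rule cos_times_cos)
      also have "(t \<bullet> x + b) - (t' \<bullet> x + b') = (t - t') \<bullet> x + (b - b')" by (simp add: inner_simps)
      also have "(t \<bullet> x + b) + (t' \<bullet> x + b') = (t + t') \<bullet> x + (b + b')" by (simp add: inner_simps)
      finally have e: "cos (t \<bullet> x + b) * cos (t' \<bullet> x + b') =
        (cos ((t - t') \<bullet> x + (b - b')) + cos ((t + t') \<bullet> x + (b + b'))) / 2" .
      have "a * cos (t \<bullet> x + b) * (a' * cos (t' \<bullet> x + b')) =
        a * a' * (cos (t \<bullet> x + b) * cos (t' \<bullet> x + b'))" by simp
      then show "a * cos (t \<bullet> x + b) * (a' * cos (t' \<bullet> x + b')) =
        (a * a' / 2) * cos ((t - t') \<bullet> x + (b - b')) + (a * a' / 2) * cos ((t + t') \<bullet> x + (b + b'))"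
        unfolding e by (simp add: distrib_left add_divide_distrib)
    qed
    then show ?case by (simp only: trig_sum.intros)
  next
    case (add f g)
    then show ?case by (simp add: distrib_left trig_sum.add)
  qed
next
  case (add f g)
  then show ?case by (simp add: distrib_right trig_sum.add)
qed

lemma trig_sum_const: "trig_sum (\<lambda>_. c)"
  using trig_sum.cosine[of c 0 0] by simp

lemma trig_sum_continuous: "trig_sum f \<Longrightarrow> continuous_on UNIV f"
  by (induction rule: trig_sum.induct) (auto intro!: continuous_intros)

lemma trig_sum_measurable [measurable_dest]: "trig_sum f \<Longrightarrow> f \<in> borel_measurable borel"
  by (intro borel_measurable_continuous_onI trig_sum_continuous)

lemma trig_sum_bounded: "trig_sum f \<Longrightarrow> \<exists>B. \<forall>x. \<bar>f x\<bar> \<le> B"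
proof (induction rule: trig_sum.induct)
  case (cosine a t b)
  show ?case by (rule exI[of _ "\<bar>a\<bar>"]) (simp add: abs_mult mult_left_le)
next
  case (add f g)
  then obtain A B where "\<And>x. \<bar>f x\<bar> \<le> A" "\<And>x. \<bar>g x\<bar> \<le> B" by blast
  then have "\<bar>f x + g x\<bar> \<le> A + B" for x by (meson abs_triangle_ineq add_mono order_trans)
  then show ?case by blast
qed

text \<open>
  The map \<open>x \<mapsto> (sin (x\<^sub>j / R))\<^sub>j\<close> sends the whole space into a compact cube and is inverted by \<open>arcsin\<close>
  on the ball of radius \<open>R\<close>. Stone-Weierstrass approximates the transported function on the cube, and
  pulling back gives a trigonometric sum that is close to \<open>h\<close> on the ball and bounded everywhere.
\<close>

lemma trig_sum_approximation:
  fixes h :: "real ^ 'p \<Rightarrow> real"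
  assumes h: "continuous_on UNIV h" "\<And>x. \<bar>h x\<bar> \<le> B" and R: "0 < R" and \<epsilon>: "0 < \<epsilon>"
  obtains q where "trig_sum q" "\<And>x. \<bar>q x\<bar> \<le> B + \<epsilon>" "\<And>x. norm x \<le> R \<Longrightarrow> \<bar>h x - q x\<bar> \<le> \<epsilon>"
proof -
  define s :: "real ^ 'p \<Rightarrow> real ^ 'p" where "s x = (\<chi> j. sin (x $ j / R))" for x
  define S :: "(real ^ 'p) set" where "S = cbox (\<chi> j. -1) (\<chi> j. 1)"
  define H where "H y = h (\<chi> j. R * arcsin (y $ j))" for y :: "real ^ 'p"
  have s_in: "s x \<in> S" for x by (simp add: S_def mem_box_cart s_def)
  have "continuous_on S (\<lambda>y. \<chi> j. R * arcsin (y $ j))"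
    by (intro continuous_intros continuous_on_vec_lambda) (auto simp: S_def mem_box_cart)
  then have H: "continuous_on S H"
    unfolding H_def by (rule continuous_on_compose2[OF h(1)]) auto
  let ?P = "\<lambda>g. continuous_on S g \<and> trig_sum (\<lambda>x. g (s x))"
  have coord: "?P (\<lambda>y. y $ j)" for j
  proof -
    have "sin (x $ j / R) = 1 * cos (axis j (1 / R) \<bullet> x + (- pi / 2))" for x :: "real ^ 'p"
      by (simp add: inner_axis' cos_diff)
    then have "(\<lambda>x. s x $ j) = (\<lambda>x. 1 * cos (axis j (1 / R) \<bullet> x + (- pi / 2)))"
      by (simp add: s_def)
    then have "trig_sum (\<lambda>x. s x $ j)" by (simp only: trig_sum.cosine)
    then show ?thesis by (auto intro!: continuous_intros)
  qed
  have "\<exists>g. ?P g \<and> (\<forall>x\<in>S. \<bar>H x - g x\<bar> < \<epsilon>)"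
  proof (rule Stone_Weierstrass_HOL[where P = ?P])
    show "compact S" by (simp add: S_def)
    show "\<exists>f. ?P f \<and> f x \<noteq> f y" if xy: "x \<in> S \<and> y \<in> S \<and> x \<noteq> y" for x y
    proof -
      obtain j where "x $ j \<noteq> y $ j" using xy by (auto simp: vec_eq_iff)
      with coord[of j] show ?thesis by blast
    qed
  qed (auto intro!: continuous_intros H \<epsilon> trig_sum_const trig_sum.add trig_sum_mult)
  then obtain g where g: "?P g" "\<And>x. x \<in> S \<Longrightarrow> \<bar>H x - g x\<bar> < \<epsilon>" by blast
  show thesis
  proof (rule that[of "\<lambda>x. g (s x)"])
    show "trig_sum (\<lambda>x. g (s x))" using g by simp
    show "\<bar>g (s x)\<bar> \<le> B + \<epsilon>" for x
    proof -
      have "\<bar>H (s x)\<bar> \<le> B" unfolding H_def by (rule h(2))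
      then show ?thesis using g(2)[OF s_in[of x]] by linarith
    qed
    show "\<bar>h x - g (s x)\<bar> \<le> \<epsilon>" if x: "norm x \<le> R" for x
    proof -
      have "\<bar>x $ j\<bar> \<le> R" for j using component_le_norm_cart[of x j] x by linarith
      then have "\<bar>x $ j / R\<bar> \<le> 1" for j using R by simp
      moreover have "1 \<le> pi / 2" using pi_gt3 by simp
      ultimately have "- (pi / 2) \<le> x $ j / R" "x $ j / R \<le> pi / 2" for j
        unfolding abs_le_iff by (smt (verit))+
      then have "R * arcsin (sin (x $ j / R)) = x $ j" for j
        using R by (subst arcsin_sin) auto
      then have "H (s x) = h x" by (simp add: H_def s_def)
      then show ?thesis using g(2)[OF s_in[of x]] by simp
    qed
  qed
qed

text \<open>
  On the ball the integrands differ by \<open>\<epsilon>\<close>, off the ball by at most \<open>2 B + \<epsilon>\<close>.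
\<close>

lemma (in prob_space) expectation_approximation:
  fixes Y :: "'a \<Rightarrow> 'b::real_normed_vector" and h q :: "'b \<Rightarrow> real"
  assumes [measurable]: "Y \<in> borel_measurable M" "h \<in> borel_measurable borel" "q \<in> borel_measurable borel"
    and h: "\<And>x. \<bar>h x\<bar> \<le> B" and q: "\<And>x. \<bar>q x\<bar> \<le> B + \<epsilon>"
    and approx: "\<And>x. norm x \<le> R \<Longrightarrow> \<bar>h x - q x\<bar> \<le> \<epsilon>"
    and \<epsilon>: "0 < \<epsilon>" "\<epsilon> \<le> 1" and tail: "prob {\<omega> \<in> space M. R < norm (Y \<omega>)} \<le> \<epsilon>"
  shows "\<bar>expectation (\<lambda>\<omega>. h (Y \<omega>)) - expectation (\<lambda>\<omega>. q (Y \<omega>))\<bar> \<le> \<epsilon> * (2 * B + 2)"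
proof -
  let ?A = "{\<omega> \<in> space M. R < norm (Y \<omega>)}"
  have B: "0 \<le> B" using h by (meson abs_ge_zero order_trans)
  have ih: "integrable M (\<lambda>\<omega>. h (Y \<omega>))" by (rule integrable_const_bound[of _ B]) (auto simp: h)
  have iq: "integrable M (\<lambda>\<omega>. q (Y \<omega>))" by (rule integrable_const_bound[of _ "B + \<epsilon>"]) (auto simp: q)
  have A[measurable]: "?A \<in> sets M" by measurable
  have "\<bar>expectation (\<lambda>\<omega>. h (Y \<omega>)) - expectation (\<lambda>\<omega>. q (Y \<omega>))\<bar> = \<bar>expectation (\<lambda>\<omega>. h (Y \<omega>) - q (Y \<omega>))\<bar>"
    using ih iq by simp
  also have "\<dots> \<le> expectation (\<lambda>\<omega>. \<bar>h (Y \<omega>) - q (Y \<omega>)\<bar>)"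
    using integral_abs_bound by blast
  also have "\<dots> \<le> expectation (\<lambda>\<omega>. \<epsilon> + (2 * B + \<epsilon>) * indicator ?A \<omega>)"
  proof (rule integral_mono)
    show "integrable M (\<lambda>\<omega>. \<bar>h (Y \<omega>) - q (Y \<omega>)\<bar>)" using ih iq by simp
    show "integrable M (\<lambda>\<omega>. \<epsilon> + (2 * B + \<epsilon>) * indicator ?A \<omega>)"
      by (intro integrable_const_bound[of _ "\<epsilon> + (2 * B + \<epsilon>)"]) (use B \<epsilon> in \<open>auto simp: indicator_def\<close>)
    show "\<bar>h (Y \<omega>) - q (Y \<omega>)\<bar> \<le> \<epsilon> + (2 * B + \<epsilon>) * indicator ?A \<omega>" if "\<omega> \<in> space M" for \<omega>
      using that h[of "Y \<omega>"] q[of "Y \<omega>"] approx[of "Y \<omega>"] \<epsilon> B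
      by (cases "norm (Y \<omega>) \<le> R") (auto simp: indicator_def)
  qed
  also have "\<dots> = \<epsilon> + (2 * B + \<epsilon>) * prob ?A"
    by (subst Bochner_Integration.integral_add) (auto simp: prob_space less_top[symmetric])
  also have "\<dots> \<le> \<epsilon> + (2 * B + 1) * \<epsilon>"
    using tail \<epsilon> B by (intro add_left_mono mult_mono) auto
  finally show ?thesis by (simp add: algebra_simps)
qed

lemma (in prob_space) norm_tail_le:
  fixes Y :: "'a \<Rightarrow> 'b::real_normed_vector"
  assumes [measurable]: "Y \<in> borel_measurable M" and \<epsilon>: "0 < \<epsilon>"
  obtains R where "prob {\<omega> \<in> space M. R < norm (Y \<omega>)} \<le> \<epsilon>"
proof -
  let ?A = "\<lambda>n::nat. {\<omega> \<in> space M. real n < norm (Y \<omega>)}"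
  have "(\<lambda>n. prob (?A n)) \<longlonglongrightarrow> prob (\<Inter>n. ?A n)"
    by (rule finite_Lim_measure_decseq) (auto simp: decseq_def)
  also have "(\<Inter>n. ?A n) = {}"
    by (auto simp: not_less dest: spec) (meson real_arch_simple not_less)
  finally have "\<forall>\<^sub>F n in sequentially. prob (?A n) < \<epsilon>"
    using \<epsilon> by (intro order_tendstoD(2)[where y=0]) auto
  then obtain n where "prob (?A n) < \<epsilon>" by (auto simp: eventually_sequentially)
  then show thesis using that by (meson less_imp_le)
qed

text \<open>
  Tightness reduces a bounded continuous test function to a trigonometric sum, whose expectation is a
  finite combination of the ones that converge by hypothesis.
\<close>

theorem converges_in_distribution_of_characteristic_functions:
  fixes Z :: "nat \<Rightarrow> 'w \<Rightarrow> real ^ 'p"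
  assumes P: "prob_space P" and N: "prob_space N" "sets N = sets borel"
    and Z: "\<And>n. Z n \<in> borel_measurable P"
    and lim: "\<And>t b. (\<lambda>n. LINT \<omega>|P. cos (t \<bullet> Z n \<omega> + b)) \<longlonglongrightarrow> (LINT y|N. cos (t \<bullet> y + b))"
    and tight: "\<And>\<epsilon>. 0 < \<epsilon> \<Longrightarrow> \<exists>R. \<forall>\<^sub>F n in sequentially. measure P {\<omega> \<in> space P. R < norm (Z n \<omega>)} \<le> \<epsilon>"
  shows "converges_in_distribution P Z N"
  unfolding converges_in_distribution_def
proof (intro allI impI)
  fix h :: "real ^ 'p \<Rightarrow> real"
  assume h: "continuous_on UNIV h" and "bounded (range h)"
  then obtain B where B: "\<And>x. \<bar>h x\<bar> \<le> B" by (auto simp: bounded_iff)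
  then have B0: "0 \<le> B" by (meson abs_ge_zero order_trans)
  interpret P: prob_space P by fact
  interpret N: prob_space N by fact
  note [measurable] = Z
  have id[measurable]: "(\<lambda>x. x) \<in> borel_measurable N" using N(2) by (simp add: measurable_ident_sets)
  have h_meas[measurable]: "h \<in> borel_measurable borel" using h by (rule borel_measurable_continuous_onI)
  have limq: "(\<lambda>n. LINT \<omega>|P. q (Z n \<omega>)) \<longlonglongrightarrow> (LINT y|N. q y)" if "trig_sum q" for q
    using that
  proof induction
    case (cosine a t b)
    show ?case by (simp add: tendsto_mult_left lim)
  next
    case (add f g)
    note [measurable] = trig_sum_measurable[OF add.hyps(1)] trig_sum_measurable[OF add.hyps(2)]
    obtain A B where AB: "\<And>x. \<bar>f x\<bar> \<le> A" "\<And>x. \<bar>g x\<bar> \<le> B"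
      using add.hyps trig_sum_bounded by metis
    have "integrable P (\<lambda>\<omega>. f (Z n \<omega>))" for n
      by (rule P.integrable_const_bound[where B=A]) (auto simp: AB)
    moreover have "integrable P (\<lambda>\<omega>. g (Z n \<omega>))" for n
      by (rule P.integrable_const_bound[where B=B]) (auto simp: AB)
    moreover have "integrable N f" "integrable N g"
      by (rule N.integrable_const_bound[where B=A] N.integrable_const_bound[where B=B];
          use AB measurable_compose[OF id] in \<open>auto simp: add.hyps trig_sum_measurable\<close>)+
    ultimately show ?case using add.IH by (simp add: tendsto_add)
  qed
  show "(\<lambda>n. LINT \<omega>|P. h (Z n \<omega>)) \<longlonglongrightarrow> (LINT y|N. h y)"
  proof (rule tendstoI)
    fix e :: real assume e: "0 < e"
    define \<epsilon> where "\<epsilon> = min 1 (e / (3 * (2 * B + 2)))"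
    have \<epsilon>: "0 < \<epsilon>" "\<epsilon> \<le> 1" using e B0 by (auto simp: \<epsilon>_def)
    have "\<epsilon> * (2 * B + 2) \<le> e / (3 * (2 * B + 2)) * (2 * B + 2)"
      using B0 by (intro mult_right_mono) (auto simp: \<epsilon>_def)
    also have "\<dots> = e / 3"
    proof -
      have "e / (3 * D) * D = e / 3" if "D \<noteq> 0" for D :: real using that by simp
      then show ?thesis using B0 by (metis add_nonneg_pos less_irrefl mult_nonneg_nonneg zero_less_numeral zero_le_numeral)
    qed
    finally have \<epsilon>e: "\<epsilon> * (2 * B + 2) \<le> e / 3" .
    obtain R1 where R1: "\<forall>\<^sub>F n in sequentially. measure P {\<omega> \<in> space P. R1 < norm (Z n \<omega>)} \<le> \<epsilon>"
      using tight[OF \<epsilon>(1)] by blast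
    obtain R2 where R2: "N.prob {y \<in> space N. R2 < norm y} \<le> \<epsilon>"
      using N.norm_tail_le[OF id \<epsilon>(1)] by blast
    define R where "R = max 1 (max R1 R2)"
    have R: "0 < R" "R1 \<le> R" "R2 \<le> R" by (auto simp: R_def)
    have tailP: "\<forall>\<^sub>F n in sequentially. P.prob {\<omega> \<in> space P. R < norm (Z n \<omega>)} \<le> \<epsilon>"
      using R1
    proof eventually_elim
      case (elim n)
      have "P.prob {\<omega> \<in> space P. R < norm (Z n \<omega>)} \<le> P.prob {\<omega> \<in> space P. R1 < norm (Z n \<omega>)}"
        using R by (intro P.finite_measure_mono) auto
      then show ?case using elim by simp
    qed
    have sN: "{y \<in> space N. c < norm y} \<in> sets N" for c :: real
      using id by measurable
    have "N.prob {y \<in> space N. R < norm y} \<le> N.prob {y \<in> space N. R2 < norm y}"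
      using R by (intro N.finite_measure_mono sN) auto
    then have tailN: "N.prob {y \<in> space N. R < norm y} \<le> \<epsilon>" using R2 by simp
    obtain q where q: "trig_sum q" "\<And>x. \<bar>q x\<bar> \<le> B + \<epsilon>" "\<And>x. norm x \<le> R \<Longrightarrow> \<bar>h x - q x\<bar> \<le> \<epsilon>"
      by (rule trig_sum_approximation[OF h B R(1) \<epsilon>(1)]) blast
    note qm[measurable] = trig_sum_measurable[OF q(1)]
    have 1: "\<bar>(LINT y|N. h y) - (LINT y|N. q y)\<bar> \<le> e / 3"
      using N.expectation_approximation[OF id h_meas qm B q(2,3) \<epsilon> tailN] \<epsilon>e by simp
    have "\<forall>\<^sub>F n in sequentially. norm ((LINT \<omega>|P. q (Z n \<omega>)) - (LINT y|N. q y)) < e / 3"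
      using tendstoD[OF limq[OF q(1)], of "e / 3"] e by (simp add: dist_norm)
    with tailP show "\<forall>\<^sub>F n in sequentially. dist (LINT \<omega>|P. h (Z n \<omega>)) (LINT y|N. h y) < e"
    proof eventually_elim
      case (elim n)
      show ?case
        using P.expectation_approximation[OF Z h_meas qm B q(2,3) \<epsilon> elim(1)] 1 elim(2) \<epsilon>e
        unfolding real_norm_def dist_real_def by linarith
    qed
  qed
qed

lemma abs_cos_diff_le: "\<bar>cos a - cos b\<bar> \<le> \<bar>a - b\<bar>" for a b :: real
proof -
  have "\<bar>cos a - cos b\<bar> = 2 * (\<bar>sin ((a + b) / 2)\<bar> * \<bar>sin ((b - a) / 2)\<bar>)"
    by (simp add: cos_diff_cos abs_mult)
  also have "\<dots> \<le> 2 * (1 * \<bar>(b - a) / 2\<bar>)"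
    by (intro mult_left_mono mult_mono abs_sin_x_le_abs_x) auto
  finally show ?thesis by simp
qed

text \<open>
  Slutsky's lemma in the form needed here: the cosine is Lipschitz and bounded, so a perturbation
  that vanishes in probability changes neither the characteristic functions in the limit nor
  tightness.
\<close>

lemma (in prob_space) converges_in_distribution_perturbation:
  fixes Z W :: "nat \<Rightarrow> 'a \<Rightarrow> real ^ 'p"
  assumes N: "prob_space N" "sets N = sets borel"
    and [measurable]: "\<And>n. Z n \<in> borel_measurable M" "\<And>n. W n \<in> borel_measurable M"
    and lim: "\<And>t b. (\<lambda>n. expectation (\<lambda>\<omega>. cos (t \<bullet> W n \<omega> + b))) \<longlonglongrightarrow> (LINT y|N. cos (t \<bullet> y + b))"
    and tight: "\<And>\<epsilon>. 0 < \<epsilon> \<Longrightarrow> \<exists>R. \<forall>\<^sub>F n in sequentially. prob {\<omega> \<in> space M. R < norm (W n \<omega>)} \<le> \<epsilon>"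
    and small: "\<And>\<epsilon>. 0 < \<epsilon> \<Longrightarrow> (\<lambda>n. prob {\<omega> \<in> space M. \<epsilon> < norm (Z n \<omega> - W n \<omega>)}) \<longlonglongrightarrow> 0"
  shows "converges_in_distribution M Z N"
proof (rule converges_in_distribution_of_characteristic_functions[OF prob_space_axioms N])
  fix t :: "real ^ 'p" and b :: real
  have "(\<lambda>n. expectation (\<lambda>\<omega>. cos (t \<bullet> Z n \<omega> + b)) - expectation (\<lambda>\<omega>. cos (t \<bullet> W n \<omega> + b))) \<longlonglongrightarrow> 0"
  proof (rule tendstoI)
    fix e :: real assume e: "0 < e"
    define \<epsilon> where "\<epsilon> = e / (2 * (norm t + 1))"
    have t1: "norm t + 1 > 0" by (simp add: add_nonneg_pos)
    have \<epsilon>: "0 < \<epsilon>" using e t1 by (simp add: \<epsilon>_def)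
    have "norm t * \<epsilon> \<le> (norm t + 1) * \<epsilon>" using \<epsilon> by (simp add: mult_right_mono)
    also have "\<dots> = e / 2"
    proof -
      have "D * (e / (2 * D)) = e / 2" if "D > 0" for D :: real using that by simp
      then show ?thesis using t1 unfolding \<epsilon>_def by blast
    qed
    finally have te: "norm t * \<epsilon> \<le> e / 2" .
    have "\<forall>\<^sub>F n in sequentially. prob {\<omega> \<in> space M. \<epsilon> < norm (Z n \<omega> - W n \<omega>)} < e / 4"
      using e by (intro order_tendstoD(2)[OF small[OF \<epsilon>]]) auto
    then show "\<forall>\<^sub>F n in sequentially. dist (expectation (\<lambda>\<omega>. cos (t \<bullet> Z n \<omega> + b)) - expectation (\<lambda>\<omega>. cos (t \<bullet> W n \<omega> + b))) 0 < e"
    proof eventually_elim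
      case (elim n)
      let ?A = "{\<omega> \<in> space M. \<epsilon> < norm (Z n \<omega> - W n \<omega>)}"
      have i: "integrable M (\<lambda>\<omega>. cos (t \<bullet> Z n \<omega> + b))" "integrable M (\<lambda>\<omega>. cos (t \<bullet> W n \<omega> + b))"
        by (auto intro!: integrable_const_bound[where B=1])
      have "dist (expectation (\<lambda>\<omega>. cos (t \<bullet> Z n \<omega> + b)) - expectation (\<lambda>\<omega>. cos (t \<bullet> W n \<omega> + b))) 0
          = \<bar>expectation (\<lambda>\<omega>. cos (t \<bullet> Z n \<omega> + b) - cos (t \<bullet> W n \<omega> + b))\<bar>"
        using i by simp
      also have "\<dots> \<le> expectation (\<lambda>\<omega>. \<bar>cos (t \<bullet> Z n \<omega> + b) - cos (t \<bullet> W n \<omega> + b)\<bar>)"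
        by (rule integral_abs_bound)
      also have "\<dots> \<le> expectation (\<lambda>\<omega>. norm t * \<epsilon> + 2 * indicator ?A \<omega>)"
      proof (rule integral_mono)
        show "integrable M (\<lambda>\<omega>. norm t * \<epsilon> + 2 * indicator ?A \<omega>)"
          by (rule integrable_const_bound[where B="norm t * \<epsilon> + 2"]) (use \<epsilon> in \<open>auto simp: indicator_def\<close>)
        fix \<omega> assume \<omega>: "\<omega> \<in> space M"
        show "\<bar>cos (t \<bullet> Z n \<omega> + b) - cos (t \<bullet> W n \<omega> + b)\<bar> \<le> norm t * \<epsilon> + 2 * indicator ?A \<omega>"
        proof (cases "\<omega> \<in> ?A")
          case True
          moreover have "\<bar>cos (t \<bullet> Z n \<omega> + b) - cos (t \<bullet> W n \<omega> + b)\<bar> \<le> 2"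
            using abs_cos_le_one[of "t \<bullet> Z n \<omega> + b"] abs_cos_le_one[of "t \<bullet> W n \<omega> + b"] by linarith
          moreover have "0 \<le> norm t * \<epsilon>" using \<epsilon> by simp
          ultimately show ?thesis by (simp only: indicator_simps)
        next
          case False
          have "\<bar>cos (t \<bullet> Z n \<omega> + b) - cos (t \<bullet> W n \<omega> + b)\<bar> \<le> \<bar>(t \<bullet> Z n \<omega> + b) - (t \<bullet> W n \<omega> + b)\<bar>"
            by (rule abs_cos_diff_le)
          also have "\<dots> = \<bar>t \<bullet> (Z n \<omega> - W n \<omega>)\<bar>" by (simp add: inner_diff_right)
          also have "\<dots> \<le> norm t * norm (Z n \<omega> - W n \<omega>)" by (rule Cauchy_Schwarz_ineq2)
          also have "\<dots> \<le> norm t * \<epsilon>" using False \<omega> by (intro mult_left_mono) auto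
          finally show ?thesis using False by simp
        qed
      qed (use i in auto)
      also have "\<dots> = norm t * \<epsilon> + 2 * prob ?A"
        by (subst Bochner_Integration.integral_add) (auto simp: prob_space less_top[symmetric])
      also have "\<dots> < e" using elim te by linarith
      finally show ?case .
    qed
  qed
  from tendsto_add[OF this lim[of t b]]
  show "(\<lambda>n. expectation (\<lambda>\<omega>. cos (t \<bullet> Z n \<omega> + b))) \<longlonglongrightarrow> (LINT y|N. cos (t \<bullet> y + b))" by simp
next
  fix \<epsilon> :: real assume \<epsilon>: "0 < \<epsilon>"
  then obtain R where R: "\<forall>\<^sub>F n in sequentially. prob {\<omega> \<in> space M. R < norm (W n \<omega>)} \<le> \<epsilon> / 2"
    using tight[of "\<epsilon> / 2"] by auto
  have "\<forall>\<^sub>F n in sequentially. prob {\<omega> \<in> space M. 1 < norm (Z n \<omega> - W n \<omega>)} < \<epsilon> / 2"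
    using \<epsilon> by (intro order_tendstoD(2)[OF small]) auto
  with R have "\<forall>\<^sub>F n in sequentially. prob {\<omega> \<in> space M. R + 1 < norm (Z n \<omega>)} \<le> \<epsilon>"
  proof eventually_elim
    case (elim n)
    have "norm (Z n \<omega>) \<le> norm (W n \<omega>) + norm (Z n \<omega> - W n \<omega>)" for \<omega>
      by (metis add.commute norm_triangle_sub)
    then have "{\<omega> \<in> space M. R + 1 < norm (Z n \<omega>)} \<subseteq>
       {\<omega> \<in> space M. R < norm (W n \<omega>)} \<union> {\<omega> \<in> space M. 1 < norm (Z n \<omega> - W n \<omega>)}"
      by (auto simp: not_less) (smt (verit))
    then have "prob {\<omega> \<in> space M. R + 1 < norm (Z n \<omega>)} \<le>
       prob ({\<omega> \<in> space M. R < norm (W n \<omega>)} \<union> {\<omega> \<in> space M. 1 < norm (Z n \<omega> - W n \<omega>)})"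
      by (intro finite_measure_mono) auto
    also have "\<dots> \<le> prob {\<omega> \<in> space M. R < norm (W n \<omega>)} + prob {\<omega> \<in> space M. 1 < norm (Z n \<omega> - W n \<omega>)}"
      by (rule measure_Un_le) auto
    finally show ?case using elim by simp
  qed
  then show "\<exists>R. \<forall>\<^sub>F n in sequentially. prob {\<omega> \<in> space M. R < norm (Z n \<omega>)} \<le> \<epsilon>" by blast
qed simp

section \<open>The standard normal law\<close>

lemma integral_cos_shift_std_normal:
  "(LINT z|std_normal_distribution. cos (s * z + b)) = cos b * exp (- s\<^sup>2 / 2)"
proof -
  interpret real_distribution std_normal_distribution by (rule real_dist_normal_dist)
  have "(LINT z|std_normal_distribution. cos (s * z + b)) =
        (LINT z|std_normal_distribution. Re (iexp b * iexp (s * z)))"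
    by (simp add: cis_mult add.commute flip: cis_conv_exp of_real_mult)
  also have "\<dots> = Re (iexp b * char std_normal_distribution s)"
    unfolding char_def
    by (subst integral_Re) (auto intro!: integrable_iexp integrable_mult_right)
  also have "\<dots> = cos b * exp (- s\<^sup>2 / 2)"
    unfolding char_std_normal_distribution by (simp add: Re_exp)
  finally show ?thesis .
qed

text \<open>
  The characteristic function factorises over the independent coordinates.
\<close>

lemma prob_space_std_normal_vec: "prob_space (std_normal_vec :: (real ^ 'p) measure)"
  and sets_std_normal_vec [measurable_cong, simp]: "sets (std_normal_vec :: (real ^ 'p) measure) = sets borel"
  and integral_cos_std_normal_vec:
    "(LINT z|(std_normal_vec :: (real ^ 'p) measure). cos (s \<bullet> z + b)) = cos b * exp (- (norm s)\<^sup>2 / 2)"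
proof -
  let ?N = "\<lambda>_::'p. std_normal_distribution"
  let ?\<Pi> = "\<Pi>\<^sub>M i\<in>(UNIV::'p set). std_normal_distribution"
  have eq: "(std_normal_vec :: (real ^ 'p) measure) = distr ?\<Pi> borel (\<lambda>z. \<chi> i. z i)"
    by (simp add: std_normal_vec_def)
  interpret N: prob_space std_normal_distribution by (rule prob_space_normal_density) simp
  interpret product_prob_space ?N ..
  have [measurable]: "(\<lambda>z. \<chi> i. z i) \<in> borel_measurable ?\<Pi>"
    by (rule borel_measurable_vecI) simp
  have PP: "prob_space ?\<Pi>" by (rule prob_space_PiM) (rule N.prob_space_axioms)
  interpret \<Pi>: prob_space ?\<Pi> by fact
  show "prob_space (std_normal_vec :: (real ^ 'p) measure)"
    unfolding eq by (rule \<Pi>.prob_space_distr) measurable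
  show "sets (std_normal_vec :: (real ^ 'p) measure) = sets borel" by (simp add: eq)
  have int1: "integrable std_normal_distribution (\<lambda>x. iexp (s $ i * x))" for i
    by (rule N.integrable_iexp) auto
  have "(LINT z|?\<Pi>. iexp (s \<bullet> (\<chi> i. z i))) = (LINT z|?\<Pi>. (\<Prod>i\<in>UNIV. iexp (s $ i * z i)))"
    by (simp add: inner_vec_def sum_distrib_left flip: exp_sum)
  also have "\<dots> = (\<Prod>i\<in>UNIV. LINT x|std_normal_distribution. iexp (s $ i * x))"
    using int1 by (intro product_integral_prod) simp_all
  also have "\<dots> = (\<Prod>i\<in>UNIV. complex_of_real (exp (- (s $ i)\<^sup>2 / 2)))"
    by (simp only: fun_cong[OF char_std_normal_distribution, unfolded char_def])
  also have "\<dots> = complex_of_real (exp (- (norm s)\<^sup>2 / 2))"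
    by (simp add: exp_sum[symmetric] norm_vec_def L2_set_def sum_nonneg sum_negf sum_divide_distrib
             del: of_real_exp flip: of_real_prod)
  finally have ch: "(LINT z|?\<Pi>. iexp (s \<bullet> (\<chi> i. z i))) = complex_of_real (exp (- (norm s)\<^sup>2 / 2))" .
  have "(LINT z|(std_normal_vec :: (real ^ 'p) measure). cos (s \<bullet> z + b)) = (LINT z|?\<Pi>. cos (s \<bullet> (\<chi> i. z i) + b))"
    unfolding eq by (rule integral_distr) measurable
  also have "\<dots> = (LINT z|?\<Pi>. Re (iexp b * iexp (s \<bullet> (\<chi> i. z i))))"
    by (simp add: cis_mult add.commute flip: cis_conv_exp)
  also have "\<dots> = Re (iexp b * (LINT z|?\<Pi>. iexp (s \<bullet> (\<chi> i. z i))))"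
    by (subst integral_Re) (auto intro!: \<Pi>.integrable_iexp integrable_mult_right)
  also have "\<dots> = cos b * exp (- (norm s)\<^sup>2 / 2)"
    unfolding ch by (simp add: Re_exp)
  finally show "(LINT z|(std_normal_vec :: (real ^ 'p) measure). cos (s \<bullet> z + b)) = cos b * exp (- (norm s)\<^sup>2 / 2)" .
qed

section \<open>Sums over an i.i.d. sample\<close>

locale iid_sample = prob_space P for P :: "'w measure" +
  fixes X :: "nat \<Rightarrow> 'w \<Rightarrow> 'x::topological_space" and G :: "'x measure"
  assumes indep: "indep_vars (\<lambda>_. borel) X UNIV"
    and law: "\<And>i. distr P borel (X i) = G"
begin

lemma X_measurable [measurable]: "X i \<in> borel_measurable P"
  using indep unfolding indep_vars_def2 by simp

lemma sets_G [measurable_cong, simp]: "sets G = sets borel"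
  using law[of 0] by (metis sets_distr)

lemma space_G [simp]: "space G = UNIV"
  using sets_eq_imp_space_eq[OF sets_G] by simp

lemma prob_space_G: "prob_space G"
  using prob_space_distr[OF X_measurable[of 0]] by (simp add: law)

lemma measure_G_UNIV [simp]: "measure G UNIV = 1"
  using prob_space.prob_space[OF prob_space_G] by simp

lemma integrable_comp_iff:
  fixes h :: "'x \<Rightarrow> 'b::{banach, second_countable_topology}"
  assumes [measurable]: "h \<in> borel_measurable borel"
  shows "integrable P (\<lambda>\<omega>. h (X i \<omega>)) \<longleftrightarrow> integrable G h"
  using integrable_distr_eq[of "X i" P borel h] by (simp add: law)

lemma expectation_comp:
  fixes h :: "'x \<Rightarrow> 'b::{banach, second_countable_topology}"
  assumes [measurable]: "h \<in> borel_measurable borel"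
  shows "expectation (\<lambda>\<omega>. h (X i \<omega>)) = (LINT x|G. h x)"
  using integral_distr[of "X i" P borel h] by (simp add: law)

lemma AE_comp:
  assumes "AE x in G. Q x"
  shows "AE \<omega> in P. \<forall>i. Q (X i \<omega>)"
proof (rule AE_all_countable[THEN iffD2], intro allI)
  fix i
  have "AE x in distr P borel (X i). Q x" using assms unfolding law .
  then show "AE \<omega> in P. Q (X i \<omega>)" by (rule AE_distrD[rotated]) measurable
qed

lemma indep_comp:
  assumes "h \<in> borel_measurable borel"
  shows "indep_vars (\<lambda>_. borel) (\<lambda>i \<omega>. h (X i \<omega>)) UNIV"
  by (rule indep_vars_compose2[OF indep]) (use assms in auto)

text \<open>
  The cross terms vanish by independence and centering.
\<close>

lemma second_moment_sum:
  fixes h :: "'x \<Rightarrow> real"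
  assumes [measurable]: "h \<in> borel_measurable borel"
    and sq: "integrable G (\<lambda>x. (h x)\<^sup>2)" and mean: "(LINT x|G. h x) = 0"
  shows "integrable P (\<lambda>\<omega>. (\<Sum>i<n. h (X i \<omega>))\<^sup>2)"
    and "expectation (\<lambda>\<omega>. (\<Sum>i<n. h (X i \<omega>))\<^sup>2) = real n * (LINT x|G. (h x)\<^sup>2)"
proof -
  have sqi: "integrable P (\<lambda>\<omega>. (h (X i \<omega>))\<^sup>2)" for i
    using sq by (subst integrable_comp_iff[where h="\<lambda>x. (h x)\<^sup>2"]) auto
  have i1: "integrable P (\<lambda>\<omega>. h (X i \<omega>))" for i
    by (rule square_integrable_imp_integrable[OF _ sqi]) simp
  have cross: "integrable P (\<lambda>\<omega>. h (X i \<omega>) * h (X j \<omega>)) \<and>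
      expectation (\<lambda>\<omega>. h (X i \<omega>) * h (X j \<omega>)) = 0" if "i \<noteq> j" for i j
  proof -
    have sub: "indep_vars (\<lambda>_. borel) (\<lambda>i \<omega>. h (X i \<omega>)) {i, j}"
      by (rule indep_vars_subset[OF indep_comp]) auto
    from indep_vars_integrable[OF _ sub] indep_vars_lebesgue_integral[OF _ sub] i1 that mean
    show ?thesis by (simp add: expectation_comp)
  qed
  have "integrable P (\<lambda>\<omega>. (\<Sum>i<n. h (X i \<omega>))\<^sup>2) \<and>
    expectation (\<lambda>\<omega>. (\<Sum>i<n. h (X i \<omega>))\<^sup>2) = real n * (LINT x|G. (h x)\<^sup>2)"
  proof (induction n)
    case (Suc n)
    have exp2: "(\<Sum>i<Suc n. h (X i \<omega>))\<^sup>2 =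
       (\<Sum>i<n. h (X i \<omega>))\<^sup>2 + (h (X n \<omega>))\<^sup>2 + 2 * (\<Sum>i<n. h (X i \<omega>) * h (X n \<omega>))" for \<omega>
      by (simp add: power2_sum sum_distrib_right)
    have c: "integrable P (\<lambda>\<omega>. \<Sum>i<n. h (X i \<omega>) * h (X n \<omega>))"
      "expectation (\<lambda>\<omega>. \<Sum>i<n. h (X i \<omega>) * h (X n \<omega>)) = 0"
      using cross by (auto intro!: Bochner_Integration.integrable_sum)
    have "expectation (\<lambda>\<omega>. (h (X n \<omega>))\<^sup>2) = (LINT x|G. (h x)\<^sup>2)"
      by (subst expectation_comp[where h="\<lambda>x. (h x)\<^sup>2"]) auto
    then show ?case
      unfolding exp2 using Suc c sqi by (simp add: algebra_simps)
  qed simp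
  then show "integrable P (\<lambda>\<omega>. (\<Sum>i<n. h (X i \<omega>))\<^sup>2)"
    and "expectation (\<lambda>\<omega>. (\<Sum>i<n. h (X i \<omega>))\<^sup>2) = real n * (LINT x|G. (h x)\<^sup>2)" by auto
qed

text \<open>
  The central limit theorem in one dimension, stated so that it includes the degenerate case: if the
  second moment is zero, the summands vanish almost surely.
\<close>

lemma characteristic_function_limit:
  fixes h :: "'x \<Rightarrow> real"
  assumes [measurable]: "h \<in> borel_measurable borel"
    and sq: "integrable G (\<lambda>x. (h x)\<^sup>2)" and mean: "(LINT x|G. h x) = 0"
  shows "(\<lambda>n. expectation (\<lambda>\<omega>. cos ((\<Sum>i<n. h (X i \<omega>)) / sqrt (real n) + b)))
     \<longlonglongrightarrow> cos b * exp (- (LINT x|G. (h x)\<^sup>2) / 2)"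
proof (cases "(LINT x|G. (h x)\<^sup>2) = 0")
  case True
  then have "AE x in G. h x = 0"
    using integral_nonneg_eq_0_iff_AE[OF sq] by simp
  from AE_comp[OF this]
  have "expectation (\<lambda>\<omega>. cos ((\<Sum>i<n. h (X i \<omega>)) / sqrt (real n) + b)) = cos b" for n
  proof -
    have "expectation (\<lambda>\<omega>. cos ((\<Sum>i<n. h (X i \<omega>)) / sqrt (real n) + b)) = expectation (\<lambda>_. cos b)"
      by (rule integral_cong_AE) (use AE_comp[OF \<open>AE x in G. h x = 0\<close>] in auto)
    then show ?thesis by (simp add: prob_space)
  qed
  then show ?thesis using True by simp
next
  case False
  define \<sigma> where "\<sigma> = sqrt (LINT x|G. (h x)\<^sup>2)"
  have v: "(LINT x|G. (h x)\<^sup>2) = \<sigma>\<^sup>2" by (simp add: \<sigma>_def integral_nonneg_AE)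
  have \<sigma>: "0 < \<sigma>" using False by (simp add: \<sigma>_def less_le integral_nonneg_AE)
  have sqi: "integrable P (\<lambda>\<omega>. (h (X i \<omega>))\<^sup>2)" for i
    using sq by (subst integrable_comp_iff[where h="\<lambda>x. (h x)\<^sup>2"]) auto
  have m0: "expectation (\<lambda>\<omega>. h (X i \<omega>)) = 0" for i by (simp add: expectation_comp mean)
  have "weak_conv_m (\<lambda>n. distr P borel (\<lambda>\<omega>. (\<Sum>i<n. h (X i \<omega>)) / sqrt (n * \<sigma>\<^sup>2))) std_normal_distribution"
  proof (rule central_limit_theorem_zero_mean[where \<mu>="distr G borel h"])
    show "variance (\<lambda>\<omega>. h (X i \<omega>)) = \<sigma>\<^sup>2" for i
      unfolding m0 using expectation_comp[where h="\<lambda>x. (h x)\<^sup>2"] v by simp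
    show "distr P borel (\<lambda>\<omega>. h (X i \<omega>)) = distr G borel h" for i
      unfolding law[of i, symmetric] by (subst distr_distr) (auto simp: comp_def)
  qed (use indep_comp[OF assms(1)] m0 \<sigma> sqi in auto)
  then have "(\<lambda>n. LINT x|distr P borel (\<lambda>\<omega>. (\<Sum>i<n. h (X i \<omega>)) / sqrt (n * \<sigma>\<^sup>2)). cos (\<sigma> * x + b))
      \<longlonglongrightarrow> (LINT x|std_normal_distribution. cos (\<sigma> * x + b))"
    by (intro weak_conv_imp_integral_bdd_continuous_conv[where B=1])
       (auto intro!: real_distribution_distr real_dist_normal_dist)
  moreover have "(LINT x|distr P borel (\<lambda>\<omega>. (\<Sum>i<n. h (X i \<omega>)) / sqrt (n * \<sigma>\<^sup>2)). cos (\<sigma> * x + b))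
     = expectation (\<lambda>\<omega>. cos ((\<Sum>i<n. h (X i \<omega>)) / sqrt (real n) + b))" for n
    using \<sigma> by (subst integral_distr) (auto simp: real_sqrt_mult)
  ultimately show ?thesis by (simp add: integral_cos_shift_std_normal v)
qed

text \<open>
  Law of large numbers under a first moment alone. The part of \<open>h\<close> bounded by \<open>c\<close> has sample means with
  variance of order \<open>1/n\<close>, and the rest is small in \<open>L\<^sup>1\<close>, uniformly in \<open>n\<close>.
\<close>

lemma mean_converges_in_L1:
  fixes h :: "'x \<Rightarrow> real"
  assumes [measurable]: "h \<in> borel_measurable borel" and int: "integrable G h"
  shows "(\<lambda>n. expectation (\<lambda>\<omega>. \<bar>(\<Sum>i<n. h (X i \<omega>)) / real n - (LINT x|G. h x)\<bar>)) \<longlonglongrightarrow> 0"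
proof (rule tendstoI)
  interpret G: prob_space G by (rule prob_space_G)
  fix e :: real assume e: "0 < e"
  let ?t = "\<lambda>c::nat. \<lambda>x. if \<bar>h x\<bar> \<le> real c then h x else 0"
  have "(\<lambda>c. LINT x|G. \<bar>h x - ?t c x\<bar>) \<longlonglongrightarrow> (LINT x|G. 0)"
  proof (rule integral_dominated_convergence[where w="\<lambda>x. \<bar>h x\<bar>"])
    show "AE x in G. (\<lambda>c. \<bar>h x - ?t c x\<bar>) \<longlonglongrightarrow> 0"
    proof (rule AE_I2, rule tendsto_eventually)
      fix x
      obtain k where "\<bar>h x\<bar> \<le> real k" using real_arch_simple by blast
      then have "\<bar>h x - ?t c x\<bar> = 0" if "c \<ge> k" for c using that by auto
      then show "\<forall>\<^sub>F c in sequentially. \<bar>h x - ?t c x\<bar> = 0" by (intro eventually_sequentiallyI[of k])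
    qed
  qed (use int in auto)
  then have "\<forall>\<^sub>F c in sequentially. (LINT x|G. \<bar>h x - ?t c x\<bar>) < e / 4"
    using e by (intro order_tendstoD(2)) auto
  then obtain c where c: "(LINT x|G. \<bar>h x - ?t c x\<bar>) < e / 4" by (auto simp: eventually_sequentially)
  define m where "m = (LINT x|G. ?t c x)"
  define k where "k x = ?t c x - m" for x
  have [measurable]: "k \<in> borel_measurable borel" unfolding k_def[abs_def] by measurable
  have tint: "integrable G (?t c)" by (rule G.integrable_const_bound[where B="real c"]) auto
  have m: "\<bar>m\<bar> \<le> real c"
  proof -
    have "\<bar>m\<bar> \<le> (LINT x|G. \<bar>?t c x\<bar>)" unfolding m_def by (rule integral_abs_bound)
    also have "\<dots> \<le> (LINT x|G. real c)" using tint by (intro integral_mono) auto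
    finally show ?thesis by (simp add: G.prob_space)
  qed
  have kb: "(k x)\<^sup>2 \<le> (2 * real c)\<^sup>2" for x
    using m by (intro abs_le_square_iff[THEN iffD1]) (auto simp: k_def)
  have ksq: "integrable G (\<lambda>x. (k x)\<^sup>2)"
    by (rule G.integrable_const_bound[where B="(2 * real c)\<^sup>2"]) (use kb in \<open>auto simp: power_mult_distrib\<close>)
  have kint: "integrable G k" unfolding k_def[abs_def] using tint by simp
  have k0: "(LINT x|G. k x) = 0"
    unfolding k_def[abs_def] using tint by (simp add: m_def G.prob_space)
  have "(LINT x|G. (k x)\<^sup>2) \<le> (LINT x|G. (2 * real c)\<^sup>2)"
    using ksq kb by (intro integral_mono) auto
  then have v: "(LINT x|G. (k x)\<^sup>2) \<le> 4 * (real c)\<^sup>2" by (simp add: G.prob_space power_mult_distrib)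
  have ik: "integrable P (\<lambda>\<omega>. k (X i \<omega>))" for i using kint by (simp add: integrable_comp_iff)
  \<comment> \<open>The bound \<open>\<bar>a\<bar> \<le> \<eta> + a\<^sup>2 / \<eta>\<close> with \<open>\<eta> = 1 / \<surd>n\<close> replaces the Cauchy-Schwarz inequality.\<close>
  have bd: "expectation (\<lambda>\<omega>. \<bar>(\<Sum>i<n. k (X i \<omega>)) / real n\<bar>) \<le> (1 + 4 * (real c)\<^sup>2) / sqrt (real n)" if n: "n > 0" for n
  proof -
    let ?A = "\<lambda>\<omega>. (\<Sum>i<n. k (X i \<omega>)) / real n"
    have pt: "\<bar>a\<bar> \<le> 1 / sqrt n + sqrt n * a\<^sup>2" for a :: real
    proof -
      have "0 \<le> (\<bar>a\<bar> * sqrt n - 1)\<^sup>2 + \<bar>a\<bar> * sqrt n" by simp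
      also have "\<dots> = a\<^sup>2 * n - \<bar>a\<bar> * sqrt n + 1"
        by (simp add: power2_eq_square algebra_simps)
      finally have "\<bar>a\<bar> * sqrt n \<le> a\<^sup>2 * n + 1" by simp
      then have "\<bar>a\<bar> * sqrt n / sqrt n \<le> (a\<^sup>2 * n + 1) / sqrt n"
        by (rule divide_right_mono) simp
      moreover have "a\<^sup>2 * n / sqrt n = sqrt n * a\<^sup>2"
        using real_div_sqrt[of "real n"] by (simp flip: times_divide_eq_right)
      ultimately show ?thesis using n by (simp add: add_divide_distrib)
    qed
    have "\<bar>?A \<omega>\<bar> \<le> 1 / sqrt n + sqrt n / (real n)\<^sup>2 * (\<Sum>i<n. k (X i \<omega>))\<^sup>2" for \<omega>
      using pt[of "?A \<omega>"] by (simp add: power_divide)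
    then have "expectation (\<lambda>\<omega>. \<bar>?A \<omega>\<bar>) \<le> expectation (\<lambda>\<omega>. 1 / sqrt n + sqrt n / (real n)\<^sup>2 * (\<Sum>i<n. k (X i \<omega>))\<^sup>2)"
      using second_moment_sum(1)[of k n, OF _ ksq k0] ik
      by (intro integral_mono) auto
    also have "\<dots> = 1 / sqrt n + sqrt n / (real n)\<^sup>2 * (real n * (LINT x|G. (k x)\<^sup>2))"
      using second_moment_sum[of k n, OF _ ksq k0] by (simp add: prob_space)
    also have "sqrt n / (real n)\<^sup>2 * (real n * (LINT x|G. (k x)\<^sup>2)) = (LINT x|G. (k x)\<^sup>2) / sqrt n"
      using n by (simp add: power2_eq_square field_simps)
    also have "1 / sqrt n + (LINT x|G. (k x)\<^sup>2) / sqrt n \<le> (1 + 4 * (real c)\<^sup>2) / sqrt n"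
      using v by (simp add: divide_right_mono flip: add_divide_distrib)
    finally show ?thesis .
  qed
  have "(\<lambda>n. (1 + 4 * (real c)\<^sup>2) / sqrt (real n)) \<longlonglongrightarrow> 0"
    by (intro real_tendsto_divide_at_top[OF tendsto_const] filterlim_compose[OF sqrt_at_top] filterlim_real_sequentially)
  then have "\<forall>\<^sub>F n in sequentially. (1 + 4 * (real c)\<^sup>2) / sqrt (real n) < e / 2"
    using e by (intro order_tendstoD(2)) auto
  then have ev: "\<forall>\<^sub>F n in sequentially. n > 0 \<and> (1 + 4 * (real c)\<^sup>2) / sqrt (real n) < e / 2"
    using eventually_gt_at_top[of 0] by eventually_elim auto
  define d where "d x = h x - ?t c x" for x
  have [measurable]: "d \<in> borel_measurable borel" unfolding d_def[abs_def] by measurable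
  have dint: "integrable G d" unfolding d_def[abs_def] using int tint by simp
  have id: "integrable P (\<lambda>\<omega>. d (X i \<omega>))" for i using dint by (simp add: integrable_comp_iff)
  have "\<bar>(LINT x|G. h x) - m\<bar> \<le> (LINT x|G. \<bar>d x\<bar>)"
    unfolding m_def using int tint integral_abs_bound[of G d] by (simp add: d_def[abs_def])
  then have md: "\<bar>(LINT x|G. h x) - m\<bar> < e / 4" using c by (simp add: d_def)
  show "\<forall>\<^sub>F n in sequentially. dist (expectation (\<lambda>\<omega>. \<bar>(\<Sum>i<n. h (X i \<omega>)) / real n - (LINT x|G. h x)\<bar>)) 0 < e"
    using ev
  proof eventually_elim
    case (elim n)
    then have n: "n > 0" by simp
    let ?E = "\<lambda>\<omega>. \<bar>(\<Sum>i<n. h (X i \<omega>)) / real n - (LINT x|G. h x)\<bar>"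
    have ih: "integrable P (\<lambda>\<omega>. h (X i \<omega>))" for i using int by (simp add: integrable_comp_iff)
    have "expectation ?E \<le> expectation (\<lambda>\<omega>. \<bar>(\<Sum>i<n. k (X i \<omega>)) / real n\<bar> + (\<Sum>i<n. \<bar>d (X i \<omega>)\<bar>) / real n + \<bar>m - (LINT x|G. h x)\<bar>)"
    proof (rule integral_mono)
      show "integrable P ?E" using ih by simp
      show "integrable P (\<lambda>\<omega>. \<bar>(\<Sum>i<n. k (X i \<omega>)) / real n\<bar> + (\<Sum>i<n. \<bar>d (X i \<omega>)\<bar>) / real n + \<bar>m - (LINT x|G. h x)\<bar>)"
        using ik id by simp
      fix \<omega>
      have "h x = k x + d x + m" for x by (simp add: k_def d_def)
      then have "(\<Sum>i<n. h (X i \<omega>)) / real n = (\<Sum>i<n. k (X i \<omega>)) / real n + (\<Sum>i<n. d (X i \<omega>)) / real n + m"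
        using n by (simp add: sum.distrib add_divide_distrib)
      moreover have "\<bar>(\<Sum>i<n. d (X i \<omega>)) / real n\<bar> \<le> (\<Sum>i<n. \<bar>d (X i \<omega>)\<bar>) / real n"
        by (simp add: sum_abs divide_right_mono)
      ultimately show "?E \<omega> \<le> \<bar>(\<Sum>i<n. k (X i \<omega>)) / real n\<bar> + (\<Sum>i<n. \<bar>d (X i \<omega>)\<bar>) / real n + \<bar>m - (LINT x|G. h x)\<bar>"
        by linarith
    qed
    also have "\<dots> = expectation (\<lambda>\<omega>. \<bar>(\<Sum>i<n. k (X i \<omega>)) / real n\<bar>) + (LINT x|G. \<bar>d x\<bar>) + \<bar>m - (LINT x|G. h x)\<bar>"
      using ik id n by (simp add: prob_space expectation_comp[where h="\<lambda>x. \<bar>d x\<bar>"])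
    also have "\<dots> < e / 2 + e / 4 + e / 4"
      using bd[OF n] elim c md unfolding d_def by linarith
    finally show ?case by (simp add: integral_nonneg_AE)
  qed
qed

lemma mean_matrix_converges_in_prob:
  fixes D :: "'x \<Rightarrow> real ^ 'n ^ 'm"
  assumes [measurable]: "\<And>i j. (\<lambda>x. D x $ i $ j) \<in> borel_measurable borel"
    and int: "\<And>i j. integrable G (\<lambda>x. D x $ i $ j)" and \<eta>: "0 < \<eta>"
  shows "(\<lambda>n. prob {\<omega> \<in> space P. \<eta> \<le> (\<Sum>i\<in>UNIV. \<Sum>j\<in>UNIV.
      \<bar>(\<Sum>k<n. D (X k \<omega>) $ i $ j) / real n - (LINT x|G. D x $ i $ j)\<bar>)}) \<longlonglongrightarrow> 0"
proof -
  let ?e = "\<lambda>n i j \<omega>. \<bar>(\<Sum>k<n. D (X k \<omega>) $ i $ j) / real n - (LINT x|G. D x $ i $ j)\<bar>"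
  have ii: "integrable P (\<lambda>\<omega>. D (X k \<omega>) $ i $ j)" for k i j
    using int[of i j] by (subst integrable_comp_iff[where h="\<lambda>x. D x $ i $ j"]) auto
  have "(\<lambda>n. \<Sum>i\<in>UNIV. \<Sum>j\<in>UNIV. expectation (?e n i j)) \<longlonglongrightarrow> (\<Sum>i\<in>(UNIV::'m set). \<Sum>j\<in>(UNIV::'n set). 0)"
    by (intro tendsto_sum mean_converges_in_L1[where h="\<lambda>x. D x $ _ $ _"] int) measurable
  moreover have "(\<Sum>i\<in>UNIV. \<Sum>j\<in>UNIV. expectation (?e n i j)) = expectation (\<lambda>\<omega>. \<Sum>i\<in>UNIV. \<Sum>j\<in>UNIV. ?e n i j \<omega>)" for n
    using ii by simp
  ultimately have E: "(\<lambda>n. expectation (\<lambda>\<omega>. \<Sum>i\<in>UNIV. \<Sum>j\<in>UNIV. ?e n i j \<omega>) / \<eta>) \<longlonglongrightarrow> 0"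
    by (intro tendsto_divide_zero) simp
  show ?thesis
  proof (rule tendsto_sandwich[OF _ _ tendsto_const E])
    show "\<forall>\<^sub>F n in sequentially. prob {\<omega> \<in> space P. \<eta> \<le> (\<Sum>i\<in>UNIV. \<Sum>j\<in>UNIV. ?e n i j \<omega>)}
        \<le> expectation (\<lambda>\<omega>. \<Sum>i\<in>UNIV. \<Sum>j\<in>UNIV. ?e n i j \<omega>) / \<eta>"
      using ii \<eta> by (intro always_eventually allI integral_Markov_inequality_measure[where A="space P"])
        (auto intro!: sum_nonneg)
  qed auto
qed

text \<open>
  The multivariate central limit theorem on the level of characteristic functions: \<open>t \<bullet> \<Sum>y (X i)\<close> is a
  sum of real variables with variance \<open>t\<^sup>t E[y y\<^sup>t] t = \<parallel>A\<^sup>t t\<parallel>\<^sup>2\<close>.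
\<close>

lemma normalized_sum_characteristic_limit:
  fixes y :: "'x \<Rightarrow> real ^ 'p" and A :: "real ^ 'p ^ 'p"
  assumes [measurable]: "y \<in> borel_measurable borel"
    and sq: "integrable G (\<lambda>x. (norm (y x))\<^sup>2)" and mean: "(LINT x|G. y x) = 0"
    and A: "A ** transpose A = (LINT x|G. outer (y x) (y x))"
  shows "(\<lambda>n. expectation (\<lambda>\<omega>. cos (t \<bullet> ((1 / sqrt (real n)) *\<^sub>R (\<Sum>i<n. y (X i \<omega>))) + b)))
     \<longlonglongrightarrow> (LINT v|distr std_normal_vec borel (\<lambda>z. 0 + A *v z). cos (t \<bullet> v + b))"
proof -
  interpret G: prob_space G by (rule prob_space_G)
  have yint: "integrable G y" by (rule G.integrable_of_square_norm[OF _ sq]) measurable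
  note oint = integrable_outer[of y G, OF _ sq]
  let ?h = "\<lambda>x. t \<bullet> y x"
  have h_bound: "(?h x)\<^sup>2 \<le> (norm t)\<^sup>2 * (norm (y x))\<^sup>2" for x
    using Cauchy_Schwarz_ineq2[of t "y x"] by (metis abs_ge_zero power2_abs power_mono power_mult_distrib)
  have hsq: "integrable G (\<lambda>x. (?h x)\<^sup>2)"
    by (rule Bochner_Integration.integrable_bound[OF integrable_mult_right[OF sq, of "(norm t)\<^sup>2"]])
       (use h_bound in auto)
  have hmean: "(LINT x|G. ?h x) = 0"
    using integral_inner_right[of t G y] yint mean by simp
  have "(LINT x|G. (?h x)\<^sup>2) = (LINT x|G. (\<Sum>j\<in>UNIV. \<Sum>k\<in>UNIV. t $ j * t $ k * outer (y x) (y x) $ j $ k))"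
    by (intro Bochner_Integration.integral_cong refl)
       (simp add: outer_def inner_vec_def power2_eq_square sum_product mult_ac)
  also have "\<dots> = (\<Sum>j\<in>UNIV. \<Sum>k\<in>UNIV. t $ j * t $ k * (LINT x|G. outer (y x) (y x)) $ j $ k)"
  proof -
    show ?thesis
      using integral_components[OF oint] by (simp add: Bochner_Integration.integral_sum)
  qed
  also have "\<dots> = (norm (transpose A *v t))\<^sup>2"
  proof -
    have "(norm (transpose A *v t))\<^sup>2 = (\<Sum>i\<in>UNIV. (\<Sum>j\<in>UNIV. A $ j $ i * t $ j)\<^sup>2)"
      unfolding power2_norm_vec by (simp add: matrix_vector_mult_def transpose_def)
    also have "\<dots> = (\<Sum>i\<in>UNIV. \<Sum>j\<in>UNIV. \<Sum>k\<in>UNIV. t $ j * t $ k * (A $ j $ i * A $ k $ i))"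
      by (simp add: power2_eq_square sum_product mult_ac)
    also have "\<dots> = (\<Sum>j\<in>UNIV. \<Sum>i\<in>UNIV. \<Sum>k\<in>UNIV. t $ j * t $ k * (A $ j $ i * A $ k $ i))"
      by (rule sum.swap)
    also have "\<dots> = (\<Sum>j\<in>UNIV. \<Sum>k\<in>UNIV. \<Sum>i\<in>UNIV. t $ j * t $ k * (A $ j $ i * A $ k $ i))"
      by (rule sum.cong[OF refl], rule sum.swap)
    also have "\<dots> = (\<Sum>j\<in>UNIV. \<Sum>k\<in>UNIV. t $ j * t $ k * (A ** transpose A) $ j $ k)"
      by (simp add: matrix_matrix_mult_def transpose_def sum_distrib_left)
    finally show ?thesis unfolding A by simp
  qed
  finally have v: "(LINT x|G. (?h x)\<^sup>2) = (norm (transpose A *v t))\<^sup>2" .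
  have 1: "t \<bullet> ((1 / sqrt (real n)) *\<^sub>R (\<Sum>i<n. y (X i \<omega>))) = (\<Sum>i<n. ?h (X i \<omega>)) / sqrt (real n)" for n \<omega>
    by (simp add: inner_sum_right)
  have 2: "(LINT v|distr std_normal_vec borel (\<lambda>z. 0 + A *v z). cos (t \<bullet> v + b))
      = cos b * exp (- (LINT x|G. (?h x)\<^sup>2) / 2)"
  proof -
    have [measurable]: "(\<lambda>z. A *v z) \<in> borel_measurable borel"
      by (intro borel_measurable_continuous_onI linear_continuous_on matrix_vector_mul_bounded_linear)
    have "t \<bullet> (A *v z) = (transpose A *v t) \<bullet> z" for z
      using dot_lmul_matrix[of t A z] by (metis transpose_matrix_vector)
    then show ?thesis
      unfolding v by (subst integral_distr) (auto simp: integral_cos_std_normal_vec)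
  qed
  show ?thesis
    unfolding 1 2 by (rule characteristic_function_limit[OF _ hsq hmean]) measurable
qed

text \<open>
  Markov's inequality for the squared norm, whose expectation does not depend on \<open>n\<close>.
\<close>

lemma normalized_sum_tight:
  fixes y :: "'x \<Rightarrow> real ^ 'p"
  assumes [measurable]: "y \<in> borel_measurable borel"
    and sq: "integrable G (\<lambda>x. (norm (y x))\<^sup>2)" and mean: "(LINT x|G. y x) = 0" and \<epsilon>: "0 < \<epsilon>"
  shows "\<exists>R>0. \<forall>n. prob {\<omega> \<in> space P. R < norm ((1 / sqrt (real n)) *\<^sub>R (\<Sum>i<n. y (X i \<omega>)))} \<le> \<epsilon>"
proof -
  interpret G: prob_space G by (rule prob_space_G)
  have yint: "integrable G y" by (rule G.integrable_of_square_norm[OF _ sq]) measurable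
  define v where "v = (LINT x|G. (norm (y x))\<^sup>2)"
  have v0: "0 \<le> v" by (simp add: v_def)
  have [measurable]: "(\<lambda>x. y x $ j) \<in> borel_measurable borel" for j
    by (rule measurable_compose[OF assms(1)]) (intro borel_measurable_continuous_onI continuous_intros)
  have csq: "integrable G (\<lambda>x. (y x $ j)\<^sup>2)" for j
    by (rule Bochner_Integration.integrable_bound[OF sq])
       (auto simp: abs_le_square_iff[symmetric] component_le_norm_cart)
  have cm: "(LINT x|G. y x $ j) = 0" for j
    using integral_vec_nth[OF yint, of j] mean by simp
  note nrm = power2_norm_vec
  have m2: "integrable P (\<lambda>\<omega>. (norm (\<Sum>i<n. y (X i \<omega>)))\<^sup>2)"
     "expectation (\<lambda>\<omega>. (norm (\<Sum>i<n. y (X i \<omega>)))\<^sup>2) = real n * v" for n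
  proof -
    note s = second_moment_sum[OF _ csq cm, where n = n]
    show "integrable P (\<lambda>\<omega>. (norm (\<Sum>i<n. y (X i \<omega>)))\<^sup>2)" unfolding nrm using s by simp
    have "expectation (\<lambda>\<omega>. (norm (\<Sum>i<n. y (X i \<omega>)))\<^sup>2) = (\<Sum>j\<in>UNIV. real n * (LINT x|G. (y x $ j)\<^sup>2))"
      unfolding nrm using s by simp
    also have "\<dots> = real n * v"
      unfolding v_def nrm using csq by (simp add: sum_distrib_left)
    finally show "expectation (\<lambda>\<omega>. (norm (\<Sum>i<n. y (X i \<omega>)))\<^sup>2) = real n * v" .
  qed
  define R where "R = sqrt ((v + 1) / \<epsilon>)"
  have R: "R > 0" using v0 \<epsilon> by (simp add: R_def)
  have R2: "R\<^sup>2 = (v + 1) / \<epsilon>" using v0 \<epsilon> by (simp add: R_def)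
  have "prob {\<omega> \<in> space P. R < norm ((1 / sqrt (real n)) *\<^sub>R (\<Sum>i<n. y (X i \<omega>)))} \<le> \<epsilon>" for n
  proof (cases "n = 0")
    case True
    then show ?thesis using R \<epsilon> by simp
  next
    case False
    let ?u = "\<lambda>\<omega>. (norm (\<Sum>i<n. y (X i \<omega>)))\<^sup>2"
    have sub: "{\<omega> \<in> space P. R < norm ((1 / sqrt (real n)) *\<^sub>R (\<Sum>i<n. y (X i \<omega>)))} \<subseteq> {\<omega> \<in> space P. real n * R\<^sup>2 \<le> ?u \<omega>}"
    proof safe
      fix \<omega> assume "R < norm ((1 / sqrt (real n)) *\<^sub>R (\<Sum>i<n. y (X i \<omega>)))"
      then have "R * sqrt n \<le> norm (\<Sum>i<n. y (X i \<omega>))" using False by (simp add: field_simps)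
      then have "(R * sqrt n)\<^sup>2 \<le> ?u \<omega>" using R by (intro power_mono) auto
      then show "real n * R\<^sup>2 \<le> ?u \<omega>" by (simp add: power_mult_distrib mult.commute)
    qed
    have "prob {\<omega> \<in> space P. R < norm ((1 / sqrt (real n)) *\<^sub>R (\<Sum>i<n. y (X i \<omega>)))} \<le> prob {\<omega> \<in> space P. real n * R\<^sup>2 \<le> ?u \<omega>}"
      using sub by (intro finite_measure_mono) auto
    also have "\<dots> \<le> expectation ?u / (real n * R\<^sup>2)"
      using m2(1) R False by (intro integral_Markov_inequality_measure[where A="space P"]) auto
    also have "\<dots> = v / ((v + 1) / \<epsilon>)" using False by (simp add: m2(2) R2)
    also have "\<dots> \<le> \<epsilon>" using v0 \<epsilon> by (simp add: field_simps)
    finally show ?thesis .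
  qed
  with R show ?thesis by blast
qed

end

section \<open>Z-estimators with a dominated score\<close>

text \<open>
  The largest relative linearisation error at distance less than \<open>\<delta>\<close>, taken over a set \<open>Q\<close> of
  increments. With a countable dense \<open>Q\<close> the supremum is measurable in parameters and, by continuity,
  still bounds the error for all increments. An infinite supremum would be read as \<open>0\<close>; the bound \<open>c\<close>
  assumed below excludes it.
\<close>

definition linearization_error ::
  "(real ^ 'n \<Rightarrow> real ^ 'm) \<Rightarrow> real ^ 'n ^ 'm \<Rightarrow> real ^ 'n \<Rightarrow> real \<Rightarrow> (real ^ 'n) set \<Rightarrow> real" where
  "linearization_error \<psi> A a \<delta> Q = enn2real (SUP u\<in>{u\<in>Q. u \<noteq> 0 \<and> norm u < \<delta>}.
     ennreal (norm (\<psi> (a + u) - \<psi> a - A *v u) / norm u))"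

lemma
  fixes \<psi> :: "real ^ 'n \<Rightarrow> real ^ 'm"
  assumes Q: "\<forall>S. open S \<longrightarrow> S \<noteq> {} \<longrightarrow> (\<exists>u\<in>Q. u \<in> S)"
    and cont: "continuous_on (ball a r) \<psi>"
    and bound: "\<forall>u. norm u < \<delta> \<longrightarrow> norm (\<psi> (a + u) - \<psi> a - A *v u) \<le> c * norm u"
    and \<delta>: "0 < \<delta>" "\<delta> \<le> r" and c: "0 \<le> c"
  shows linearization_error_nonneg: "0 \<le> linearization_error \<psi> A a \<delta> Q"
    and linearization_error_le: "linearization_error \<psi> A a \<delta> Q \<le> c"
    and linearization_error_bound: "norm u < \<delta> \<Longrightarrow>
      norm (\<psi> (a + u) - \<psi> a - A *v u) \<le> linearization_error \<psi> A a \<delta> Q * norm u"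
proof -
  let ?q = "\<lambda>u. norm (\<psi> (a + u) - \<psi> a - A *v u) / norm u"
  let ?U = "{u\<in>Q. u \<noteq> 0 \<and> norm u < \<delta>}"
  let ?s = "SUP u\<in>?U. ennreal (?q u)"
  show "0 \<le> linearization_error \<psi> A a \<delta> Q" by (simp add: linearization_error_def)
  have "?q u \<le> c" if "norm u < \<delta>" "u \<noteq> 0" for u
    using bound[rule_format, OF that(1)] that by (simp add: divide_le_eq)
  then have s: "?s \<le> ennreal c" by (intro SUP_least) (auto intro: ennreal_leI)
  then show "linearization_error \<psi> A a \<delta> Q \<le> c"
    unfolding linearization_error_def using c by (intro enn2real_leI) auto
  have fin: "?s < top" using s by (simp add: order_le_less_trans)
  have inQ: "?q u \<le> linearization_error \<psi> A a \<delta> Q" if "u \<in> ?U" for u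
  proof -
    have "ennreal (?q u) \<le> ?s" using that by (rule SUP_upper)
    then have "enn2real (ennreal (?q u)) \<le> enn2real ?s" using fin by (intro enn2real_mono) auto
    then show ?thesis by (simp add: linearization_error_def)
  qed
  let ?S = "ball 0 \<delta> - {0} :: (real ^ 'n) set"
  have oS: "open ?S" by (intro open_Diff) auto
  have cS: "continuous_on ?S ?q"
  proof (intro continuous_intros)
    show "continuous_on ?S (\<lambda>u. \<psi> (a + u))"
      by (rule continuous_on_compose2[OF cont]) (use \<delta> in \<open>auto intro!: continuous_intros simp: dist_norm\<close>)
  qed (auto intro!: linear_continuous_on)
  show "norm (\<psi> (a + u) - \<psi> a - A *v u) \<le> linearization_error \<psi> A a \<delta> Q * norm u" if u: "norm u < \<delta>"
  proof (cases "u = 0")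
    case False
    have "?q u \<le> linearization_error \<psi> A a \<delta> Q"
    proof (rule ccontr)
      assume "\<not> ?thesis"
      then have "u \<in> ?S \<inter> ?q -` {linearization_error \<psi> A a \<delta> Q <..}" using u False by simp
      moreover have "open (?S \<inter> ?q -` {linearization_error \<psi> A a \<delta> Q <..})"
        by (rule continuous_open_preimage[OF cS oS]) simp
      ultimately obtain v where "v \<in> Q" "v \<in> ?S \<inter> ?q -` {linearization_error \<psi> A a \<delta> Q <..}"
        using Q by blast
      then show False using inQ[of v] by auto
    qed
    then show ?thesis using False by (simp add: field_simps)
  qed simp
qed

text \<open>
  The deterministic part of the linearisation. Expanding every summand of the estimating equation at
  \<open>\<theta>\<^sub>0\<close> leaves two errors, both proportional to the rescaled deviation \<open>\<surd>n u\<close>: the deviation of the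
  mean derivative from \<open>V\<close> and the mean of the relative remainders.
\<close>

lemma norm_linearized_score_le:
  fixes s s' :: "nat \<Rightarrow> real ^ 'p" and M :: "nat \<Rightarrow> real ^ 'p ^ 'p" and V :: "real ^ 'p ^ 'p"
  assumes n: "0 < n" and zero: "(\<Sum>i<n. s' i) = 0"
    and rem: "\<And>i. norm (s' i - s i - M i *v u) \<le> \<rho> i * norm u"
  shows "norm ((1 / sqrt (real n)) *\<^sub>R (\<Sum>i<n. s i) + V *v (sqrt (real n) *\<^sub>R u)) \<le>
    ((\<Sum>j\<in>UNIV. \<Sum>k\<in>UNIV. \<bar>(\<Sum>i<n. M i $ j $ k) / real n - V $ j $ k\<bar>) + (\<Sum>i<n. \<rho> i) / real n)
      * norm (sqrt (real n) *\<^sub>R u)"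
proof -
  define R where "R i = s' i - s i - M i *v u" for i
  define S where "S = (\<Sum>i<n. M i)"
  define E where "E = V - (1 / real n) *\<^sub>R S"
  let ?Z = "sqrt (real n) *\<^sub>R u"
  have Su: "(\<Sum>i<n. M i *v u) = S *v u"
    unfolding S_def by (induction n) (auto simp: matrix_vector_mult_add_rdistrib)
  have "(\<Sum>i<n. s' i) = (\<Sum>i<n. s i) + S *v u + (\<Sum>i<n. R i)"
    unfolding R_def sum_subtractf Su by simp
  then have sum: "(\<Sum>i<n. s i) = - (S *v u) - (\<Sum>i<n. R i)"
    using zero by (simp add: algebra_simps eq_neg_iff_add_eq_0)
  have "1 / sqrt (real n) = sqrt (real n) * (1 / real n)"
    using n by (simp add: field_simps)
  then have "(1 / sqrt (real n)) *\<^sub>R (S *v u) = sqrt (real n) *\<^sub>R (((1 / real n) *\<^sub>R S) *v u)"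
    by (simp add: scaleR_matrix_vector_assoc[symmetric])
  then have eq: "(1 / sqrt (real n)) *\<^sub>R (\<Sum>i<n. s i) + V *v ?Z = E *v ?Z - (1 / sqrt (real n)) *\<^sub>R (\<Sum>i<n. R i)"
    unfolding sum by (simp add: E_def matrix_vector_mult_diff_rdistrib matrix_vector_mult_scaleR
        scaleR_diff_right)
  have "norm (E *v ?Z) \<le> (\<Sum>j\<in>UNIV. \<Sum>k\<in>UNIV. \<bar>E $ j $ k\<bar>) * norm ?Z"
    by (rule norm_matrix_vector_mult_le)
  also have "(\<Sum>j\<in>UNIV. \<Sum>k\<in>UNIV. \<bar>E $ j $ k\<bar>) = (\<Sum>j\<in>UNIV. \<Sum>k\<in>UNIV. \<bar>(\<Sum>i<n. M i $ j $ k) / real n - V $ j $ k\<bar>)"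
    by (simp add: E_def S_def sum_component abs_minus_commute)
  finally have 1: "norm (E *v ?Z) \<le> (\<Sum>j\<in>UNIV. \<Sum>k\<in>UNIV. \<bar>(\<Sum>i<n. M i $ j $ k) / real n - V $ j $ k\<bar>) * norm ?Z" .
  have "norm (\<Sum>i<n. R i) \<le> (\<Sum>i<n. \<rho> i) * norm u"
    unfolding sum_distrib_right using rem by (intro sum_norm_le) (simp add: R_def)
  then have "norm ((1 / sqrt (real n)) *\<^sub>R (\<Sum>i<n. R i)) \<le> (1 / sqrt (real n)) * ((\<Sum>i<n. \<rho> i) * norm u)"
    by (simp add: divide_right_mono)
  also have "\<dots> = (\<Sum>i<n. \<rho> i) / real n * norm ?Z"
    using n by (simp add: field_simps)
  finally have 2: "norm ((1 / sqrt (real n)) *\<^sub>R (\<Sum>i<n. R i)) \<le> (\<Sum>i<n. \<rho> i) / real n * norm ?Z" .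
  show ?thesis
    unfolding eq distrib_right by (rule order_trans[OF norm_triangle_ineq4 add_mono[OF 1 2]])
qed

context iid_sample
begin

text \<open>
  Differentiability at \<open>\<theta>\<^sub>0\<close> gives convergence to \<open>0\<close> for almost every \<open>x\<close>, and \<open>c\<close> dominates.
\<close>

lemma integral_linearization_error_tendsto_0:
  fixes \<Psi> :: "'x \<Rightarrow> real ^ 'n \<Rightarrow> real ^ 'm" and D :: "'x \<Rightarrow> real ^ 'n ^ 'm"
  assumes r: "0 < r"
    and Q: "countable Q" "\<forall>S. open S \<longrightarrow> S \<noteq> {} \<longrightarrow> (\<exists>u\<in>Q. u \<in> S)"
    and \<Psi>m: "\<And>\<theta>. \<theta> \<in> ball \<theta>\<^sub>0 r \<Longrightarrow> (\<lambda>x. \<Psi> x \<theta>) \<in> borel_measurable borel"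
    and Dm: "D \<in> borel_measurable borel"
    and cont: "AE x in G. continuous_on (ball \<theta>\<^sub>0 r) (\<Psi> x)"
    and diff: "AE x in G. (\<Psi> x has_derivative (\<lambda>u. D x *v u)) (at \<theta>\<^sub>0)"
    and bound: "AE x in G. \<forall>u. norm u < r \<longrightarrow> norm (\<Psi> x (\<theta>\<^sub>0 + u) - \<Psi> x \<theta>\<^sub>0 - D x *v u) \<le> c x * norm u"
    and c: "integrable G c" "\<And>x. 0 \<le> c x"
  defines "\<rho> \<equiv> \<lambda>k x. linearization_error (\<Psi> x) (D x) \<theta>\<^sub>0 (r / real (Suc k)) Q"
  shows "\<rho> k \<in> borel_measurable borel" and "integrable G (\<rho> k)" and "(\<lambda>k. LINT x|G. \<rho> k x) \<longlonglongrightarrow> 0"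
proof -
  have \<delta>: "0 < r / real (Suc k)" "r / real (Suc k) \<le> r" for k
    using r by (auto simp: field_simps)
  show meas: "\<rho> k \<in> borel_measurable borel" for k
  proof -
    let ?U = "{u\<in>Q. u \<noteq> 0 \<and> norm u < r / real (Suc k)}"
    have "(\<lambda>x. ennreal (norm (\<Psi> x (\<theta>\<^sub>0 + u) - \<Psi> x \<theta>\<^sub>0 - D x *v u) / norm u)) \<in> borel_measurable borel"
      if "u \<in> ?U" for u
    proof -
      have "norm u < r" using that \<delta>(2)[of k] by auto
      then have [measurable]: "(\<lambda>x. \<Psi> x (\<theta>\<^sub>0 + u)) \<in> borel_measurable borel" "(\<lambda>x. \<Psi> x \<theta>\<^sub>0) \<in> borel_measurable borel"
        using r by (auto intro!: \<Psi>m simp: dist_norm)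
      have [measurable]: "(\<lambda>x. D x *v u) \<in> borel_measurable borel"
      proof (rule measurable_compose[OF Dm borel_measurable_continuous_onI])
        have "linear (\<lambda>A :: real ^ 'n ^ 'm. A *v u)"
          by (rule linearI) (auto simp: matrix_vector_mult_add_rdistrib scaleR_matrix_vector_assoc)
        then show "continuous_on UNIV (\<lambda>A :: real ^ 'n ^ 'm. A *v u)"
          by (intro linear_continuous_on) (simp add: linear_conv_bounded_linear)
      qed
      show ?thesis by measurable
    qed
    moreover have "countable ?U" using Q(1) by (rule countable_subset[rotated]) auto
    ultimately have "(\<lambda>x. SUP u\<in>?U. ennreal (norm (\<Psi> x (\<theta>\<^sub>0 + u) - \<Psi> x \<theta>\<^sub>0 - D x *v u) / norm u)) \<in> borel_measurable borel"
      by (intro borel_measurable_SUP) auto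
    then show ?thesis unfolding \<rho>_def linearization_error_def by measurable
  qed
  have bd: "AE x in G. \<forall>k. 0 \<le> \<rho> k x \<and> \<rho> k x \<le> c x"
    using cont bound
  proof eventually_elim
    case (elim x)
    have b: "\<forall>u. norm u < r / real (Suc k) \<longrightarrow> norm (\<Psi> x (\<theta>\<^sub>0 + u) - \<Psi> x \<theta>\<^sub>0 - D x *v u) \<le> c x * norm u" for k
      using elim(2) \<delta>(2)[of k] by auto
    show ?case
      unfolding \<rho>_def
      using linearization_error_nonneg[OF Q(2) elim(1) b \<delta> c(2)] linearization_error_le[OF Q(2) elim(1) b \<delta> c(2)]
      by blast
  qed
  show "integrable G (\<rho> k)"
    by (rule Bochner_Integration.integrable_bound[OF c(1)]) (use bd meas c(2) in \<open>auto elim!: eventually_mono\<close>)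
  have "(\<lambda>k. LINT x|G. \<rho> k x) \<longlonglongrightarrow> (LINT x|G. 0)"
  proof (rule integral_dominated_convergence[OF _ _ c(1)])
    show "AE x in G. norm (\<rho> k x) \<le> c x" for k using bd by eventually_elim auto
    show "AE x in G. (\<lambda>k. \<rho> k x) \<longlonglongrightarrow> 0"
      using diff cont
    proof eventually_elim
      case (elim x)
      show ?case
      proof (rule tendstoI)
        fix e :: real assume e: "0 < e"
        then have "e / 2 > 0" by simp
        with elim(1)[unfolded has_derivative_at_alt] obtain d where
          d: "d > 0" "\<And>y. norm (y - \<theta>\<^sub>0) < d \<Longrightarrow> norm (\<Psi> x y - \<Psi> x \<theta>\<^sub>0 - D x *v (y - \<theta>\<^sub>0)) \<le> e / 2 * norm (y - \<theta>\<^sub>0)"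
          by meson
        obtain K :: nat where K: "r / d < real K" using reals_Archimedean2 by blast
        have "dist (\<rho> k x) 0 < e" if "k \<ge> K" for k
        proof -
          have "r / d < real (Suc k)" using K that by linarith
          then have rd: "r / real (Suc k) < d" using d(1) by (simp add: field_simps)
          have b: "\<forall>u. norm u < r / real (Suc k) \<longrightarrow> norm (\<Psi> x (\<theta>\<^sub>0 + u) - \<Psi> x \<theta>\<^sub>0 - D x *v u) \<le> e / 2 * norm u"
          proof (intro allI impI)
            fix u :: "real ^ 'n" assume "norm u < r / real (Suc k)"
            then show "norm (\<Psi> x (\<theta>\<^sub>0 + u) - \<Psi> x \<theta>\<^sub>0 - D x *v u) \<le> e / 2 * norm u"
              using d(2)[of "\<theta>\<^sub>0 + u"] rd by simp
          qed
          have "0 \<le> \<rho> k x" "\<rho> k x \<le> e / 2"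
            unfolding \<rho>_def
            using linearization_error_nonneg[OF Q(2) elim(2) b \<delta>] linearization_error_le[OF Q(2) elim(2) b \<delta>] e
            by auto
          then show ?thesis using e by simp
        qed
        then show "\<forall>\<^sub>F k in sequentially. dist (\<rho> k x) 0 < e" by (rule eventually_sequentiallyI)
      qed
    qed
  qed (use meas in auto)
  then show "(\<lambda>k. LINT x|G. \<rho> k x) \<longlonglongrightarrow> 0" by simp
qed

text \<open>
  Outside three events the estimating equation forces \<open>W\<^sub>n + V Z\<^sub>n\<close> to be small relative to \<open>Z\<^sub>n\<close>: the
  estimator is far from \<open>\<theta>\<^sub>0\<close>, the mean remainder is large, or the mean derivative is far from \<open>V\<close>. The
  first is rare by consistency, the second by Markov's inequality once \<open>\<delta>\<close> is small, and the third by the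
  law of large numbers.
\<close>

lemma score_linearization:
  fixes \<Psi> :: "'x \<Rightarrow> real ^ 'p \<Rightarrow> real ^ 'p" and D :: "'x \<Rightarrow> real ^ 'p ^ 'p"
    and est :: "nat \<Rightarrow> 'w \<Rightarrow> real ^ 'p"
  assumes r: "0 < r"
    and \<Psi>m: "\<And>\<theta>. \<theta> \<in> ball \<theta>\<^sub>0 r \<Longrightarrow> (\<lambda>x. \<Psi> x \<theta>) \<in> borel_measurable borel"
    and Dm: "D \<in> borel_measurable borel" and Dint: "integrable G D"
    and cont: "AE x in G. continuous_on (ball \<theta>\<^sub>0 r) (\<Psi> x)"
    and diff: "AE x in G. (\<Psi> x has_derivative (\<lambda>u. D x *v u)) (at \<theta>\<^sub>0)"
    and lip: "AE x in G. \<forall>\<theta>\<in>ball \<theta>\<^sub>0 r. norm (\<Psi> x \<theta> - \<Psi> x \<theta>\<^sub>0) \<le> b x * norm (\<theta> - \<theta>\<^sub>0)"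
    and b: "integrable G b"
    and em: "\<And>n. est n \<in> borel_measurable P"
    and cons: "tendsto_in_prob P est \<theta>\<^sub>0"
    and root: "\<forall>\<^sub>F n in sequentially. AE \<omega> in P. est n \<omega> \<in> ball \<theta>\<^sub>0 r \<longrightarrow> (\<Sum>i<n. \<Psi> (X i \<omega>) (est n \<omega>)) = 0"
    and \<eta>: "0 < \<eta>"
  defines "Z \<equiv> \<lambda>n \<omega>. sqrt (real n) *\<^sub>R (est n \<omega> - \<theta>\<^sub>0)"
  defines "W \<equiv> \<lambda>n \<omega>. (1 / sqrt (real n)) *\<^sub>R (\<Sum>i<n. \<Psi> (X i \<omega>) \<theta>\<^sub>0)"
  shows "(\<lambda>n. prob {\<omega> \<in> space P. \<eta> * norm (Z n \<omega>) < norm (W n \<omega> + (LINT x|G. D x) *v Z n \<omega>)}) \<longlonglongrightarrow> 0"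
proof (rule tendstoI)
  fix e :: real assume e: "0 < e"
  let ?V = "LINT x|G. D x"
  obtain Q :: "(real ^ 'p) set" where "countable Q" "\<And>S. open S \<Longrightarrow> S \<noteq> {} \<Longrightarrow> \<exists>u\<in>Q. u \<in> S"
    by (rule countable_dense_setE) blast
  then have Q: "countable Q" "\<forall>S. open S \<longrightarrow> S \<noteq> {} \<longrightarrow> (\<exists>u\<in>Q. u \<in> S)" by auto
  let ?nD = "\<lambda>x. \<Sum>i\<in>UNIV. \<Sum>j\<in>UNIV. \<bar>D x $ i $ j\<bar>"
  note Dent = integral_components(1)[OF Dint] and Vent = integral_components(2)[OF Dint]
  have Dentm: "(\<lambda>x. D x $ i $ j) \<in> borel_measurable borel" for i j
    using Dent[of i j] borel_measurable_integrable[of G] by (simp cong: measurable_cong_sets)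
  define c where "c x = \<bar>b x\<bar> + ?nD x" for x
  have c0: "0 \<le> c x" for x by (simp add: c_def sum_nonneg)
  have cint: "integrable G c" unfolding c_def[abs_def]
    using b Dent by simp
  have bound: "AE x in G. \<forall>u. norm u < r \<longrightarrow> norm (\<Psi> x (\<theta>\<^sub>0 + u) - \<Psi> x \<theta>\<^sub>0 - D x *v u) \<le> c x * norm u"
    using lip
  proof eventually_elim
    case (elim x)
    show ?case
    proof (intro allI impI)
      fix u :: "real ^ 'p" assume "norm u < r"
      then have "\<theta>\<^sub>0 + u \<in> ball \<theta>\<^sub>0 r" by (simp add: dist_norm)
      with elim have "norm (\<Psi> x (\<theta>\<^sub>0 + u) - \<Psi> x \<theta>\<^sub>0) \<le> b x * norm (\<theta>\<^sub>0 + u - \<theta>\<^sub>0)" by blast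
      also have "\<dots> \<le> \<bar>b x\<bar> * norm u" by (simp add: mult_right_mono)
      finally have "norm (\<Psi> x (\<theta>\<^sub>0 + u) - \<Psi> x \<theta>\<^sub>0) \<le> \<bar>b x\<bar> * norm u" .
      moreover have "norm (D x *v u) \<le> ?nD x * norm u" by (rule norm_matrix_vector_mult_le)
      moreover have "norm (\<Psi> x (\<theta>\<^sub>0 + u) - \<Psi> x \<theta>\<^sub>0 - D x *v u) \<le> norm (\<Psi> x (\<theta>\<^sub>0 + u) - \<Psi> x \<theta>\<^sub>0) + norm (D x *v u)"
        by (rule norm_triangle_ineq4)
      ultimately show "norm (\<Psi> x (\<theta>\<^sub>0 + u) - \<Psi> x \<theta>\<^sub>0 - D x *v u) \<le> c x * norm u"
        unfolding c_def distrib_right by linarith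
    qed
  qed
  define \<rho> where "\<rho> k x = linearization_error (\<Psi> x) (D x) \<theta>\<^sub>0 (r / real (Suc k)) Q" for k x
  note \<rho>_props = integral_linearization_error_tendsto_0[OF r Q \<Psi>m Dm cont diff bound cint c0, folded \<rho>_def]
  have "\<forall>\<^sub>F k in sequentially. (LINT x|G. \<rho> k x) < \<eta> * e / 8"
    using e \<eta> by (intro order_tendstoD(2)[OF \<rho>_props(3)]) auto
  then obtain k where k: "(LINT x|G. \<rho> k x) < \<eta> * e / 8" by (auto simp: eventually_sequentially)
  note \<rho>m[measurable] = \<rho>_props(1)[of k]
  note \<rho>i = \<rho>_props(2)[of k]
  define \<delta> where "\<delta> = r / real (Suc k)"
  have \<delta>: "0 < \<delta>" "\<delta> \<le> r" using r by (auto simp: \<delta>_def field_simps)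
  have \<rho>0: "0 \<le> \<rho> k x" for x by (simp add: \<rho>_def linearization_error_def)
  have \<rho>b: "AE x in G. \<forall>u. norm u < \<delta> \<longrightarrow> norm (\<Psi> x (\<theta>\<^sub>0 + u) - \<Psi> x \<theta>\<^sub>0 - D x *v u) \<le> \<rho> k x * norm u"
    using cont bound
  proof eventually_elim
    case (elim x)
    have "\<forall>u. norm u < \<delta> \<longrightarrow> norm (\<Psi> x (\<theta>\<^sub>0 + u) - \<Psi> x \<theta>\<^sub>0 - D x *v u) \<le> c x * norm u"
      using elim(2) \<delta> by auto
    from linearization_error_bound[OF Q(2) elim(1) this \<delta> c0]
    show ?case unfolding \<rho>_def \<delta>_def by blast
  qed
  let ?mD = "\<lambda>n \<omega>. \<Sum>i\<in>UNIV. \<Sum>j\<in>UNIV. \<bar>(\<Sum>k<n. D (X k \<omega>) $ i $ j) / real n - (LINT x|G. D x $ i $ j)\<bar>"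
  let ?m\<rho> = "\<lambda>n \<omega>. (\<Sum>i<n. \<rho> k (X i \<omega>)) / real n"
  let ?A1 = "\<lambda>n. {\<omega> \<in> space P. \<delta> / 2 < dist (est n \<omega>) \<theta>\<^sub>0}"
  let ?A2 = "\<lambda>n. {\<omega> \<in> space P. \<eta> / 2 \<le> ?m\<rho> n \<omega>}"
  let ?A3 = "\<lambda>n. {\<omega> \<in> space P. \<eta> / 2 \<le> ?mD n \<omega>}"
  let ?B = "\<lambda>n. {\<omega> \<in> space P. \<eta> * norm (Z n \<omega>) < norm (W n \<omega> + ?V *v Z n \<omega>)}"
  note [measurable] = em Dentm
  have A1m[measurable]: "?A1 n \<in> sets P" for n by measurable
  have A2m[measurable]: "?A2 n \<in> sets P" for n by measurable
  have A3m[measurable]: "?A3 n \<in> sets P" for n by measurable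
  have A1: "(\<lambda>n. prob (?A1 n)) \<longlonglongrightarrow> 0"
    using cons[unfolded tendsto_in_prob_def, rule_format, of "\<delta> / 2"] \<delta> by (simp only: half_gt_zero)
  have A3: "(\<lambda>n. prob (?A3 n)) \<longlonglongrightarrow> 0"
    using mean_matrix_converges_in_prob[OF Dentm Dent, of "\<eta> / 2"] \<eta> by simp
  have \<rho>X: "integrable P (\<lambda>\<omega>. \<rho> k (X i \<omega>))" for i using \<rho>i by (simp add: integrable_comp_iff)
  have A2: "prob (?A2 n) \<le> e / 4" if n: "n > 0" for n
  proof -
    have "prob (?A2 n) \<le> expectation (?m\<rho> n) / (\<eta> / 2)"
      using \<eta> \<rho>X \<rho>0 by (intro integral_Markov_inequality_measure[where A="space P"])
        (auto intro!: sum_nonneg divide_nonneg_nonneg)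
    also have "expectation (?m\<rho> n) = (LINT x|G. \<rho> k x)"
      using \<rho>X n by (simp add: expectation_comp)
    also have "(LINT x|G. \<rho> k x) / (\<eta> / 2) \<le> (\<eta> * e / 8) / (\<eta> / 2)"
      using k \<eta> by (intro divide_right_mono) auto
    also have "\<dots> = e / 4" using \<eta> by simp
    finally show ?thesis .
  qed
  have sub: "AE \<omega> in P. \<omega> \<in> ?B n \<longrightarrow> \<omega> \<in> ?A1 n \<union> ?A2 n \<union> ?A3 n"
    if n: "n > 0" and root_n: "AE \<omega> in P. est n \<omega> \<in> ball \<theta>\<^sub>0 r \<longrightarrow> (\<Sum>i<n. \<Psi> (X i \<omega>) (est n \<omega>)) = 0" for n
    using root_n AE_comp[OF \<rho>b]
  proof eventually_elim
    case (elim \<omega>)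
    show ?case
    proof (rule impI, rule ccontr)
      assume B: "\<omega> \<in> ?B n" and "\<omega> \<notin> ?A1 n \<union> ?A2 n \<union> ?A3 n"
      then have nA: "dist (est n \<omega>) \<theta>\<^sub>0 \<le> \<delta> / 2" "?m\<rho> n \<omega> < \<eta> / 2" "?mD n \<omega> < \<eta> / 2" by auto
      define u where "u = est n \<omega> - \<theta>\<^sub>0"
      have u: "norm u < \<delta>" using nA(1) \<delta> by (simp add: u_def dist_norm)
      then have "est n \<omega> \<in> ball \<theta>\<^sub>0 r" using \<delta> by (simp add: u_def dist_norm norm_minus_commute)
      then have zero: "(\<Sum>i<n. \<Psi> (X i \<omega>) (\<theta>\<^sub>0 + u)) = 0" using elim(1) by (simp add: u_def)
      have rem: "norm (\<Psi> (X i \<omega>) (\<theta>\<^sub>0 + u) - \<Psi> (X i \<omega>) \<theta>\<^sub>0 - D (X i \<omega>) *v u) \<le> \<rho> k (X i \<omega>) * norm u" for i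
        using elim(2) u by blast
      have "norm (W n \<omega> + ?V *v Z n \<omega>) \<le> (?mD n \<omega> + ?m\<rho> n \<omega>) * norm (Z n \<omega>)"
        using norm_linearized_score_le[OF n zero rem, of ?V] by (simp only: W_def Z_def u_def Vent)
      also have "\<dots> \<le> \<eta> * norm (Z n \<omega>)"
        using nA(2,3) by (intro mult_right_mono norm_ge_zero) linarith
      finally show False using B by simp
    qed
  qed
  have "\<forall>\<^sub>F n in sequentially. prob (?A1 n) < e / 4" using e by (intro order_tendstoD(2)[OF A1]) auto
  moreover have "\<forall>\<^sub>F n in sequentially. prob (?A3 n) < e / 4" using e by (intro order_tendstoD(2)[OF A3]) auto
  ultimately show "\<forall>\<^sub>F n in sequentially. dist (prob (?B n)) 0 < e"
    using root eventually_gt_at_top[of 0]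
  proof eventually_elim
    case (elim n)
    have "prob (?B n) \<le> prob (?A1 n \<union> ?A2 n \<union> ?A3 n)"
      by (rule finite_measure_mono_AE[OF sub]) (use elim in auto)
    also have "\<dots> \<le> prob (?A1 n \<union> ?A2 n) + prob (?A3 n)" by (rule measure_Un_le) auto
    also have "prob (?A1 n \<union> ?A2 n) \<le> prob (?A1 n) + prob (?A2 n)" by (rule measure_Un_le) auto
    finally show ?case using elim A2[of n] e by simp
  qed
qed

text \<open>
  Since \<open>W\<^sub>n + V Z\<^sub>n\<close> is small relative to \<open>Z\<^sub>n\<close>, the error \<open>Z\<^sub>n + V\<^sup>-\<^sup>1 W\<^sub>n\<close> is at most a small multiple of
  \<open>\<parallel>Z\<^sub>n\<parallel>\<close>. It can be absorbed, which bounds it by a small multiple of \<open>\<parallel>V\<^sup>-\<^sup>1 W\<^sub>n\<parallel>\<close>, and this is tight. So \<open>Z\<^sub>n\<close>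
  is a perturbation of \<open>- V\<^sup>-\<^sup>1 W\<^sub>n\<close>, a normalised sum to which the central limit theorem applies.
\<close>

theorem Z_estimator_asymptotically_normal:
  fixes \<Psi> :: "'x \<Rightarrow> real ^ 'p \<Rightarrow> real ^ 'p" and D :: "'x \<Rightarrow> real ^ 'p ^ 'p"
    and est :: "nat \<Rightarrow> 'w \<Rightarrow> real ^ 'p" and A :: "real ^ 'p ^ 'p"
  assumes r: "0 < r"
    and \<Psi>m: "\<And>\<theta>. \<theta> \<in> ball \<theta>\<^sub>0 r \<Longrightarrow> (\<lambda>x. \<Psi> x \<theta>) \<in> borel_measurable borel"
    and Dm: "D \<in> borel_measurable borel" and Dint: "integrable G D"
    and cont: "AE x in G. continuous_on (ball \<theta>\<^sub>0 r) (\<Psi> x)"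
    and diff: "AE x in G. (\<Psi> x has_derivative (\<lambda>u. D x *v u)) (at \<theta>\<^sub>0)"
    and lip: "AE x in G. \<forall>\<theta>\<in>ball \<theta>\<^sub>0 r. norm (\<Psi> x \<theta> - \<Psi> x \<theta>\<^sub>0) \<le> b x * norm (\<theta> - \<theta>\<^sub>0)"
    and b: "integrable G b"
    and mean: "(LINT x|G. \<Psi> x \<theta>\<^sub>0) = 0" and sq: "integrable G (\<lambda>x. (norm (\<Psi> x \<theta>\<^sub>0))\<^sup>2)"
    and V: "invertible V" "V = (LINT x|G. D x)"
    and em: "\<And>n. est n \<in> borel_measurable P"
    and cons: "tendsto_in_prob P est \<theta>\<^sub>0"
    and root: "\<forall>\<^sub>F n in sequentially. AE \<omega> in P. est n \<omega> \<in> ball \<theta>\<^sub>0 r \<longrightarrow> (\<Sum>i<n. \<Psi> (X i \<omega>) (est n \<omega>)) = 0"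
    and A: "A ** transpose A = matrix_inv V ** (LINT x|G. outer (\<Psi> x \<theta>\<^sub>0) (\<Psi> x \<theta>\<^sub>0)) ** transpose (matrix_inv V)"
  shows "converges_in_distribution P (\<lambda>n \<omega>. sqrt (real n) *\<^sub>R (est n \<omega> - \<theta>\<^sub>0))
    (distr std_normal_vec borel (\<lambda>z. 0 + A *v z))"
proof -
  let ?L = "matrix_inv V"
  let ?Z = "\<lambda>n \<omega>. sqrt (real n) *\<^sub>R (est n \<omega> - \<theta>\<^sub>0)"
  let ?W = "\<lambda>n \<omega>. (1 / sqrt (real n)) *\<^sub>R (\<Sum>i<n. \<Psi> (X i \<omega>) \<theta>\<^sub>0)"
  define y where "y x = - (?L *v \<Psi> x \<theta>\<^sub>0)" for x
  let ?Y = "\<lambda>n \<omega>. (1 / sqrt (real n)) *\<^sub>R (\<Sum>i<n. y (X i \<omega>))"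
  interpret G: prob_space G by (rule prob_space_G)
  have blL: "bounded_linear (\<lambda>v. - (M *v v))" for M :: "real ^ 'p ^ 'p"
    by (intro bounded_linear_minus matrix_vector_mul_bounded_linear)
  have \<Psi>0[measurable]: "(\<lambda>x. \<Psi> x \<theta>\<^sub>0) \<in> borel_measurable borel" using r by (intro \<Psi>m) simp
  have ym[measurable]: "y \<in> borel_measurable borel"
    unfolding y_def[abs_def]
    by (rule measurable_compose[OF \<Psi>0 borel_measurable_continuous_onI]) (rule linear_continuous_on[OF blL])
  have \<Psi>int: "integrable G (\<lambda>x. \<Psi> x \<theta>\<^sub>0)"
    by (rule G.integrable_of_square_norm[OF _ sq]) measurable
  define c where "c = 1 + (\<Sum>i\<in>UNIV. \<Sum>j\<in>UNIV. \<bar>?L $ i $ j\<bar>)"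
  have c: "0 < c" by (simp add: c_def add_pos_nonneg sum_nonneg)
  have cL: "norm (?L *v v) \<le> c * norm v" for v
    using norm_matrix_vector_mult_le[of ?L v] by (simp add: c_def distrib_right add_increasing)
  have ysq: "integrable G (\<lambda>x. (norm (y x))\<^sup>2)"
  proof (rule Bochner_Integration.integrable_bound[OF integrable_mult_right[OF sq, of "c\<^sup>2"]])
    have "(norm (y x))\<^sup>2 \<le> c\<^sup>2 * (norm (\<Psi> x \<theta>\<^sub>0))\<^sup>2" for x
      using cL[of "\<Psi> x \<theta>\<^sub>0"] unfolding y_def power_mult_distrib[symmetric] norm_minus_cancel
      by (intro power_mono) auto
    then show "AE x in G. norm ((norm (y x))\<^sup>2) \<le> norm (c\<^sup>2 * (norm (\<Psi> x \<theta>\<^sub>0))\<^sup>2)" by auto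
  qed measurable
  have ymean: "(LINT x|G. y x) = 0"
    unfolding y_def[abs_def] using integral_bounded_linear[OF blL \<Psi>int] mean by simp
  have oint: "integrable G (\<lambda>x. outer (\<Psi> x \<theta>\<^sub>0) (\<Psi> x \<theta>\<^sub>0))"
    using integrable_outer[OF _ sq] by simp
  have outer_mult: "outer (- (M *v v)) (- (M *v v)) = M ** outer v v ** transpose M"
    for M :: "real ^ 'p ^ 'p" and v
    by (simp add: vec_eq_iff outer_def matrix_matrix_mult_def matrix_vector_mult_def transpose_def
        sum_distrib_left sum_distrib_right sum_product mult_ac)
  have "(LINT x|G. outer (y x) (y x)) = ?L ** (LINT x|G. outer (\<Psi> x \<theta>\<^sub>0) (\<Psi> x \<theta>\<^sub>0)) ** transpose ?L"
  proof -
    have "linear (\<lambda>K. ?L ** K ** transpose ?L)"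
      by (rule linearI) (simp_all add: vec_eq_iff matrix_matrix_mult_def distrib_left distrib_right sum.distrib sum_distrib_left mult_ac)
    then have "bounded_linear (\<lambda>K. ?L ** K ** transpose ?L)" by (simp add: linear_conv_bounded_linear)
    from integral_bounded_linear[OF this oint] show ?thesis
      unfolding y_def outer_mult by simp
  qed
  then have Ay: "A ** transpose A = (LINT x|G. outer (y x) (y x))" using A by simp
  let ?N = "distr std_normal_vec borel (\<lambda>z. 0 + A *v z)"
  have [measurable]: "(\<lambda>z. 0 + A *v z) \<in> borel_measurable borel"
    by (intro borel_measurable_continuous_onI) (auto intro!: linear_continuous_on)
  interpret S: prob_space "std_normal_vec :: (real ^ 'p) measure" by (rule prob_space_std_normal_vec)
  note [measurable] = em
  have Zm[measurable]: "?Z n \<in> borel_measurable P" for n by measurable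
  have Ym[measurable]: "?Y n \<in> borel_measurable P" for n by measurable
  have Wm[measurable]: "?W n \<in> borel_measurable P" for n by measurable
  show ?thesis
  proof (rule converges_in_distribution_perturbation[where W="?Y"])
    show "prob_space ?N" by (rule S.prob_space_distr) measurable
    show "(\<lambda>n. expectation (\<lambda>\<omega>. cos (t \<bullet> ?Y n \<omega> + b))) \<longlonglongrightarrow> (LINT v|?N. cos (t \<bullet> v + b))" for t b
      by (rule normalized_sum_characteristic_limit[OF ym ysq ymean Ay])
    show "\<exists>R. \<forall>\<^sub>F n in sequentially. prob {\<omega> \<in> space P. R < norm (?Y n \<omega>)} \<le> \<epsilon>" if "0 < \<epsilon>" for \<epsilon>
      using normalized_sum_tight[OF ym ysq ymean that] by (auto intro: always_eventually)
    show "(\<lambda>n. prob {\<omega> \<in> space P. \<epsilon> < norm (?Z n \<omega> - ?Y n \<omega>)}) \<longlonglongrightarrow> 0" if \<epsilon>: "0 < \<epsilon>" for \<epsilon>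
    proof (rule tendstoI)
      fix e :: real assume e: "0 < e"
      obtain K where K: "K > 0" "\<And>n. prob {\<omega> \<in> space P. K < norm (?Y n \<omega>)} \<le> e / 2"
        using normalized_sum_tight[OF ym ysq ymean, of "e / 2"] e by auto
      \<comment> \<open>The first bound on \<open>\<eta>\<close> allows the absorption, the second makes the result at most \<open>\<epsilon>\<close>.\<close>
      define \<eta> where "\<eta> = min (1 / (2 * c)) (\<epsilon> / (2 * c * K))"
      have \<eta>: "0 < \<eta>" using c K \<epsilon> by (simp add: \<eta>_def)
      have "c * \<eta> \<le> c * (1 / (2 * c))" "c * \<eta> \<le> c * (\<epsilon> / (2 * c * K))"
        using c by (intro mult_left_mono; simp add: \<eta>_def)+
      then have \<eta>': "c * \<eta> \<le> 1 / 2" "2 * (c * \<eta>) * K \<le> \<epsilon>" using c K(1) by (auto simp: field_simps)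
      let ?B = "\<lambda>n. {\<omega> \<in> space P. \<eta> * norm (?Z n \<omega>) < norm (?W n \<omega> + V *v ?Z n \<omega>)}"
      have "(\<lambda>n. prob (?B n)) \<longlonglongrightarrow> 0"
        unfolding V(2) by (rule score_linearization[OF r \<Psi>m Dm Dint cont diff lip b em cons root \<eta>])
      then have "\<forall>\<^sub>F n in sequentially. prob (?B n) < e / 2" using e by (intro order_tendstoD(2)) auto
      then show "\<forall>\<^sub>F n in sequentially. dist (prob {\<omega> \<in> space P. \<epsilon> < norm (?Z n \<omega> - ?Y n \<omega>)}) 0 < e"
      proof eventually_elim
        case (elim n)
        have [measurable]: "(\<lambda>v. V *v v) \<in> borel_measurable borel"
          by (intro borel_measurable_continuous_onI) (auto intro!: linear_continuous_on)
        have "{\<omega> \<in> space P. \<epsilon> < norm (?Z n \<omega> - ?Y n \<omega>)} \<subseteq> ?B n \<union> {\<omega> \<in> space P. K < norm (?Y n \<omega>)}"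
        proof (rule subsetI, rule ccontr)
          fix \<omega> assume \<omega>: "\<omega> \<in> {\<omega> \<in> space P. \<epsilon> < norm (?Z n \<omega> - ?Y n \<omega>)}"
            and "\<omega> \<notin> ?B n \<union> {\<omega> \<in> space P. K < norm (?Y n \<omega>)}"
          then have n1: "norm (?W n \<omega> + V *v ?Z n \<omega>) \<le> \<eta> * norm (?Z n \<omega>)" and n2: "norm (?Y n \<omega>) \<le> K"
            by auto
          have "(\<Sum>i<n. y (X i \<omega>)) = - (?L *v (\<Sum>i<n. \<Psi> (X i \<omega>) \<theta>\<^sub>0))"
            unfolding y_def by (simp add: sum_negf linear_sum[OF matrix_vector_mul_linear])
          then have YW: "?Y n \<omega> = - (?L *v ?W n \<omega>)" by (simp add: matrix_vector_mult_scaleR)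
          have LV: "?L ** V = mat 1"
            using V(1) by (simp add: matrix_inv_mult)
          have eq: "?Z n \<omega> - ?Y n \<omega> = ?L *v (?W n \<omega> + V *v ?Z n \<omega>)"
            unfolding YW matrix_vector_right_distrib matrix_vector_mul_assoc LV by simp
          define E where "E = norm (?Z n \<omega> - ?Y n \<omega>)"
          have "E \<le> c * (\<eta> * norm (?Z n \<omega>))"
            unfolding E_def eq using cL n1 c by (meson mult_left_mono less_imp_le order_trans)
          also have "\<dots> \<le> c * (\<eta> * (E + K))"
            using n2 norm_triangle_sub[of "?Z n \<omega>" "?Y n \<omega>"] c \<eta>
            by (intro mult_left_mono) (auto simp: E_def)
          also have "\<dots> = c * \<eta> * E + c * \<eta> * K" by (simp add: algebra_simps)
          also have "c * \<eta> * E \<le> 1 / 2 * E" using \<eta>'(1) by (intro mult_right_mono) (auto simp: E_def)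
          finally have "E \<le> 2 * (c * \<eta>) * K" by simp
          then show False using \<eta>'(2) \<omega> by (simp add: E_def)
        qed
        then have "prob {\<omega> \<in> space P. \<epsilon> < norm (?Z n \<omega> - ?Y n \<omega>)} \<le> prob (?B n \<union> {\<omega> \<in> space P. K < norm (?Y n \<omega>)})"
          by (intro finite_measure_mono) auto
        also have "\<dots> \<le> prob (?B n) + prob {\<omega> \<in> space P. K < norm (?Y n \<omega>)}"
          by (rule measure_Un_le) auto
        finally show ?case using elim K(2)[of n] by simp
      qed
    qed
  qed auto
qed

end

section \<open>The reference measure and the law of the data\<close>

lemma (in complete_measure) borel_measurable_AE_eq:
  assumes h: "h \<in> M \<rightarrow>\<^sub>M N" and eq: "AE x in M. f x = h x" and sp: "space N = UNIV"
  shows "f \<in> M \<rightarrow>\<^sub>M N"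
proof (rule measurableI)
  fix A assume "A \<in> sets N"
  then have "h -` A \<inter> space M \<in> sets M" using h by (rule measurable_sets[rotated])
  then show "f -` A \<inter> space M \<in> sets M"
    by (rule in_sets_AE[rotated]) (use eq in \<open>auto elim: eventually_mono\<close>)
qed (simp add: sp)

lemma complete_measure_completion: "complete_measure (completion M)"
  by unfold_locales

locale observed_law =
  fixes \<nu> \<mu> G :: "'x::polish_space measure" and \<X> :: "'x set" and g :: "'x \<Rightarrow> real"
  assumes sets_\<nu>: "sets \<nu> = sets borel"
    and g_meas: "g \<in> borel_measurable borel" and g_nonneg: "\<And>x. 0 \<le> g x"
    and G_eq: "G = density \<nu> (\<lambda>x. ennreal (g x))" and prob_G: "prob_space G"
    and \<X>_eq: "\<X> = topological_support G"
    and \<mu>_eq: "\<mu> = completion (restrict_space \<nu> \<X>)"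
begin

sublocale G: prob_space G by (rule prob_G)

lemma sets_G_borel [measurable_cong, simp]: "sets G = sets borel"
  by (simp add: G_eq sets_\<nu>)

lemma g_meas_\<nu> [measurable]: "g \<in> borel_measurable \<nu>"
  using g_meas by (simp cong: measurable_cong_sets add: sets_\<nu>)

text \<open>
  The complement of the support is the union of the null sets in a countable base.
\<close>

lemma closed_support: "closed \<X>" and AE_in_support: "AE x in G. x \<in> \<X>"
proof -
  obtain \<B> :: "'x set set" where \<B>: "countable \<B>" "topological_basis \<B>"
    using ex_countable_basis by blast
  let ?N = "{U \<in> \<B>. emeasure G U = 0}"
  have "- \<X> = \<Union>?N"
  proof safe
    fix x assume "x \<notin> \<X>"
    then obtain U where U: "open U" "x \<in> U" "emeasure G U = 0"
      by (auto simp: \<X>_eq topological_support_def)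
    obtain V where V: "V \<in> \<B>" "x \<in> V" "V \<subseteq> U" using topological_basisE[OF \<B>(2) U(1,2)] by blast
    have "emeasure G V \<le> emeasure G U" using V U(1) by (intro emeasure_mono) auto
    then show "x \<in> \<Union>?N" using V U(3) by auto
  next
    fix x U assume "x \<in> U" "U \<in> \<B>" "emeasure G U = 0" "x \<in> \<X>"
    moreover have "open U" using topological_basis_open[OF \<B>(2)] \<open>U \<in> \<B>\<close> by auto
    ultimately have "0 < emeasure G U" by (auto simp: \<X>_eq topological_support_def)
    then show False using \<open>emeasure G U = 0\<close> by simp
  qed
  moreover have "open (\<Union>?N)" using topological_basis_open[OF \<B>(2)] by auto
  ultimately show "closed \<X>" by (simp add: closed_def)
  have "(\<Union>U\<in>?N. U) \<in> null_sets G"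
    using \<B> topological_basis_open[OF \<B>(2)]
    by (intro null_sets_UN') (auto simp: null_sets_def intro: countable_subset)
  then have "- \<X> \<in> null_sets G" using \<open>- \<X> = \<Union>?N\<close> by simp
  then have "AE x in G. x \<notin> - \<X>" by (rule AE_not_in)
  then show "AE x in G. x \<in> \<X>" by simp
qed

lemma support_measurable: "\<X> \<in> sets borel" "\<X> \<in> sets \<nu>"
  using closed_support by (auto simp: sets_\<nu>)

lemma space_\<mu>: "space \<mu> = \<X>"
  using sets_eq_imp_space_eq[OF sets_\<nu>] by (simp add: \<mu>_eq space_restrict_space)

lemma AE_\<mu>_iff: "(AE x in \<mu>. Q x) \<longleftrightarrow> (AE x in \<nu>. x \<in> \<X> \<longrightarrow> Q x)"
  unfolding \<mu>_eq AE_completion_iff by (rule AE_restrict_space_iff) (simp add: support_measurable)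

lemma AE_G:
  assumes "AE x in \<mu>. Q x"
  shows "AE x in G. Q x"
proof -
  have "AE x in \<nu>. x \<in> \<X> \<longrightarrow> Q x" using assms by (simp add: AE_\<mu>_iff)
  then have "AE x in G. x \<in> \<X> \<longrightarrow> Q x" unfolding G_eq by (subst AE_density) auto
  with AE_in_support show ?thesis by eventually_elim auto
qed

lemma measurable_\<mu>:
  assumes "h \<in> borel_measurable borel"
  shows "h \<in> borel_measurable \<mu>"
  unfolding \<mu>_eq using assms
  by (intro measurable_completion measurable_restrict_space1) (simp cong: measurable_cong_sets add: sets_\<nu>)

lemma measurable_\<mu>_AE:
  assumes "h \<in> borel_measurable \<mu>" "AE x in \<mu>. h' x = h x"
  shows "h' \<in> borel_measurable \<mu>"
proof -
  interpret complete_measure \<mu> unfolding \<mu>_eq by (rule complete_measure_completion)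
  show ?thesis by (rule borel_measurable_AE_eq[OF assms]) simp
qed

text \<open>
  Integrals of the model are taken with respect to the completed measure \<open>\<mu>\<close> with weight \<open>g\<close>, those of
  the sample with respect to \<open>G\<close>. The lemma passes from one to the other and at the same time from an
  integrand that is defined almost everywhere to a Borel version of it.
\<close>

lemma integral_density_transfer:
  fixes h h' :: "'x \<Rightarrow> real"
  assumes h'[measurable]: "h' \<in> borel_measurable borel" and eq: "AE x in \<mu>. h x = h' x"
  shows "integrable \<mu> (\<lambda>x. h x * g x) \<longleftrightarrow> integrable G h'"
    and "(LINT x|\<mu>. h x * g x) = (LINT x|G. h' x)"
proof -
  have [measurable]: "h' \<in> borel_measurable \<nu>" using h' by (simp cong: measurable_cong_sets add: sets_\<nu>)
  have hm': "(\<lambda>x. h' x * g x) \<in> borel_measurable \<mu>" by (rule measurable_\<mu>) (use g_meas in measurable)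
  have hm: "(\<lambda>x. h x * g x) \<in> borel_measurable \<mu>"
    by (rule measurable_\<mu>_AE[OF hm']) (use eq in \<open>auto elim: eventually_mono\<close>)
  have eq': "AE x in \<mu>. h x * g x = h' x * g x" using eq by eventually_elim simp
  have X: "\<X> \<inter> space \<nu> \<in> sets \<nu>" using support_measurable by auto
  have zero: "AE x in \<nu>. g x * h' x = (indicator \<X> x *\<^sub>R (h' x * g x))"
  proof -
    have "AE x in \<nu>. 0 < ennreal (g x) \<longrightarrow> x \<in> \<X>"
      using AE_in_support unfolding G_eq by (subst (asm) AE_density) auto
    then show ?thesis
      by eventually_elim (use g_nonneg in \<open>auto simp: indicator_def order.order_iff_strict\<close>)
  qed
  have rm: "(\<lambda>x. h' x * g x) \<in> borel_measurable (restrict_space \<nu> \<X>)"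
    by (intro measurable_restrict_space1) measurable
  have "integrable \<mu> (\<lambda>x. h x * g x) \<longleftrightarrow> integrable \<mu> (\<lambda>x. h' x * g x)"
    by (rule integrable_cong_AE[OF hm hm' eq'])
  also have "\<dots> \<longleftrightarrow> integrable \<nu> (\<lambda>x. indicator \<X> x *\<^sub>R (h' x * g x))"
    unfolding \<mu>_eq integrable_completion[OF rm] by (rule integrable_restrict_space[OF X])
  also have "\<dots> \<longleftrightarrow> integrable \<nu> (\<lambda>x. g x * h' x)"
    using zero support_measurable by (intro integrable_cong_AE) (auto elim: eventually_mono)
  also have "\<dots> \<longleftrightarrow> integrable G h'"
    unfolding G_eq by (subst integrable_density) (auto simp: g_nonneg)
  finally show "integrable \<mu> (\<lambda>x. h x * g x) \<longleftrightarrow> integrable G h'" .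
  have "(LINT x|\<mu>. h x * g x) = (LINT x|\<mu>. h' x * g x)"
    by (rule integral_cong_AE[OF hm hm' eq'])
  also have "\<dots> = (LINT x|\<nu>. indicator \<X> x *\<^sub>R (h' x * g x))"
    unfolding \<mu>_eq integral_completion[OF rm] by (rule integral_restrict_space[OF X])
  also have "\<dots> = (LINT x|\<nu>. g x * h' x)"
    using zero support_measurable by (intro integral_cong_AE) (auto elim: eventually_mono)
  also have "\<dots> = (LINT x|G. h' x)"
    unfolding G_eq by (subst integral_density) (auto simp: g_nonneg)
  finally show "(LINT x|\<mu>. h x * g x) = (LINT x|G. h' x)" .
qed

text \<open>
  Only the product \<open>\<phi> g\<close> is known to be measurable. Dividing a Borel version of it by \<open>g\<close> recovers \<open>\<phi>\<close>
  where \<open>g > 0\<close>, which is \<open>G\<close>-almost everywhere.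
\<close>

lemma borel_version_of_density_integrable:
  fixes \<phi> :: "'x \<Rightarrow> real"
  assumes "integrable \<mu> (\<lambda>x. \<phi> x * g x)"
  obtains b where "b \<in> borel_measurable borel" "integrable G b" "AE x in G. b x = \<phi> x"
proof -
  have "(\<lambda>x. \<phi> x * g x) \<in> borel_measurable (completion (restrict_space \<nu> \<X>))"
    using assms \<mu>_eq by auto
  from completion_ex_borel_measurable_real[OF this] obtain k where
    k: "k \<in> borel_measurable (restrict_space \<nu> \<X>)" "AE x in restrict_space \<nu> \<X>. \<phi> x * g x = k x" by blast
  define b where "b x = indicator \<X> x *\<^sub>R k x / g x" for x
  have "(\<lambda>x. indicator \<X> x *\<^sub>R k x) \<in> borel_measurable \<nu>"
    using k(1) support_measurable by (subst borel_measurable_restrict_space_iff[symmetric]) auto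
  then have [measurable]: "(\<lambda>x. indicator \<X> x *\<^sub>R k x) \<in> borel_measurable borel"
    by (simp cong: measurable_cong_sets add: sets_\<nu>)
  have bm: "b \<in> borel_measurable borel" unfolding b_def[abs_def] using g_meas by measurable
  have k': "AE x in \<mu>. \<phi> x * g x = k x" unfolding \<mu>_eq using k(2) by (simp add: AE_completion_iff)
  have pos: "AE x in G. 0 < g x"
    unfolding G_eq by (subst AE_density) auto
  have AEb: "AE x in G. b x = \<phi> x"
    using AE_G[OF k'] pos AE_in_support by eventually_elim (auto simp: b_def field_simps)
  have in\<X>: "AE x in \<mu>. x \<in> \<X>" by (rule AE_I2) (simp add: space_\<mu>)
  have "AE x in \<mu>. \<phi> x * g x = b x * g x"
    using k' in\<X> by eventually_elim (auto simp: b_def)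
  moreover have "(\<lambda>x. b x * g x) \<in> borel_measurable \<mu>" by (rule measurable_\<mu>) (use bm g_meas in measurable)
  ultimately have "integrable \<mu> (\<lambda>x. b x * g x)"
    using assms by (subst integrable_cong_AE[symmetric]) auto
  then have "integrable G b" using integral_density_transfer(1)[OF bm, of b] by simp
  with bm AEb show thesis using that by blast
qed

end

section \<open>Powers of a function with twice differentiable logarithm\<close>

text \<open>
  All derivatives come from \<open>w\<^sup>a = e\<^sup>a\<^sup>l\<^sup>n\<^sup>w\<close>, where \<open>S\<close> plays the role of the score.
\<close>

lemma
  fixes w :: "real ^ 'p \<Rightarrow> real"
  assumes B: "open B" and pos: "\<And>\<theta>. \<theta> \<in> B \<Longrightarrow> 0 < w \<theta>"
    and tw: "twice_differentiable_on (\<lambda>\<theta>. ln (w \<theta>)) B" and \<theta>: "\<theta> \<in> B"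
  defines "S \<equiv> gradient (\<lambda>\<theta>. ln (w \<theta>))"
  shows has_derivative_powr_ln: "((\<lambda>t. w t powr a) has_derivative (\<lambda>v. ((a * w \<theta> powr a) *\<^sub>R S \<theta>) \<bullet> v)) (at \<theta>)"
    and gradient_powr_ln: "gradient (\<lambda>t. w t powr a) \<theta> = (a * w \<theta> powr a) *\<^sub>R S \<theta>"
    and has_derivative_gradient_powr_ln: "(gradient (\<lambda>t. w t powr a) has_derivative
          (\<lambda>v. hessian (\<lambda>t. w t powr a) \<theta> *v v)) (at \<theta>)"
    and hessian_powr_ln: "hessian (\<lambda>t. w t powr a) \<theta> =
          (a * w \<theta> powr a) *\<^sub>R (a *\<^sub>R outer (S \<theta>) (S \<theta>) + hessian (\<lambda>\<theta>. ln (w \<theta>)) \<theta>)"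
proof -
  let ?u = "\<lambda>\<theta>. ln (w \<theta>)"
  have d: "((\<lambda>t. w t powr a) has_derivative (\<lambda>v. ((a * w \<theta> powr a) *\<^sub>R S \<theta>) \<bullet> v)) (at \<theta>)" if \<theta>: "\<theta> \<in> B" for \<theta>
  proof -
    have "(?u has_derivative (\<lambda>v. S \<theta> \<bullet> v)) (at \<theta>)"
      unfolding S_def using tw \<theta> by (intro has_derivative_gradient) (auto simp: twice_differentiable_on_def)
    from DERIV_compose_FDERIV[OF DERIV_exp has_derivative_mult_right[OF this, of a]]
    have "((\<lambda>t. exp (a * ?u t)) has_derivative (\<lambda>v. ((a * w \<theta> powr a) *\<^sub>R S \<theta>) \<bullet> v)) (at \<theta>)"
      by (rule has_derivative_eq_rhs) (use pos[OF \<theta>] in \<open>auto simp: powr_def\<close>)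
    then show ?thesis
      by (rule has_derivative_transform_within_open[OF _ B \<theta>]) (use pos in \<open>force simp: powr_def\<close>)
  qed
  have gr: "gradient (\<lambda>t. w t powr a) \<theta> = (a * w \<theta> powr a) *\<^sub>R S \<theta>" if \<theta>: "\<theta> \<in> B" for \<theta>
    by (rule gradient_eqI[OF d[OF \<theta>]])
  show "((\<lambda>t. w t powr a) has_derivative (\<lambda>v. ((a * w \<theta> powr a) *\<^sub>R S \<theta>) \<bullet> v)) (at \<theta>)" by (rule d[OF \<theta>])
  show "gradient (\<lambda>t. w t powr a) \<theta> = (a * w \<theta> powr a) *\<^sub>R S \<theta>" by (rule gr[OF \<theta>])
  let ?H = "(a * w \<theta> powr a) *\<^sub>R (a *\<^sub>R outer (S \<theta>) (S \<theta>) + hessian ?u \<theta>)"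
  have "(S has_derivative (\<lambda>v. hessian ?u \<theta> *v v)) (at \<theta>)"
    unfolding S_def using tw \<theta> by (intro has_derivative_hessian) (auto simp: twice_differentiable_on_def)
  then have "((\<lambda>\<theta>. (a * w \<theta> powr a) *\<^sub>R S \<theta>) has_derivative (\<lambda>v. ?H *v v)) (at \<theta>)"
  proof (rule has_derivative_eq_rhs[OF has_derivative_scaleR[OF has_derivative_mult_right[OF d[OF \<theta>]]]])
    have "outer (S \<theta>) (S \<theta>) *v v = (S \<theta> \<bullet> v) *\<^sub>R S \<theta>" for v
      by (simp add: vec_eq_iff outer_def matrix_vector_mult_def inner_vec_def sum_distrib_left sum_distrib_right mult_ac)
    then show "(\<lambda>h. (a * w \<theta> powr a) *\<^sub>R (hessian ?u \<theta> *v h) + (a * (((a * w \<theta> powr a) *\<^sub>R S \<theta>) \<bullet> h)) *\<^sub>R S \<theta>) = (\<lambda>v. ?H *v v)"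
      by (simp add: fun_eq_iff matrix_vector_mult_add_rdistrib algebra_simps flip: scaleR_matrix_vector_assoc)
  qed
  then have g': "(gradient (\<lambda>t. w t powr a) has_derivative (\<lambda>v. ?H *v v)) (at \<theta>)"
    by (rule has_derivative_transform_within_open[OF _ B \<theta>]) (simp add: gr)
  show h: "hessian (\<lambda>t. w t powr a) \<theta> = ?H" by (rule hessian_eqI[OF g'])
  show "(gradient (\<lambda>t. w t powr a) has_derivative (\<lambda>v. hessian (\<lambda>t. w t powr a) \<theta> *v v)) (at \<theta>)"
    unfolding h by (rule g')
qed

lemma powr_square: "(x powr a)\<^sup>2 = x powr (2 * a)" for x a :: real
  using powr_add[of x a a] by (simp add: power2_eq_square)

text \<open>
  The inequality of Landau type along the \<open>j\<close>-th coordinate line through \<open>\<theta>\<close>. The line stays in \<open>B\<close> up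
  to distance \<open>r\<close> on both sides, because the ball of radius \<open>2 r\<close> does.
\<close>

lemma weighted_score_bound:
  fixes w :: "real ^ 'p \<Rightarrow> real"
  assumes B: "open B" "ball \<theta>\<^sub>0 (2 * r) \<subseteq> B" and r: "0 < r" and \<alpha>: "0 < \<alpha>"
    and pos: "\<And>\<theta>. \<theta> \<in> B \<Longrightarrow> 0 < w \<theta>"
    and tw: "twice_differentiable_on (\<lambda>\<theta>. ln (w \<theta>)) B"
    and score: "\<And>\<theta>. \<theta> \<in> B \<Longrightarrow> (gradient (\<lambda>\<theta>. ln (w \<theta>)) \<theta> $ j)\<^sup>2 * w \<theta> powr (2 * \<alpha>) \<le> C"
    and info: "\<And>\<theta>. \<theta> \<in> B \<Longrightarrow> \<bar>hessian (\<lambda>\<theta>. ln (w \<theta>)) \<theta> $ j $ j * w \<theta> powr \<alpha>\<bar> \<le> \<phi>"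
    and \<theta>: "\<theta> \<in> ball \<theta>\<^sub>0 r"
  shows "(gradient (\<lambda>\<theta>. ln (w \<theta>)) \<theta> $ j)\<^sup>2 * w \<theta> powr \<alpha> \<le> 2 / \<alpha> * (\<phi> + sqrt C / r)"
proof -
  let ?L = "\<lambda>\<theta>. ln (w \<theta>)"
  let ?e = "axis j 1 :: real ^ 'p"
  have inB: "\<theta> + t *\<^sub>R ?e \<in> B" if "\<bar>t\<bar> \<le> r" for t
  proof -
    have "dist \<theta>\<^sub>0 (\<theta> + t *\<^sub>R ?e) \<le> dist \<theta>\<^sub>0 \<theta> + \<bar>t\<bar>"
      using dist_triangle[of \<theta>\<^sub>0 "\<theta> + t *\<^sub>R ?e" \<theta>] by (simp add: dist_norm)
    then show ?thesis using \<theta> that B(2) by auto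
  qed
  have weight: "exp (\<alpha> * ?L \<theta>) = w \<theta> powr \<alpha>" if "\<theta> \<in> B" for \<theta>
    using pos[OF that] by (simp add: powr_def)
  have line: "((\<lambda>t. \<theta> + t *\<^sub>R ?e) has_derivative (\<lambda>h. h *\<^sub>R ?e)) (at t)" for t
    by (auto intro!: derivative_eq_intros)
  have "(gradient ?L (\<theta> + 0 *\<^sub>R ?e) $ j)\<^sup>2 * exp (\<alpha> * ?L (\<theta> + 0 *\<^sub>R ?e)) \<le> 2 / \<alpha> * (\<phi> + sqrt C / r)"
  proof (rule exp_weighted_landau_inequality[OF r \<alpha>, of "\<lambda>t. ?L (\<theta> + t *\<^sub>R ?e)" "\<lambda>t. gradient ?L (\<theta> + t *\<^sub>R ?e) $ j"
        "\<lambda>t. hessian ?L (\<theta> + t *\<^sub>R ?e) $ j $ j"])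
    fix t :: real assume t: "\<bar>t\<bar> \<le> r"
    note tB = inB[OF t]
    have d: "?L differentiable at (\<theta> + t *\<^sub>R ?e)" "gradient ?L differentiable at (\<theta> + t *\<^sub>R ?e)"
      using tw tB by (auto simp: twice_differentiable_on_def)
    show "((\<lambda>t. ?L (\<theta> + t *\<^sub>R ?e)) has_real_derivative gradient ?L (\<theta> + t *\<^sub>R ?e) $ j) (at t)"
      unfolding has_field_derivative_def
      by (rule has_derivative_eq_rhs[OF has_derivative_compose[OF line has_derivative_gradient[OF d(1)]]])
         (simp add: fun_eq_iff inner_axis)
    have "((\<lambda>t. gradient ?L (\<theta> + t *\<^sub>R ?e) $ j) has_derivative (\<lambda>h. (hessian ?L (\<theta> + t *\<^sub>R ?e) *v (h *\<^sub>R ?e)) $ j)) (at t)"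
      by (rule bounded_linear.has_derivative[OF bounded_linear_vec_nth
            has_derivative_compose[OF line has_derivative_hessian[OF d(2)]]])
    then show "((\<lambda>t. gradient ?L (\<theta> + t *\<^sub>R ?e) $ j) has_real_derivative hessian ?L (\<theta> + t *\<^sub>R ?e) $ j $ j) (at t)"
      unfolding has_field_derivative_def
      by (rule has_derivative_eq_rhs)
         (simp add: fun_eq_iff matrix_vector_mult_scaleR matrix_vector_mul_component inner_axis)
    have "(gradient ?L (\<theta> + t *\<^sub>R ?e) $ j * w (\<theta> + t *\<^sub>R ?e) powr \<alpha>)\<^sup>2 \<le> C"
      using score[OF tB] by (simp add: power_mult_distrib powr_square)
    then show "\<bar>gradient ?L (\<theta> + t *\<^sub>R ?e) $ j * exp (\<alpha> * ?L (\<theta> + t *\<^sub>R ?e))\<bar> \<le> sqrt C"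
      unfolding weight[OF tB] by (intro real_le_rsqrt) simp
    show "\<bar>hessian ?L (\<theta> + t *\<^sub>R ?e) $ j $ j * exp (\<alpha> * ?L (\<theta> + t *\<^sub>R ?e))\<bar> \<le> \<phi>"
      unfolding weight[OF tB] by (rule info[OF tB])
  qed
  then show ?thesis using weight[of \<theta>] inB[of 0] r by simp
qed

lemma continuous_on_weighted_score:
  fixes w :: "real ^ 'p \<Rightarrow> real"
  assumes B: "open B" and pos: "\<And>\<theta>. \<theta> \<in> B \<Longrightarrow> 0 < w \<theta>"
    and tw: "twice_differentiable_on (\<lambda>\<theta>. ln (w \<theta>)) B"
  shows "continuous_on B (\<lambda>\<theta>. (gradient (\<lambda>\<theta>. ln (w \<theta>)) \<theta> $ j)\<^sup>2 * w \<theta> powr a)"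
proof (intro continuous_on_mult continuous_on_power continuous_on_component)
  show "continuous_on B (gradient (\<lambda>\<theta>. ln (w \<theta>)))"
    using tw by (intro differentiable_imp_continuous_on)
      (auto simp: twice_differentiable_on_def differentiable_on_def intro: differentiable_at_withinI)
  show "continuous_on B (\<lambda>\<theta>. w \<theta> powr a)"
    by (intro continuous_at_imp_continuous_on ballI has_derivative_continuous)
      (rule has_derivative_powr_ln[OF B pos tw])
qed

text \<open>
  What \<open>weighted_score_bound\<close> yields for the sum of the entries of \<open>\<bar>\<alpha> f\<^sup>\<alpha> (\<alpha> S S\<^sup>t - i)\<bar>\<close>, using
  \<open>\<bar>S\<^sub>j S\<^sub>k\<bar> \<le> S\<^sub>j\<^sup>2 + S\<^sub>k\<^sup>2\<close>. It is affine in \<open>\<phi>\<close>, so it is integrable along with \<open>\<phi>\<close>.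
\<close>

definition hessian_bound :: "real \<Rightarrow> ('p \<Rightarrow> real) \<Rightarrow> ('p::finite \<Rightarrow> 'p \<Rightarrow> real) \<Rightarrow> real \<Rightarrow> real" where
  "hessian_bound \<alpha> C \<phi> r = (\<Sum>j\<in>UNIV. \<Sum>k\<in>UNIV.
     2 * \<alpha> * (\<phi> j j + sqrt (C j) / r) + 2 * \<alpha> * (\<phi> k k + sqrt (C k) / r) + \<alpha> * \<phi> j k)"

lemma hessian_powr_bound:
  fixes w :: "real ^ 'p \<Rightarrow> real"
  assumes B: "open B" "ball \<theta>\<^sub>0 (2 * r) \<subseteq> B" and r: "0 < r" and \<alpha>: "0 < \<alpha>"
    and pos: "\<And>\<theta>. \<theta> \<in> B \<Longrightarrow> 0 < w \<theta>"
    and tw: "twice_differentiable_on (\<lambda>\<theta>. ln (w \<theta>)) B"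
    and score: "\<And>\<theta> j. \<theta> \<in> B \<Longrightarrow> (gradient (\<lambda>\<theta>. ln (w \<theta>)) \<theta> $ j)\<^sup>2 * w \<theta> powr (2 * \<alpha>) \<le> C j"
    and info: "\<And>\<theta> j k. \<theta> \<in> B \<Longrightarrow> \<bar>hessian (\<lambda>\<theta>. ln (w \<theta>)) \<theta> $ j $ k * w \<theta> powr \<alpha>\<bar> \<le> \<phi> j k"
    and \<theta>: "\<theta> \<in> ball \<theta>\<^sub>0 r"
  shows "(\<Sum>j\<in>UNIV. \<Sum>k\<in>UNIV. \<bar>hessian (\<lambda>t. w t powr \<alpha>) \<theta> $ j $ k\<bar>) \<le> hessian_bound \<alpha> C \<phi> r"
  unfolding hessian_bound_def
proof (intro sum_mono)
  fix j k
  have "\<theta> \<in> ball \<theta>\<^sub>0 (2 * r)" using \<theta> r by simp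
  then have \<theta>B: "\<theta> \<in> B" using B(2) by auto
  let ?S = "gradient (\<lambda>\<theta>. ln (w \<theta>)) \<theta>" and ?h = "hessian (\<lambda>\<theta>. ln (w \<theta>)) \<theta>" and ?q = "w \<theta> powr \<alpha>"
  have S: "\<alpha> * (?S $ i)\<^sup>2 * ?q \<le> 2 * (\<phi> i i + sqrt (C i) / r)" for i
    using weighted_score_bound[OF B r \<alpha> pos tw score info \<theta>, of i] \<alpha> by (simp add: field_simps)
  have "\<bar>?S $ j * ?S $ k\<bar> \<le> (?S $ j)\<^sup>2 + (?S $ k)\<^sup>2"
  proof -
    have "\<bar>a * b\<bar> \<le> a\<^sup>2 + b\<^sup>2" for a b :: real
    proof -
      have "2 * (\<bar>a\<bar> * \<bar>b\<bar>) \<le> a\<^sup>2 + b\<^sup>2" using sum_squares_bound[of "\<bar>a\<bar>" "\<bar>b\<bar>"] by simp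
      moreover have "0 \<le> \<bar>a\<bar> * \<bar>b\<bar>" by simp
      ultimately show ?thesis unfolding abs_mult by linarith
    qed
    then show ?thesis .
  qed
  then have "\<alpha> * ?q * \<bar>?S $ j * ?S $ k\<bar> \<le> \<alpha> * ?q * ((?S $ j)\<^sup>2 + (?S $ k)\<^sup>2)"
    using \<alpha> by (intro mult_left_mono) auto
  also have "\<dots> = \<alpha> * (?S $ j)\<^sup>2 * ?q + \<alpha> * (?S $ k)\<^sup>2 * ?q" by (simp add: algebra_simps)
  also have "\<dots> \<le> 2 * (\<phi> j j + sqrt (C j) / r) + 2 * (\<phi> k k + sqrt (C k) / r)"
    using S by (intro add_mono)
  finally have SS: "\<alpha> * ?q * \<bar>?S $ j * ?S $ k\<bar> \<le> 2 * (\<phi> j j + sqrt (C j) / r) + 2 * (\<phi> k k + sqrt (C k) / r)" .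
  have h: "?q * \<bar>?h $ j $ k\<bar> \<le> \<phi> j k" using info[OF \<theta>B, of j k] by (simp add: abs_mult mult.commute)
  have "hessian (\<lambda>t. w t powr \<alpha>) \<theta> $ j $ k = \<alpha> * (\<alpha> * ?q * (?S $ j * ?S $ k) + ?q * ?h $ j $ k)"
  proof -
    have "hessian (\<lambda>t. w t powr \<alpha>) \<theta> = (\<alpha> * ?q) *\<^sub>R (\<alpha> *\<^sub>R outer ?S ?S + ?h)"
      by (rule hessian_powr_ln[OF B(1) pos tw \<theta>B])
    then show ?thesis by (simp add: outer_def algebra_simps)
  qed
  then have "\<bar>hessian (\<lambda>t. w t powr \<alpha>) \<theta> $ j $ k\<bar> = \<alpha> * \<bar>\<alpha> * ?q * (?S $ j * ?S $ k) + ?q * ?h $ j $ k\<bar>"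
    using \<alpha> by (simp add: abs_mult)
  also have "\<dots> \<le> \<alpha> * (\<alpha> * ?q * \<bar>?S $ j * ?S $ k\<bar> + ?q * \<bar>?h $ j $ k\<bar>)"
    using \<alpha> abs_triangle_ineq[of "\<alpha> * ?q * (?S $ j * ?S $ k)" "?q * ?h $ j $ k"]
    by (intro mult_left_mono) (auto simp: abs_mult)
  also have "\<dots> \<le> \<alpha> * (2 * (\<phi> j j + sqrt (C j) / r) + 2 * (\<phi> k k + sqrt (C k) / r) + \<phi> j k)"
    using \<alpha> SS h by (intro mult_left_mono add_mono) auto
  finally show "\<bar>hessian (\<lambda>t. w t powr \<alpha>) \<theta> $ j $ k\<bar> \<le>
     2 * \<alpha> * (\<phi> j j + sqrt (C j) / r) + 2 * \<alpha> * (\<phi> k k + sqrt (C k) / r) + \<alpha> * \<phi> j k"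
    by (simp add: distrib_left mult_ac)
qed

section \<open>Derivatives as limits of difference quotients\<close>

text \<open>
  The directional derivative along one fixed sequence of step sizes. It is a limit of measurable
  functions of any parameter on which \<open>h\<close> depends measurably, whether or not \<open>h\<close> is differentiable.
  The steps do not exceed \<open>s / 2\<close>, so that all points lie in the open ball of radius \<open>s\<close> when \<open>v\<close> is a unit
  vector.
\<close>

definition sequential_derivative :: "('a::real_normed_vector \<Rightarrow> real) \<Rightarrow> 'a \<Rightarrow> real \<Rightarrow> 'a \<Rightarrow> real" where
  "sequential_derivative h \<theta> s v = lim (\<lambda>n. (h (\<theta> + (s / real (n + 2)) *\<^sub>R v) - h \<theta>) / (s / real (n + 2)))"

lemma difference_quotient_tendsto:
  fixes h :: "'a::real_normed_vector \<Rightarrow> real"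
  assumes d: "(h has_derivative h') (at \<theta>)" and s: "s \<noteq> 0"
  shows "(\<lambda>n. (h (\<theta> + (s / real (n + 2)) *\<^sub>R v) - h \<theta>) / (s / real (n + 2))) \<longlonglongrightarrow> h' v"
proof -
  interpret h': bounded_linear h' by (rule has_derivative_bounded_linear[OF d])
  have "((\<lambda>t. h (\<theta> + t *\<^sub>R v)) has_derivative (\<lambda>t. h' (t *\<^sub>R v))) (at 0)"
    by (rule has_derivative_compose[where f="\<lambda>t. \<theta> + t *\<^sub>R v" and g=h])
       (auto intro!: derivative_eq_intros d)
  then have "((\<lambda>t. h (\<theta> + t *\<^sub>R v)) has_real_derivative h' v) (at 0)"
    unfolding has_field_derivative_def by (rule has_derivative_eq_rhs) (simp add: fun_eq_iff h'.scaleR)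
  then have lim: "((\<lambda>t. (h (\<theta> + t *\<^sub>R v) - h \<theta>) / t) \<longlongrightarrow> h' v) (at 0)"
    by (simp add: DERIV_def)
  have "(\<lambda>n. s / real (n + 2)) \<longlonglongrightarrow> 0"
    using LIMSEQ_ignore_initial_segment[OF lim_const_over_n[of s], of 2] by simp
  then have "filterlim (\<lambda>n. s / real (n + 2)) (at 0) sequentially"
    using s by (auto simp: filterlim_at)
  from filterlim_compose[OF lim this] show ?thesis by simp
qed

lemma sequential_derivative_eq:
  assumes "(h has_derivative h') (at \<theta>)" "s \<noteq> 0"
  shows "sequential_derivative h \<theta> s v = h' v"
  unfolding sequential_derivative_def by (rule limI[OF difference_quotient_tendsto[OF assms]])

lemma sequential_derivative_measurable:
  assumes "\<And>n. (\<lambda>x. h x (\<theta> + (s / real (n + 2)) *\<^sub>R v)) \<in> borel_measurable M" "(\<lambda>x. h x \<theta>) \<in> borel_measurable M"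
  shows "(\<lambda>x. sequential_derivative (h x) \<theta> s v) \<in> borel_measurable M"
  unfolding sequential_derivative_def using assms
  by (intro borel_measurable_lim_metric borel_measurable_divide borel_measurable_diff borel_measurable_const)

section \<open>The density power divergence model\<close>

text \<open>
  The hypotheses on the model are kept apart from those on the sample: the moments of the score and its
  domination are properties of \<open>G\<close> and \<open>f\<close> alone.
\<close>

locale dpd_model = observed_law \<nu> \<mu> G \<X> g
  for \<nu> \<mu> G :: "'x::polish_space measure" and \<X> :: "'x set" and g :: "'x \<Rightarrow> real" +
  fixes \<Theta> B :: "(real ^ 'p) set" and f :: "'x \<Rightarrow> real ^ 'p \<Rightarrow> real" and \<alpha> :: real
    and \<theta>\<^sub>0 :: "real ^ 'p" and C :: "'p \<Rightarrow> real" and \<phi> :: "'p \<Rightarrow> 'p \<Rightarrow> 'x \<Rightarrow> real"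
  assumes f_meas: "\<And>\<theta>. \<theta> \<in> \<Theta> \<Longrightarrow> (\<lambda>x. f x \<theta>) \<in> borel_measurable (restrict_space borel \<X>)"
    and \<alpha>: "0 < \<alpha>"
    and \<theta>\<^sub>0_max: "\<And>\<theta>. \<theta> \<in> \<Theta> \<Longrightarrow> dpd_M \<mu> g f \<alpha> \<Theta> \<theta> \<le> dpd_M \<mu> g f \<alpha> \<Theta> \<theta>\<^sub>0"
    and J_invertible: "invertible (dpd_J \<mu> g f \<alpha> \<theta>\<^sub>0)"
    and B: "open B" "\<theta>\<^sub>0 \<in> B" "B \<subseteq> Theta_G \<mu> g f \<alpha> \<Theta>"
    and smooth: "AE x in \<mu>. (\<forall>\<theta>\<in>B. 0 < f x \<theta>) \<and> twice_differentiable_on (\<lambda>\<theta>. ln (f x \<theta>)) B"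
    and I_smooth: "twice_differentiable_on (dpd_integral \<mu> f \<alpha>) B"
    and I_hessian: "has_bochner_integral \<mu> (\<lambda>x. hessian (\<lambda>t. f x t powr (1 + \<alpha>)) \<theta>\<^sub>0)
        (hessian (dpd_integral \<mu> f \<alpha>) \<theta>\<^sub>0)"
    and score_bounded: "\<And>j \<theta>. \<theta> \<in> B \<Longrightarrow> AE x in \<mu>. (score f x \<theta> $ j)\<^sup>2 * f x \<theta> powr (2 * \<alpha>) < C j"
    and info_dominated: "\<And>j k. AE x in \<mu>. \<forall>\<theta>\<in>B. \<bar>information f x \<theta> $ j $ k * f x \<theta> powr \<alpha>\<bar> \<le> \<phi> j k x"
    and \<phi>_f: "\<And>j k. integrable \<mu> (\<lambda>x. \<phi> j k x * f x \<theta>\<^sub>0)"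
    and \<phi>_g: "\<And>j k. integrable \<mu> (\<lambda>x. \<phi> j k x * g x)"
begin

abbreviation "I \<equiv> dpd_integral \<mu> f \<alpha>"

text \<open>
  The pointwise hypotheses, with one exceptional null set for all parameters in \<open>B\<close>.
\<close>

definition regular :: "'x \<Rightarrow> bool" where
  "regular x \<longleftrightarrow> x \<in> \<X> \<and> (\<forall>\<theta>\<in>B. 0 < f x \<theta>) \<and> twice_differentiable_on (\<lambda>\<theta>. ln (f x \<theta>)) B \<and>
     (\<forall>\<theta>\<in>B. \<forall>j. (score f x \<theta> $ j)\<^sup>2 * f x \<theta> powr (2 * \<alpha>) \<le> C j) \<and>
     (\<forall>\<theta>\<in>B. \<forall>j k. \<bar>information f x \<theta> $ j $ k * f x \<theta> powr \<alpha>\<bar> \<le> \<phi> j k x)"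

lemma B_subset_\<Theta>: "B \<subseteq> \<Theta>"
  using B(3) by (auto simp: Theta_G_def)

text \<open>
  The score bound is given for each parameter separately. It holds simultaneously on a countable
  dense set of parameters, and continuity of the weighted score extends it to \<open>B\<close>.
\<close>

lemma AE_regular: "AE x in \<mu>. regular x"
proof -
  obtain Q :: "(real ^ 'p) set" where Q: "countable Q" "\<And>S. open S \<Longrightarrow> S \<noteq> {} \<Longrightarrow> \<exists>u\<in>Q. u \<in> S"
    by (rule countable_dense_setE) blast
  have "countable (Q \<inter> B)" using Q(1) by simp
  then have "AE x in \<mu>. \<forall>\<theta>\<in>Q \<inter> B. \<forall>j. (score f x \<theta> $ j)\<^sup>2 * f x \<theta> powr (2 * \<alpha>) < C j"
    unfolding AE_ball_countable[OF \<open>countable (Q \<inter> B)\<close>] AE_all_countable using score_bounded by blast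
  moreover have "AE x in \<mu>. x \<in> \<X>" by (rule AE_I2) (simp add: space_\<mu>)
  moreover have "AE x in \<mu>. \<forall>j k. \<forall>\<theta>\<in>B. \<bar>information f x \<theta> $ j $ k * f x \<theta> powr \<alpha>\<bar> \<le> \<phi> j k x"
    unfolding AE_all_countable using info_dominated by blast
  ultimately show ?thesis using smooth
  proof eventually_elim
    case (elim x)
    have "(score f x \<theta> $ j)\<^sup>2 * f x \<theta> powr (2 * \<alpha>) \<le> C j" if \<theta>: "\<theta> \<in> B" for \<theta> j
    proof (rule ccontr)
      assume neg: "\<not> ?thesis"
      let ?h = "\<lambda>\<theta>. (score f x \<theta> $ j)\<^sup>2 * f x \<theta> powr (2 * \<alpha>)"
      have "continuous_on B ?h"
        unfolding score_def using elim(4) by (intro continuous_on_weighted_score B(1)) auto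
      then have "open (B \<inter> ?h -` {C j <..})" by (rule continuous_open_preimage[OF _ B(1)]) simp
      moreover have "\<theta> \<in> B \<inter> ?h -` {C j <..}" using neg \<theta> by simp
      ultimately obtain u where "u \<in> Q" "u \<in> B \<inter> ?h -` {C j <..}" using Q(2) by blast
      with elim(1) have "?h u < C j" "C j < ?h u" by auto
      then show False by simp
    qed
    then show ?case using elim(2-4) by (auto simp: regular_def)
  qed
qed

text \<open>
  The factor \<open>2\<close> leaves room for the coordinate segments of \<open>weighted_score_bound\<close> and for the
  difference quotients at every point of the smaller ball.
\<close>

definition radius :: real where "radius = (SOME r. 0 < r \<and> ball \<theta>\<^sub>0 (2 * r) \<subseteq> B)"

lemma radius: "0 < radius" "ball \<theta>\<^sub>0 (2 * radius) \<subseteq> B"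
proof -
  obtain e where "0 < e" "ball \<theta>\<^sub>0 e \<subseteq> B" using B(1,2) open_contains_ball by blast
  then have "0 < e / 2 \<and> ball \<theta>\<^sub>0 (2 * (e / 2)) \<subseteq> B" by simp
  from someI[of "\<lambda>r. 0 < r \<and> ball \<theta>\<^sub>0 (2 * r) \<subseteq> B", OF this]
  show "0 < radius" "ball \<theta>\<^sub>0 (2 * radius) \<subseteq> B" by (auto simp: radius_def)
qed

lemma ball_radius_subset: "ball \<theta>\<^sub>0 radius \<subseteq> B"
  using radius by (meson less_imp_le mult_le_cancel_right1 not_le one_le_numeral order_trans subset_ball subset_trans)

lemma regular_facts:
  assumes "regular x"
  shows "x \<in> \<X>" "\<And>\<theta>. \<theta> \<in> B \<Longrightarrow> 0 < f x \<theta>" "twice_differentiable_on (\<lambda>\<theta>. ln (f x \<theta>)) B"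
    "\<And>\<theta> j. \<theta> \<in> B \<Longrightarrow> (gradient (\<lambda>\<theta>. ln (f x \<theta>)) \<theta> $ j)\<^sup>2 * f x \<theta> powr (2 * \<alpha>) \<le> C j"
    "\<And>\<theta> j k. \<theta> \<in> B \<Longrightarrow> \<bar>hessian (\<lambda>\<theta>. ln (f x \<theta>)) \<theta> $ j $ k * f x \<theta> powr \<alpha>\<bar> \<le> \<phi> j k x"
  using assms by (auto simp: regular_def score_def information_def)

lemma gradient_powr:
  assumes "regular x" "\<theta> \<in> B"
  shows "((\<lambda>t. f x t powr a) has_derivative (\<lambda>v. gradient (\<lambda>t. f x t powr a) \<theta> \<bullet> v)) (at \<theta>)"
    and "gradient (\<lambda>t. f x t powr a) \<theta> = (a * f x \<theta> powr a) *\<^sub>R score f x \<theta>"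
    and "(gradient (\<lambda>t. f x t powr a) has_derivative (\<lambda>v. hessian (\<lambda>t. f x t powr a) \<theta> *v v)) (at \<theta>)"
    and "hessian (\<lambda>t. f x t powr a) \<theta> =
      (a * f x \<theta> powr a) *\<^sub>R (a *\<^sub>R outer (score f x \<theta>) (score f x \<theta>) - information f x \<theta>)"
proof -
  note r = regular_facts[OF assms(1)]
  show g: "gradient (\<lambda>t. f x t powr a) \<theta> = (a * f x \<theta> powr a) *\<^sub>R score f x \<theta>"
    unfolding score_def by (rule gradient_powr_ln[OF B(1) r(2,3) assms(2)])
  show "((\<lambda>t. f x t powr a) has_derivative (\<lambda>v. gradient (\<lambda>t. f x t powr a) \<theta> \<bullet> v)) (at \<theta>)"
    unfolding g score_def by (rule has_derivative_powr_ln[OF B(1) r(2,3) assms(2)])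
  show "(gradient (\<lambda>t. f x t powr a) has_derivative (\<lambda>v. hessian (\<lambda>t. f x t powr a) \<theta> *v v)) (at \<theta>)"
    by (rule has_derivative_gradient_powr_ln[OF B(1) r(2,3) assms(2)])
  have "hessian (\<lambda>t. f x t powr a) \<theta> =
      (a * f x \<theta> powr a) *\<^sub>R (a *\<^sub>R outer (score f x \<theta>) (score f x \<theta>) + hessian (\<lambda>\<theta>. ln (f x \<theta>)) \<theta>)"
    unfolding score_def by (rule hessian_powr_ln[OF B(1) r(2,3) assms(2)])
  then show "hessian (\<lambda>t. f x t powr a) \<theta> =
      (a * f x \<theta> powr a) *\<^sub>R (a *\<^sub>R outer (score f x \<theta>) (score f x \<theta>) - information f x \<theta>)"
    by (simp add: information_def)
qed

lemma information_symmetric: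
  assumes "regular x" "\<theta> \<in> B"
  shows "information f x \<theta> $ j $ k = information f x \<theta> $ k $ j"
proof -
  have "transpose (hessian (\<lambda>\<theta>. ln (f x \<theta>)) \<theta>) = hessian (\<lambda>\<theta>. ln (f x \<theta>)) \<theta>"
    by (rule hessian_symmetric[OF B(1) assms(2)])
       (use regular_facts(3)[OF assms(1)] assms(2) in \<open>auto simp: twice_differentiable_on_def\<close>)
  then show ?thesis unfolding information_def by (simp add: vec_eq_iff transpose_def)
qed

text \<open>
  A Lipschitz constant of \<open>\<theta> \<mapsto> f\<^sup>\<alpha>(x;\<theta>)\<close> on the ball around \<open>\<theta>\<^sub>0\<close>, the same for all regular \<open>x\<close>.
\<close>

definition lip :: real where "lip = (\<Sum>j\<in>UNIV. \<alpha> * sqrt (C j))"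

lemma gradient_powr_bounded:
  assumes "regular x" "\<theta> \<in> B"
  shows "norm (gradient (\<lambda>t. f x t powr \<alpha>) \<theta>) \<le> lip"
proof -
  have "norm (gradient (\<lambda>t. f x t powr \<alpha>) \<theta>) \<le> (\<Sum>j\<in>UNIV. \<bar>gradient (\<lambda>t. f x t powr \<alpha>) \<theta> $ j\<bar>)"
    by (rule norm_le_l1_cart)
  also have "\<dots> \<le> lip"
    unfolding lip_def
  proof (rule sum_mono)
    fix j
    have "(score f x \<theta> $ j * f x \<theta> powr \<alpha>)\<^sup>2 \<le> C j"
      using regular_facts(4)[OF assms, of j] by (simp add: power_mult_distrib powr_square score_def)
    then have "\<bar>score f x \<theta> $ j * f x \<theta> powr \<alpha>\<bar> \<le> sqrt (C j)" by (intro real_le_rsqrt) simp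
    then have "\<alpha> * \<bar>score f x \<theta> $ j * f x \<theta> powr \<alpha>\<bar> \<le> \<alpha> * sqrt (C j)" using \<alpha> by (intro mult_left_mono) auto
    then show "\<bar>gradient (\<lambda>t. f x t powr \<alpha>) \<theta> $ j\<bar> \<le> \<alpha> * sqrt (C j)"
      unfolding gradient_powr(2)[OF assms] using \<alpha> by (simp add: abs_mult mult_ac)
  qed
  finally show ?thesis .
qed

lemma powr_lipschitz:
  assumes "regular x" "\<theta> \<in> ball \<theta>\<^sub>0 radius"
  shows "\<bar>f x \<theta> powr \<alpha> - f x \<theta>\<^sub>0 powr \<alpha>\<bar> \<le> lip * norm (\<theta> - \<theta>\<^sub>0)"
proof -
  have "norm (f x \<theta> powr \<alpha> - f x \<theta>\<^sub>0 powr \<alpha>) \<le> lip * norm (\<theta> - \<theta>\<^sub>0)"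
  proof (rule differentiable_bound[of "ball \<theta>\<^sub>0 radius" "\<lambda>t. f x t powr \<alpha>" "\<lambda>\<theta> v. gradient (\<lambda>t. f x t powr \<alpha>) \<theta> \<bullet> v"])
    fix t assume "t \<in> ball \<theta>\<^sub>0 radius"
    then have t: "t \<in> B" using ball_radius_subset by auto
    show "((\<lambda>t. f x t powr \<alpha>) has_derivative (\<lambda>v. gradient (\<lambda>t. f x t powr \<alpha>) t \<bullet> v)) (at t within ball \<theta>\<^sub>0 radius)"
      by (rule has_derivative_at_withinI[OF gradient_powr(1)[OF assms(1) t]])
    show "onorm (\<lambda>v. gradient (\<lambda>t. f x t powr \<alpha>) t \<bullet> v) \<le> lip"
    proof (rule onorm_le)
      fix v
      have "norm (gradient (\<lambda>t. f x t powr \<alpha>) t \<bullet> v) \<le> norm (gradient (\<lambda>t. f x t powr \<alpha>) t) * norm v"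
        by (simp add: Cauchy_Schwarz_ineq2)
      also have "\<dots> \<le> lip * norm v" using gradient_powr_bounded[OF assms(1) t] by (rule mult_right_mono) simp
      finally show "norm (gradient (\<lambda>t. f x t powr \<alpha>) t \<bullet> v) \<le> lip * norm v" .
    qed
  qed (use assms(2) radius(1) in auto)
  then show ?thesis by simp
qed

text \<open>
  This is where the domination of the Hessian enters.
\<close>

lemma gradient_powr_lipschitz:
  assumes "regular x" "\<theta> \<in> ball \<theta>\<^sub>0 radius"
  shows "norm (gradient (\<lambda>t. f x t powr \<alpha>) \<theta> - gradient (\<lambda>t. f x t powr \<alpha>) \<theta>\<^sub>0)
    \<le> hessian_bound \<alpha> C (\<lambda>j k. \<phi> j k x) radius * norm (\<theta> - \<theta>\<^sub>0)"
proof (rule differentiable_bound[of "ball \<theta>\<^sub>0 radius" _ "\<lambda>\<theta> v. hessian (\<lambda>t. f x t powr \<alpha>) \<theta> *v v"])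
  fix t assume t: "t \<in> ball \<theta>\<^sub>0 radius"
  then have tB: "t \<in> B" using ball_radius_subset by auto
  show "(gradient (\<lambda>t. f x t powr \<alpha>) has_derivative (\<lambda>v. hessian (\<lambda>t. f x t powr \<alpha>) t *v v)) (at t within ball \<theta>\<^sub>0 radius)"
    by (rule has_derivative_at_withinI[OF gradient_powr(3)[OF assms(1) tB]])
  have "onorm (\<lambda>v. hessian (\<lambda>t. f x t powr \<alpha>) t *v v) \<le> (\<Sum>j\<in>UNIV. \<Sum>k\<in>UNIV. \<bar>hessian (\<lambda>t. f x t powr \<alpha>) t $ j $ k\<bar>)"
    by (rule onorm_le_matrix_component_sum)
  also have "\<dots> \<le> hessian_bound \<alpha> C (\<lambda>j k. \<phi> j k x) radius"
    by (rule hessian_powr_bound[OF B(1) radius(2,1) \<alpha> regular_facts(2-5)[OF assms(1)] t])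
  finally show "onorm (\<lambda>v. hessian (\<lambda>t. f x t powr \<alpha>) t *v v) \<le> hessian_bound \<alpha> C (\<lambda>j k. \<phi> j k x) radius" .
qed (use assms(2) radius(1) in auto)

end

section \<open>Borel versions of the derivatives\<close>

context dpd_model
begin

text \<open>
  Everything is built from \<open>f\<^sup>\<alpha>\<close>, set to \<open>0\<close> outside the support, where \<open>f\<close> is arbitrary. Borel
  versions of its gradient and of its Hessian at \<open>\<theta>\<^sub>0\<close> follow.
\<close>

definition q :: "'x \<Rightarrow> real ^ 'p \<Rightarrow> real" where
  "q x \<theta> = indicator \<X> x *\<^sub>R (f x \<theta> powr \<alpha>)"

definition \<psi> :: "'x \<Rightarrow> real ^ 'p \<Rightarrow> real ^ 'p" where
  "\<psi> x \<theta> = (\<chi> j. sequential_derivative (q x) \<theta> radius (axis j 1))"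

definition D :: "'x \<Rightarrow> real ^ 'p ^ 'p" where
  "D x = (\<chi> j k. sequential_derivative (\<lambda>\<theta>. \<psi> x \<theta> $ j) \<theta>\<^sub>0 radius (axis k 1))"

lemma q_eq: "x \<in> \<X> \<Longrightarrow> q x = (\<lambda>t. f x t powr \<alpha>)"
  by (simp add: q_def fun_eq_iff)

lemma \<psi>_eq:
  assumes "regular x" "\<theta> \<in> B"
  shows "\<psi> x \<theta> = gradient (\<lambda>t. f x t powr \<alpha>) \<theta>"
  using radius(1) unfolding \<psi>_def q_eq[OF regular_facts(1)[OF assms(1)]]
  by (simp add: vec_eq_iff sequential_derivative_eq[OF gradient_powr(1)[OF assms]] inner_axis)

lemma \<psi>_has_derivative:
  assumes "regular x" "\<theta> \<in> B"
  shows "(\<psi> x has_derivative (\<lambda>v. hessian (\<lambda>t. f x t powr \<alpha>) \<theta> *v v)) (at \<theta>)"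
  by (rule has_derivative_transform_within_open[OF gradient_powr(3)[OF assms] B(1) assms(2)])
     (simp add: \<psi>_eq assms(1))

lemma D_eq:
  assumes "regular x"
  shows "D x = hessian (\<lambda>t. f x t powr \<alpha>) \<theta>\<^sub>0"
proof -
  have "((\<lambda>\<theta>. \<psi> x \<theta> $ j) has_derivative (\<lambda>v. (hessian (\<lambda>t. f x t powr \<alpha>) \<theta>\<^sub>0 *v v) $ j)) (at \<theta>\<^sub>0)" for j
    by (rule bounded_linear.has_derivative[OF bounded_linear_vec_nth \<psi>_has_derivative[OF assms B(2)]])
  from sequential_derivative_eq[OF this, of radius] show ?thesis using radius(1)
    by (simp add: D_def vec_eq_iff matrix_vector_mul_component inner_axis)
qed

text \<open>
  The points at which the difference quotients evaluate \<open>f\<close> stay in \<open>B\<close>.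
\<close>

lemma shifted_in_ball:
  assumes "\<theta> \<in> ball \<theta>\<^sub>0 e" "\<bar>s\<bar> \<le> radius"
  shows "\<theta> + (s / real (n + 2)) *\<^sub>R axis j 1 \<in> ball \<theta>\<^sub>0 (e + radius / 2)"
proof -
  have "\<bar>s\<bar> / real (n + 2) \<le> radius / 2"
    using assms(2) radius(1) by (intro frac_le) auto
  moreover have "dist \<theta>\<^sub>0 (\<theta> + (s / real (n + 2)) *\<^sub>R axis j 1) \<le> dist \<theta>\<^sub>0 \<theta> + \<bar>s\<bar> / real (n + 2)"
    using dist_triangle[of \<theta>\<^sub>0 "\<theta> + (s / real (n + 2)) *\<^sub>R axis j 1" \<theta>] by (simp add: dist_norm)
  ultimately show ?thesis using assms(1) unfolding mem_ball by linarith
qed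

lemma q_meas: "\<theta> \<in> B \<Longrightarrow> (\<lambda>x. q x \<theta>) \<in> borel_measurable borel"
proof -
  assume "\<theta> \<in> B"
  then have [measurable]: "(\<lambda>x. f x \<theta>) \<in> borel_measurable (restrict_space borel \<X>)"
    using B_subset_\<Theta> f_meas by auto
  have "(\<lambda>x. f x \<theta> powr \<alpha>) \<in> borel_measurable (restrict_space borel \<X>)" by measurable
  then show ?thesis
    unfolding q_def using support_measurable by (subst borel_measurable_restrict_space_iff[symmetric]) auto
qed

lemma \<psi>_meas:
  assumes "\<theta> \<in> ball \<theta>\<^sub>0 radius"
  shows "(\<lambda>x. \<psi> x \<theta>) \<in> borel_measurable borel"
proof (rule borel_measurable_vecI)
  fix j
  have "\<theta> + (radius / real (n + 2)) *\<^sub>R axis j 1 \<in> B" for n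
    using shifted_in_ball[OF assms, of radius n j] radius by auto
  moreover have "\<theta> \<in> B" using assms ball_radius_subset by auto
  ultimately have "(\<lambda>x. sequential_derivative (q x) \<theta> radius (axis j 1)) \<in> borel_measurable borel"
    by (intro sequential_derivative_measurable q_meas)
  then show "(\<lambda>x. \<psi> x \<theta> $ j) \<in> borel_measurable borel" by (simp add: \<psi>_def)
qed

lemma D_entry_meas: "(\<lambda>x. D x $ j $ k) \<in> borel_measurable borel"
proof -
  have "\<theta>\<^sub>0 + (radius / real (n + 2)) *\<^sub>R axis k 1 \<in> ball \<theta>\<^sub>0 radius" for n
    using shifted_in_ball[of \<theta>\<^sub>0 "radius / 2" radius n k] radius(1) by simp
  then have "(\<lambda>x. sequential_derivative (\<lambda>\<theta>. \<psi> x \<theta> $ j) \<theta>\<^sub>0 radius (axis k 1)) \<in> borel_measurable borel"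
    using radius(1) by (intro sequential_derivative_measurable measurable_vec_nth \<psi>_meas) auto
  then show ?thesis by (simp add: D_def)
qed

lemma D_meas: "D \<in> borel_measurable borel"
  by (intro borel_measurable_vecI D_entry_meas)

lemma AE_G_regular: "AE x in G. regular x"
  by (rule AE_G[OF AE_regular])

lemma dominating_function:
  obtains b where "b \<in> borel_measurable borel" "integrable G b"
    "AE x in G. b x = hessian_bound \<alpha> C (\<lambda>j k. \<phi> j k x) radius"
proof -
  have "\<forall>j k. \<exists>b. b \<in> borel_measurable borel \<and> integrable G b \<and> (AE x in G. b x = \<phi> j k x)"
    using borel_version_of_density_integrable[OF \<phi>_g] by metis
  then obtain b where b: "\<And>j k. b j k \<in> borel_measurable borel" "\<And>j k. integrable G (b j k)"
    "\<And>j k. AE x in G. b j k x = \<phi> j k x" by metis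
  show thesis
  proof (rule that[of "\<lambda>x. hessian_bound \<alpha> C (\<lambda>j k. b j k x) radius"])
    show "(\<lambda>x. hessian_bound \<alpha> C (\<lambda>j k. b j k x) radius) \<in> borel_measurable borel"
      unfolding hessian_bound_def using b(1) by measurable
    show "integrable G (\<lambda>x. hessian_bound \<alpha> C (\<lambda>j k. b j k x) radius)"
      unfolding hessian_bound_def using b(2) by simp
    have "AE x in G. \<forall>j k. b j k x = \<phi> j k x"
      unfolding AE_all_countable using b(3) by blast
    then show "AE x in G. hessian_bound \<alpha> C (\<lambda>j k. b j k x) radius = hessian_bound \<alpha> C (\<lambda>j k. \<phi> j k x) radius"
      by eventually_elim (simp add: hessian_bound_def)
  qed
qed

lemma D_integrable: "integrable G D"
proof -
  obtain b where b: "b \<in> borel_measurable borel" "integrable G b"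
    "AE x in G. b x = hessian_bound \<alpha> C (\<lambda>j k. \<phi> j k x) radius" by (rule dominating_function)
  show ?thesis
  proof (intro integrable_vecI)
    fix j k
    show "integrable G (\<lambda>x. D x $ j $ k)"
    proof (rule Bochner_Integration.integrable_bound[OF b(2)])
      show "(\<lambda>x. D x $ j $ k) \<in> borel_measurable G" using D_entry_meas by (simp cong: measurable_cong_sets)
      show "AE x in G. norm (D x $ j $ k) \<le> norm (b x)"
        using AE_G_regular b(3)
      proof eventually_elim
        case (elim x)
        have \<theta>\<^sub>0: "\<theta>\<^sub>0 \<in> ball \<theta>\<^sub>0 radius" using radius(1) by simp
        have *: "(\<Sum>j\<in>UNIV. \<Sum>k\<in>UNIV. \<bar>D x $ j $ k\<bar>) \<le> b x"
          unfolding elim(2) D_eq[OF elim(1)]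
          by (rule hessian_powr_bound[OF B(1) radius(2,1) \<alpha> regular_facts(2-5)[OF elim(1)] \<theta>\<^sub>0])
        have "\<bar>D x $ j $ k\<bar> \<le> (\<Sum>k\<in>UNIV. \<bar>D x $ j $ k\<bar>)"
          by (rule member_le_sum) auto
        also have "\<dots> \<le> (\<Sum>j\<in>UNIV. \<Sum>k\<in>UNIV. \<bar>D x $ j $ k\<bar>)"
          by (rule member_le_sum[where f="\<lambda>j. \<Sum>k\<in>UNIV. \<bar>D x $ j $ k\<bar>"]) (auto intro: sum_nonneg)
        finally show ?case using * by simp
      qed
    qed
  qed
qed

lemma \<psi>\<^sub>0_integrable: "integrable G (\<lambda>x. \<psi> x \<theta>\<^sub>0)" and \<psi>\<^sub>0_bounded: "AE x in G. norm (\<psi> x \<theta>\<^sub>0) \<le> lip"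
proof -
  have m: "(\<lambda>x. \<psi> x \<theta>\<^sub>0) \<in> borel_measurable G"
    using \<psi>_meas[of \<theta>\<^sub>0] radius(1) by (simp cong: measurable_cong_sets)
  show bd: "AE x in G. norm (\<psi> x \<theta>\<^sub>0) \<le> lip"
    using AE_G_regular by eventually_elim (simp add: \<psi>_eq B gradient_powr_bounded)
  show "integrable G (\<lambda>x. \<psi> x \<theta>\<^sub>0)" by (rule G.integrable_const_bound[OF bd m])
qed

end

section \<open>Mean, covariance and mean derivative of the score\<close>

context dpd_model
begin

text \<open>
  Since \<open>B\<close> is contained in \<open>\<Theta>\<^sub>G\<close> and \<open>g\<close> is a probability density, \<open>f\<^sup>\<alpha> g\<close> is integrable.
\<close>

lemma dpd_M_eq:
  assumes "\<theta> \<in> B"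
  shows "integrable G (\<lambda>x. q x \<theta>)"
    and "dpd_M \<mu> g f \<alpha> \<Theta> \<theta> = ereal ((1 + 1 / \<alpha>) * (LINT x|G. q x \<theta>) - I \<theta>)"
proof -
  have in\<X>: "AE x in \<mu>. f x \<theta> powr \<alpha> = q x \<theta>" by (rule AE_I2) (simp add: space_\<mu> q_def)
  have m: "integrable \<mu> (\<lambda>x. dpd_m \<mu> f \<alpha> x \<theta> * g x)" using assms B(3) by (auto simp: Theta_G_def)
  have const: "integrable \<mu> (\<lambda>x. 1 * g x)" "(LINT x|\<mu>. 1 * g x) = 1"
    using integral_density_transfer[of "\<lambda>_. 1" "\<lambda>_. 1"] by (auto simp: G.prob_space[simplified])
  have "integrable \<mu> (\<lambda>x. (1 / (1 + 1 / \<alpha>)) * (dpd_m \<mu> f \<alpha> x \<theta> * g x + I \<theta> * (1 * g x)))"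
    using m const(1) by (intro integrable_mult_right Bochner_Integration.integrable_add) auto
  moreover have "(1 / (1 + 1 / \<alpha>)) * (dpd_m \<mu> f \<alpha> x \<theta> * g x + I \<theta> * (1 * g x)) = f x \<theta> powr \<alpha> * g x" for x
  proof -
    have "1 + 1 / \<alpha> > 0" using \<alpha> by (simp add: add_pos_pos)
    moreover have "dpd_m \<mu> f \<alpha> x \<theta> * g x + I \<theta> * (1 * g x) = (1 + 1 / \<alpha>) * (f x \<theta> powr \<alpha> * g x)"
      by (simp add: dpd_m_def algebra_simps)
    ultimately show ?thesis by simp
  qed
  ultimately have fg: "integrable \<mu> (\<lambda>x. f x \<theta> powr \<alpha> * g x)" by simp
  then show "integrable G (\<lambda>x. q x \<theta>)"
    using integral_density_transfer(1)[OF q_meas[OF assms] in\<X>] by simp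
  have "(LINT x|\<mu>. dpd_m \<mu> f \<alpha> x \<theta> * g x) = (LINT x|\<mu>. (1 + 1 / \<alpha>) * (f x \<theta> powr \<alpha> * g x) - I \<theta> * (1 * g x))"
    by (intro Bochner_Integration.integral_cong) (auto simp: dpd_m_def algebra_simps)
  also have "\<dots> = (1 + 1 / \<alpha>) * (LINT x|\<mu>. f x \<theta> powr \<alpha> * g x) - I \<theta> * (LINT x|\<mu>. 1 * g x)"
    using fg const(1) by simp
  also have "\<dots> = (1 + 1 / \<alpha>) * (LINT x|G. q x \<theta>) - I \<theta>"
    unfolding const(2) integral_density_transfer(2)[OF q_meas[OF assms] in\<X>] by simp
  finally show "dpd_M \<mu> g f \<alpha> \<Theta> \<theta> = ereal ((1 + 1 / \<alpha>) * (LINT x|G. q x \<theta>) - I \<theta>)"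
    using assms B(3) by (auto simp: dpd_M_def)
qed

text \<open>
  The first order condition at the maximiser \<open>\<theta>\<^sub>0\<close> of \<open>M\<close>. The difference quotients of \<open>f\<^sup>\<alpha>\<close> are bounded by
  \<open>lip\<close>, so \<open>M\<close> may be differentiated under the integral. Along each coordinate its quotients are
  nonpositive for positive steps and nonnegative for negative ones, so the derivative vanishes.
\<close>

lemma gradient_I: "gradient I \<theta>\<^sub>0 = (1 + 1 / \<alpha>) *\<^sub>R (LINT x|G. \<psi> x \<theta>\<^sub>0)"
proof -
  have "gradient I \<theta>\<^sub>0 $ j = (1 + 1 / \<alpha>) * (LINT x|G. \<psi> x \<theta>\<^sub>0 $ j)" for j
  proof -
    define M where "M \<theta> = (1 + 1 / \<alpha>) * (LINT x|G. q x \<theta>) - I \<theta>" for \<theta>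
    define e :: "real ^ 'p" where "e = axis j 1"
    have lim: "(\<lambda>n. (M (\<theta>\<^sub>0 + (s / real (n + 2)) *\<^sub>R e) - M \<theta>\<^sub>0) / (s / real (n + 2)))
        \<longlonglongrightarrow> (1 + 1 / \<alpha>) * (LINT x|G. \<psi> x \<theta>\<^sub>0 $ j) - gradient I \<theta>\<^sub>0 $ j"
      if s: "\<bar>s\<bar> = radius" for s
    proof -
      have s0: "s \<noteq> 0" using s radius(1) by auto
      define u where "u n = \<theta>\<^sub>0 + (s / real (n + 2)) *\<^sub>R e" for n
      have ub: "u n \<in> ball \<theta>\<^sub>0 radius" for n
        using shifted_in_ball[of \<theta>\<^sub>0 "radius / 2" s n j] radius(1) s by (simp add: u_def e_def)
      then have uB: "u n \<in> B" for n using ball_radius_subset by auto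
      have "(\<lambda>n. LINT x|G. (q x (u n) - q x \<theta>\<^sub>0) / (s / real (n + 2))) \<longlonglongrightarrow> (LINT x|G. \<psi> x \<theta>\<^sub>0 $ j)"
      proof (rule integral_dominated_convergence[where w="\<lambda>_. lip"])
        show "(\<lambda>x. \<psi> x \<theta>\<^sub>0 $ j) \<in> borel_measurable G"
          using \<psi>\<^sub>0_integrable by (intro measurable_vec_nth) auto
        show "(\<lambda>x. (q x (u n) - q x \<theta>\<^sub>0) / (s / real (n + 2))) \<in> borel_measurable G" for n
          using dpd_M_eq(1)[OF uB] dpd_M_eq(1)[OF B(2)] by simp
        show "AE x in G. (\<lambda>n. (q x (u n) - q x \<theta>\<^sub>0) / (s / real (n + 2))) \<longlonglongrightarrow> \<psi> x \<theta>\<^sub>0 $ j"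
          using AE_G_regular
        proof eventually_elim
          case (elim x)
          have "(q x has_derivative (\<lambda>v. \<psi> x \<theta>\<^sub>0 \<bullet> v)) (at \<theta>\<^sub>0)"
            using gradient_powr(1)[OF elim B(2)] by (simp add: q_eq regular_facts(1)[OF elim] \<psi>_eq elim B(2))
          from difference_quotient_tendsto[OF this s0, of e]
          show ?case by (simp add: u_def e_def inner_axis)
        qed
        show "AE x in G. norm ((q x (u n) - q x \<theta>\<^sub>0) / (s / real (n + 2))) \<le> lip" for n
          using AE_G_regular
        proof eventually_elim
          case (elim x)
          have "\<bar>q x (u n) - q x \<theta>\<^sub>0\<bar> \<le> lip * norm (u n - \<theta>\<^sub>0)"
            using powr_lipschitz[OF elim ub] by (simp add: q_eq regular_facts(1)[OF elim])
          also have "norm (u n - \<theta>\<^sub>0) = \<bar>s / real (n + 2)\<bar>" by (simp add: u_def e_def)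
          finally have "\<bar>q x (u n) - q x \<theta>\<^sub>0\<bar> \<le> lip * \<bar>s / real (n + 2)\<bar>" .
          then show ?case using s0 by (simp only: real_norm_def abs_divide[of "_ - _"]) (subst pos_divide_le_eq, auto)
        qed
      qed simp
      moreover have "(LINT x|G. (q x (u n) - q x \<theta>\<^sub>0) / (s / real (n + 2)))
          = ((LINT x|G. q x (u n)) - (LINT x|G. q x \<theta>\<^sub>0)) / (s / real (n + 2))" for n
        using dpd_M_eq(1)[OF uB] dpd_M_eq(1)[OF B(2)] by simp
      ultimately have 1: "(\<lambda>n. ((LINT x|G. q x (u n)) - (LINT x|G. q x \<theta>\<^sub>0)) / (s / real (n + 2))) \<longlonglongrightarrow> (LINT x|G. \<psi> x \<theta>\<^sub>0 $ j)"
        by (simp only:)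
      have "(I has_derivative (\<lambda>v. gradient I \<theta>\<^sub>0 \<bullet> v)) (at \<theta>\<^sub>0)"
        using I_smooth B(2) by (intro has_derivative_gradient) (auto simp: twice_differentiable_on_def)
      from difference_quotient_tendsto[OF this s0, of e]
      have 2: "(\<lambda>n. (I (u n) - I \<theta>\<^sub>0) / (s / real (n + 2))) \<longlonglongrightarrow> gradient I \<theta>\<^sub>0 $ j"
        by (simp add: u_def e_def inner_axis)
      have "(M (u n) - M \<theta>\<^sub>0) / (s / real (n + 2)) = (1 + 1 / \<alpha>) * (((LINT x|G. q x (u n)) - (LINT x|G. q x \<theta>\<^sub>0)) / (s / real (n + 2)))
          - (I (u n) - I \<theta>\<^sub>0) / (s / real (n + 2))" for n
        unfolding M_def by (simp only: times_divide_eq_right diff_divide_distrib[symmetric]) (simp add: algebra_simps)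
      then show ?thesis
        using tendsto_diff[OF tendsto_mult_left[OF 1] 2] by (simp add: u_def)
    qed
    have max: "M (\<theta>\<^sub>0 + (s / real (n + 2)) *\<^sub>R e) - M \<theta>\<^sub>0 \<le> 0" if s: "\<bar>s\<bar> = radius" for s n
    proof -
      have "\<theta>\<^sub>0 + (s / real (n + 2)) *\<^sub>R e \<in> B"
        using shifted_in_ball[of \<theta>\<^sub>0 "radius / 2" s n j] radius(1) s ball_radius_subset by (auto simp: e_def)
      then have "ereal (M (\<theta>\<^sub>0 + (s / real (n + 2)) *\<^sub>R e)) \<le> ereal (M \<theta>\<^sub>0)"
        unfolding M_def using \<theta>\<^sub>0_max dpd_M_eq(2) B(2) B_subset_\<Theta> by (metis subsetD)
      then show ?thesis by simp
    qed
    have q1: "(M (\<theta>\<^sub>0 + (radius / real (n + 2)) *\<^sub>R e) - M \<theta>\<^sub>0) / (radius / real (n + 2)) \<le> 0" for n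
      by (rule divide_nonpos_pos[OF max]) (use radius(1) in auto)
    have q2: "0 \<le> (M (\<theta>\<^sub>0 + (- radius / real (n + 2)) *\<^sub>R e) - M \<theta>\<^sub>0) / (- radius / real (n + 2))" for n
      by (rule divide_nonpos_neg[OF max]) (use radius(1) in auto)
    have abs: "\<bar>radius\<bar> = radius" "\<bar>- radius\<bar> = radius" using radius(1) by auto
    have "(1 + 1 / \<alpha>) * (LINT x|G. \<psi> x \<theta>\<^sub>0 $ j) - gradient I \<theta>\<^sub>0 $ j \<le> 0"
      by (rule LIMSEQ_le_const2[OF lim[OF abs(1)]], intro exI allI impI, rule q1)
    moreover have "0 \<le> (1 + 1 / \<alpha>) * (LINT x|G. \<psi> x \<theta>\<^sub>0 $ j) - gradient I \<theta>\<^sub>0 $ j"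
      by (rule LIMSEQ_le_const[OF lim[OF abs(2)]], intro exI allI impI, rule q2)
    ultimately show ?thesis by simp
  qed
  then show ?thesis by (simp add: vec_eq_iff integral_vec_nth \<psi>\<^sub>0_integrable)
qed

text \<open>
  The gradient of \<open>\<theta> \<mapsto> dpd_m \<mu> f \<alpha> x \<theta>\<close>, and below it the derivative of this gradient at \<open>\<theta>\<^sub>0\<close>.
\<close>

definition \<Psi> :: "'x \<Rightarrow> real ^ 'p \<Rightarrow> real ^ 'p" where
  "\<Psi> x \<theta> = (1 + 1 / \<alpha>) *\<^sub>R \<psi> x \<theta> - gradient I \<theta>"

definition D\<Psi> :: "'x \<Rightarrow> real ^ 'p ^ 'p" where
  "D\<Psi> x = (1 + 1 / \<alpha>) *\<^sub>R D x - hessian I \<theta>\<^sub>0"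

lemma c1_pos: "0 < 1 + 1 / \<alpha>"
  using \<alpha> by (simp add: add_pos_pos)

lemma \<psi>\<^sub>0_eq: "regular x \<Longrightarrow> \<psi> x \<theta>\<^sub>0 $ j = \<alpha> * (f x \<theta>\<^sub>0 powr \<alpha> * score f x \<theta>\<^sub>0 $ j)"
  using gradient_powr(2)[of x \<theta>\<^sub>0 \<alpha>] B(2) by (simp add: \<psi>_eq)

lemma D_entry_eq: "regular x \<Longrightarrow> D x $ j $ k =
    \<alpha> * (f x \<theta>\<^sub>0 powr \<alpha> * (\<alpha> * (score f x \<theta>\<^sub>0 $ j * score f x \<theta>\<^sub>0 $ k) - information f x \<theta>\<^sub>0 $ j $ k))"
  using gradient_powr(4)[of x \<theta>\<^sub>0 \<alpha>] B(2) by (simp add: D_eq outer_def)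

lemma \<psi>\<^sub>0_meas: "(\<lambda>x. \<psi> x \<theta>\<^sub>0 $ j) \<in> borel_measurable borel"
  using \<psi>_meas[of \<theta>\<^sub>0] radius(1) by (intro measurable_vec_nth) simp

lemma dpd_U_entry: "dpd_U \<mu> g f \<alpha> \<theta>\<^sub>0 $ j = (LINT x|G. \<psi> x \<theta>\<^sub>0 $ j) / \<alpha>"
proof -
  have eq: "AE x in \<mu>. f x \<theta>\<^sub>0 powr \<alpha> * score f x \<theta>\<^sub>0 $ i = \<psi> x \<theta>\<^sub>0 $ i / \<alpha>" for i
    using AE_regular by eventually_elim (use \<alpha> in \<open>simp add: \<psi>\<^sub>0_eq\<close>)
  have m: "(\<lambda>x. \<psi> x \<theta>\<^sub>0 $ i / \<alpha>) \<in> borel_measurable borel" for i using \<psi>\<^sub>0_meas by measurable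
  have int\<psi>: "integrable G (\<lambda>x. \<psi> x \<theta>\<^sub>0 $ i)" for i
    using integrable_bounded_linear[OF bounded_linear_vec_nth \<psi>\<^sub>0_integrable] by simp
  note t = integral_density_transfer[OF m eq]
  have "integrable \<mu> (\<lambda>x. ((f x \<theta>\<^sub>0 powr \<alpha> * g x) *\<^sub>R score f x \<theta>\<^sub>0) $ i)" for i
    using t(1)[of i] int\<psi>[of i] by (simp add: mult_ac)
  then have int: "integrable \<mu> (\<lambda>x. (f x \<theta>\<^sub>0 powr \<alpha> * g x) *\<^sub>R score f x \<theta>\<^sub>0)" by (rule integrable_vecI)
  have "dpd_U \<mu> g f \<alpha> \<theta>\<^sub>0 $ j = (LINT x|\<mu>. (f x \<theta>\<^sub>0 powr \<alpha> * score f x \<theta>\<^sub>0 $ j) * g x)"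
    unfolding dpd_U_def integral_vec_nth[OF int] by (simp add: mult_ac)
  also have "\<dots> = (LINT x|G. \<psi> x \<theta>\<^sub>0 $ j) / \<alpha>" unfolding t(2) by simp
  finally show ?thesis .
qed

lemma \<psi>\<^sub>0_prod_integrable: "integrable G (\<lambda>x. \<psi> x \<theta>\<^sub>0 $ j * \<psi> x \<theta>\<^sub>0 $ k)"
proof (rule G.integrable_const_bound[where B="lip * lip"])
  show "(\<lambda>x. \<psi> x \<theta>\<^sub>0 $ j * \<psi> x \<theta>\<^sub>0 $ k) \<in> borel_measurable G"
    using \<psi>\<^sub>0_meas[of j] \<psi>\<^sub>0_meas[of k] by (simp cong: measurable_cong_sets)
  show "AE x in G. norm (\<psi> x \<theta>\<^sub>0 $ j * \<psi> x \<theta>\<^sub>0 $ k) \<le> lip * lip"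
    using \<psi>\<^sub>0_bounded
  proof eventually_elim
    case (elim x)
    have "\<bar>\<psi> x \<theta>\<^sub>0 $ i\<bar> \<le> lip" for i using component_le_norm_cart[of "\<psi> x \<theta>\<^sub>0" i] elim by linarith
    then show ?case unfolding real_norm_def abs_mult
      by (intro mult_mono) (auto intro: order_trans[OF abs_ge_zero])
  qed
qed

lemma dpd_K_entry: "dpd_K \<mu> g f \<alpha> \<theta>\<^sub>0 $ j $ k =
    ((LINT x|G. \<psi> x \<theta>\<^sub>0 $ j * \<psi> x \<theta>\<^sub>0 $ k) - (LINT x|G. \<psi> x \<theta>\<^sub>0 $ j) * (LINT x|G. \<psi> x \<theta>\<^sub>0 $ k)) / \<alpha>\<^sup>2"
proof -
  have eq: "AE x in \<mu>. f x \<theta>\<^sub>0 powr (2 * \<alpha>) * (score f x \<theta>\<^sub>0 $ i * score f x \<theta>\<^sub>0 $ l) = \<psi> x \<theta>\<^sub>0 $ i * \<psi> x \<theta>\<^sub>0 $ l / \<alpha>\<^sup>2" for i l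
    using AE_regular by eventually_elim (use \<alpha> in \<open>simp add: \<psi>\<^sub>0_eq power2_eq_square flip: powr_square\<close>)
  have m: "(\<lambda>x. \<psi> x \<theta>\<^sub>0 $ i * \<psi> x \<theta>\<^sub>0 $ l / \<alpha>\<^sup>2) \<in> borel_measurable borel" for i l using \<psi>\<^sub>0_meas by measurable
  note t = integral_density_transfer[OF m eq]
  have "integrable \<mu> (\<lambda>x. ((f x \<theta>\<^sub>0 powr (2 * \<alpha>) * g x) *\<^sub>R outer (score f x \<theta>\<^sub>0) (score f x \<theta>\<^sub>0)) $ i $ l)" for i l
    using t(1)[of i l] \<psi>\<^sub>0_prod_integrable[of i l] by (simp add: outer_def mult_ac)
  then have int: "integrable \<mu> (\<lambda>x. (f x \<theta>\<^sub>0 powr (2 * \<alpha>) * g x) *\<^sub>R outer (score f x \<theta>\<^sub>0) (score f x \<theta>\<^sub>0))"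
    by (intro integrable_vecI)
  have "dpd_K \<mu> g f \<alpha> \<theta>\<^sub>0 $ j $ k =
      (LINT x|\<mu>. (f x \<theta>\<^sub>0 powr (2 * \<alpha>) * (score f x \<theta>\<^sub>0 $ j * score f x \<theta>\<^sub>0 $ k)) * g x)
      - dpd_U \<mu> g f \<alpha> \<theta>\<^sub>0 $ j * dpd_U \<mu> g f \<alpha> \<theta>\<^sub>0 $ k"
    unfolding dpd_K_def vector_minus_component integral_components(2)[OF int] by (simp add: outer_def mult_ac)
  also have "\<dots> = (LINT x|G. \<psi> x \<theta>\<^sub>0 $ j * \<psi> x \<theta>\<^sub>0 $ k) / \<alpha>\<^sup>2
      - (LINT x|G. \<psi> x \<theta>\<^sub>0 $ j) / \<alpha> * ((LINT x|G. \<psi> x \<theta>\<^sub>0 $ k) / \<alpha>)"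
    unfolding t(2) dpd_U_entry by simp
  finally show ?thesis by (simp add: power2_eq_square diff_divide_distrib)
qed

text \<open>
  By \<open>gradient_I\<close> the subtracted gradient is the mean of the first term, so this second moment is a
  covariance. The factors \<open>1 + 1/\<alpha>\<close> from the criterion and \<open>\<alpha>\<close> from differentiating \<open>f\<^sup>\<alpha>\<close> combine to
  \<open>1 + \<alpha>\<close>.
\<close>

lemma integral_outer_\<Psi>: "(LINT x|G. outer (\<Psi> x \<theta>\<^sub>0) (\<Psi> x \<theta>\<^sub>0)) = (1 + \<alpha>)\<^sup>2 *\<^sub>R dpd_K \<mu> g f \<alpha> \<theta>\<^sub>0"
  and integrable_outer_\<Psi>: "integrable G (\<lambda>x. outer (\<Psi> x \<theta>\<^sub>0) (\<Psi> x \<theta>\<^sub>0))"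
proof -
  let ?m = "\<lambda>j. LINT x|G. \<psi> x \<theta>\<^sub>0 $ j"
  have int\<psi>: "integrable G (\<lambda>x. \<psi> x \<theta>\<^sub>0 $ i)" for i
    using integrable_bounded_linear[OF bounded_linear_vec_nth \<psi>\<^sub>0_integrable] by simp
  have gI: "gradient I \<theta>\<^sub>0 $ j = (1 + 1 / \<alpha>) * ?m j" for j
    unfolding gradient_I by (simp add: integral_vec_nth \<psi>\<^sub>0_integrable)
  have ent: "outer (\<Psi> x \<theta>\<^sub>0) (\<Psi> x \<theta>\<^sub>0) $ j $ k =
      (1 + 1 / \<alpha>)\<^sup>2 * (\<psi> x \<theta>\<^sub>0 $ j * \<psi> x \<theta>\<^sub>0 $ k - ?m j * \<psi> x \<theta>\<^sub>0 $ k - ?m k * \<psi> x \<theta>\<^sub>0 $ j + ?m j * ?m k)" for x j k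
    by (simp add: outer_def \<Psi>_def gI power2_eq_square algebra_simps del: add_divide_distrib)
  have ie: "integrable G (\<lambda>x. \<psi> x \<theta>\<^sub>0 $ j * \<psi> x \<theta>\<^sub>0 $ k - ?m j * \<psi> x \<theta>\<^sub>0 $ k - ?m k * \<psi> x \<theta>\<^sub>0 $ j + ?m j * ?m k)" for j k
    using \<psi>\<^sub>0_prod_integrable int\<psi> by simp
  show int: "integrable G (\<lambda>x. outer (\<Psi> x \<theta>\<^sub>0) (\<Psi> x \<theta>\<^sub>0))"
    by (intro integrable_vecI) (unfold ent, intro integrable_mult_right ie)
  have "(LINT x|G. outer (\<Psi> x \<theta>\<^sub>0) (\<Psi> x \<theta>\<^sub>0)) $ j $ k = (1 + 1 / \<alpha>)\<^sup>2 * \<alpha>\<^sup>2 * dpd_K \<mu> g f \<alpha> \<theta>\<^sub>0 $ j $ k" for j k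
  proof -
    have "(LINT x|G. outer (\<Psi> x \<theta>\<^sub>0) (\<Psi> x \<theta>\<^sub>0)) $ j $ k = (1 + 1 / \<alpha>)\<^sup>2 *
       (LINT x|G. \<psi> x \<theta>\<^sub>0 $ j * \<psi> x \<theta>\<^sub>0 $ k - ?m j * \<psi> x \<theta>\<^sub>0 $ k - ?m k * \<psi> x \<theta>\<^sub>0 $ j + ?m j * ?m k)"
      unfolding integral_components(2)[OF int] ent by simp
    also have "(LINT x|G. \<psi> x \<theta>\<^sub>0 $ j * \<psi> x \<theta>\<^sub>0 $ k - ?m j * \<psi> x \<theta>\<^sub>0 $ k - ?m k * \<psi> x \<theta>\<^sub>0 $ j + ?m j * ?m k)
       = (LINT x|G. \<psi> x \<theta>\<^sub>0 $ j * \<psi> x \<theta>\<^sub>0 $ k) - ?m j * ?m k"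
      using \<psi>\<^sub>0_prod_integrable int\<psi> by (simp add: G.prob_space)
    also have "\<dots> = \<alpha>\<^sup>2 * dpd_K \<mu> g f \<alpha> \<theta>\<^sub>0 $ j $ k" using \<alpha> by (simp add: dpd_K_entry)
    finally show ?thesis by (simp only: mult.assoc)
  qed
  moreover have "(1 + 1 / \<alpha>)\<^sup>2 * \<alpha>\<^sup>2 = (1 + \<alpha>)\<^sup>2"
    using \<alpha> by (simp add: field_simps flip: power_mult_distrib)
  ultimately show "(LINT x|G. outer (\<Psi> x \<theta>\<^sub>0) (\<Psi> x \<theta>\<^sub>0)) = (1 + \<alpha>)\<^sup>2 *\<^sub>R dpd_K \<mu> g f \<alpha> \<theta>\<^sub>0"
    by (simp add: vec_eq_iff)
qed

lemma fB_meas: "(\<lambda>x. indicator \<X> x *\<^sub>R f x \<theta>\<^sub>0) \<in> borel_measurable borel"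
  using f_meas[of \<theta>\<^sub>0] B(2) B_subset_\<Theta> support_measurable
  by (subst borel_measurable_restrict_space_iff[symmetric]) auto

lemma f_powr_Suc: "regular x \<Longrightarrow> f x \<theta>\<^sub>0 powr (1 + \<alpha>) = f x \<theta>\<^sub>0 * f x \<theta>\<^sub>0 powr \<alpha>"
  using regular_facts(2)[of x \<theta>\<^sub>0] B(2) by (simp add: powr_add)

text \<open>
  Domination by \<open>\<phi> f\<close> is immediate. Measurability is obtained by expressing the information through the
  Borel versions of the gradient and the Hessian of \<open>f\<^sup>\<alpha>\<close>.
\<close>

lemma weighted_information_integrable:
  "integrable \<mu> (\<lambda>x. f x \<theta>\<^sub>0 powr (1 + \<alpha>) * information f x \<theta>\<^sub>0 $ j $ k)"
proof (rule Bochner_Integration.integrable_bound[OF \<phi>_f[of j k]])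
  let ?h = "\<lambda>x. indicator \<X> x *\<^sub>R f x \<theta>\<^sub>0 * (\<psi> x \<theta>\<^sub>0 $ j * \<psi> x \<theta>\<^sub>0 $ k / (\<alpha> * q x \<theta>\<^sub>0) - D x $ j $ k / \<alpha>)"
  have "?h \<in> borel_measurable borel"
    using fB_meas \<psi>\<^sub>0_meas[of j] \<psi>\<^sub>0_meas[of k] q_meas[OF B(2)] D_entry_meas[of j k] by measurable
  then have "?h \<in> borel_measurable \<mu>" by (rule measurable_\<mu>)
  moreover have "AE x in \<mu>. f x \<theta>\<^sub>0 powr (1 + \<alpha>) * information f x \<theta>\<^sub>0 $ j $ k = ?h x"
    using AE_regular
  proof eventually_elim
    case (elim x)
    have "f x \<theta>\<^sub>0 > 0" using regular_facts(2)[OF elim] B(2) by simp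
    then have e1: "\<psi> x \<theta>\<^sub>0 $ j * \<psi> x \<theta>\<^sub>0 $ k / (\<alpha> * q x \<theta>\<^sub>0)
        = \<alpha> * (f x \<theta>\<^sub>0 powr \<alpha> * (score f x \<theta>\<^sub>0 $ j * score f x \<theta>\<^sub>0 $ k))"
      using \<alpha> by (simp add: \<psi>\<^sub>0_eq[OF elim] q_eq regular_facts(1)[OF elim])
    have e2: "D x $ j $ k / \<alpha> = f x \<theta>\<^sub>0 powr \<alpha> *
        (\<alpha> * (score f x \<theta>\<^sub>0 $ j * score f x \<theta>\<^sub>0 $ k) - information f x \<theta>\<^sub>0 $ j $ k)"
      using \<alpha> by (simp add: D_entry_eq[OF elim])
    show ?case
      unfolding e1 e2 using regular_facts(1)[OF elim] by (simp add: f_powr_Suc[OF elim] algebra_simps)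
  qed
  ultimately show "(\<lambda>x. f x \<theta>\<^sub>0 powr (1 + \<alpha>) * information f x \<theta>\<^sub>0 $ j $ k) \<in> borel_measurable \<mu>"
    by (rule measurable_\<mu>_AE)
  show "AE x in \<mu>. norm (f x \<theta>\<^sub>0 powr (1 + \<alpha>) * information f x \<theta>\<^sub>0 $ j $ k) \<le> norm (\<phi> j k x * f x \<theta>\<^sub>0)"
    using AE_regular
  proof eventually_elim
    case (elim x)
    have f0: "f x \<theta>\<^sub>0 > 0" using regular_facts(2)[OF elim] B(2) by simp
    have "\<bar>information f x \<theta>\<^sub>0 $ j $ k * f x \<theta>\<^sub>0 powr \<alpha>\<bar> \<le> \<phi> j k x"
      using elim B(2) by (simp add: regular_def)
    then have "\<bar>information f x \<theta>\<^sub>0 $ j $ k * f x \<theta>\<^sub>0 powr \<alpha>\<bar> * f x \<theta>\<^sub>0 \<le> \<phi> j k x * f x \<theta>\<^sub>0"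
      using f0 by (intro mult_right_mono) auto
    then show ?case using f0 by (simp add: f_powr_Suc[OF elim] abs_mult mult_ac)
  qed
qed

text \<open>
  With \<open>a = f\<^sup>\<alpha> (i - \<alpha> S S\<^sup>t)\<close> and \<open>e = f\<^sup>1\<^sup>+\<^sup>\<alpha> ((1 + \<alpha>) S S\<^sup>t - i)\<close> the two integrands of \<open>J\<close> add up to
  \<open>a g + e\<close>. Up to constants \<open>a\<close> is the Hessian of \<open>f\<^sup>\<alpha>\<close> and \<open>e\<close> that of \<open>f\<^sup>1\<^sup>+\<^sup>\<alpha>\<close>, and the integral of the
  latter is known. To recombine the integrals every piece has to be integrable: \<open>a g\<close> by domination, \<open>e\<close>
  by hypothesis, and \<open>f\<^sup>1\<^sup>+\<^sup>\<alpha> S S\<^sup>t\<close> because \<open>f\<^sup>1\<^sup>+\<^sup>\<alpha> i\<close> and \<open>e\<close> are.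
\<close>

lemma dpd_J_entry: "dpd_J \<mu> g f \<alpha> \<theta>\<^sub>0 $ j $ k = - (LINT x|G. D x $ j $ k) / \<alpha> + hessian I \<theta>\<^sub>0 $ j $ k / (1 + \<alpha>)"
proof -
  let ?S = "\<lambda>x j k. score f x \<theta>\<^sub>0 $ j * score f x \<theta>\<^sub>0 $ k"
  let ?i = "\<lambda>x j k. information f x \<theta>\<^sub>0 $ j $ k"
  let ?F = "\<lambda>x. f x \<theta>\<^sub>0 powr (1 + \<alpha>)"
  define a where "a x j k = f x \<theta>\<^sub>0 powr \<alpha> * (?i x j k - \<alpha> * ?S x j k)" for x j k
  have a_eq: "AE x in \<mu>. a x j k = - (D x $ j $ k) / \<alpha>" for j k
    using AE_regular
  proof eventually_elim
    case (elim x)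
    have e: "D x $ j $ k / \<alpha> = f x \<theta>\<^sub>0 powr \<alpha> * (\<alpha> * ?S x j k - ?i x j k)"
      using \<alpha> by (simp add: D_entry_eq[OF elim])
    show ?case unfolding a_def minus_divide_left[symmetric] e by (simp add: algebra_simps)
  qed
  have Dm: "(\<lambda>x. - (D x $ j $ k) / \<alpha>) \<in> borel_measurable borel" for j k using D_entry_meas[of j k] by measurable
  note ta = integral_density_transfer[OF Dm a_eq]
  have a_int: "integrable \<mu> (\<lambda>x. a x j k * g x)" for j k
    unfolding ta(1) using integral_components(1)[OF D_integrable] by simp
  have a_val: "(LINT x|\<mu>. a x j k * g x) = - (LINT x|G. D x $ j $ k) / \<alpha>" for j k
    unfolding ta(2) by simp
  define e where "e x j k = ?F x * ((1 + \<alpha>) * ?S x j k - ?i x j k)" for x j k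
  have hess: "AE x in \<mu>. hessian (\<lambda>t. f x t powr (1 + \<alpha>)) \<theta>\<^sub>0 $ j $ k = (1 + \<alpha>) * e x j k" for j k
    using AE_regular
    by eventually_elim (simp add: gradient_powr(4) B(2) e_def outer_def)
  have hi: "integrable \<mu> (\<lambda>x. hessian (\<lambda>t. f x t powr (1 + \<alpha>)) \<theta>\<^sub>0)"
    and hv: "(LINT x|\<mu>. hessian (\<lambda>t. f x t powr (1 + \<alpha>)) \<theta>\<^sub>0) = hessian I \<theta>\<^sub>0"
    using I_hessian by (auto simp: has_bochner_integral_iff)
  note hc = integral_components[OF hi]
  have em: "(\<lambda>x. e x j k) \<in> borel_measurable \<mu>" for j k
  proof (rule measurable_\<mu>_AE)
    show "(\<lambda>x. hessian (\<lambda>t. f x t powr (1 + \<alpha>)) \<theta>\<^sub>0 $ j $ k / (1 + \<alpha>)) \<in> borel_measurable \<mu>"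
      using hc(1)[of j k] by (intro borel_measurable_divide) auto
    show "AE x in \<mu>. e x j k = hessian (\<lambda>t. f x t powr (1 + \<alpha>)) \<theta>\<^sub>0 $ j $ k / (1 + \<alpha>)"
      using hess[of j k] by eventually_elim (use \<alpha> in simp)
  qed
  have e_eq: "AE x in \<mu>. e x j k = hessian (\<lambda>t. f x t powr (1 + \<alpha>)) \<theta>\<^sub>0 $ j $ k / (1 + \<alpha>)" for j k
    using hess[of j k] by eventually_elim (use \<alpha> in simp)
  have hm: "(\<lambda>x. hessian (\<lambda>t. f x t powr (1 + \<alpha>)) \<theta>\<^sub>0 $ j $ k / (1 + \<alpha>)) \<in> borel_measurable \<mu>" for j k
    using hc(1)[of j k] by (intro borel_measurable_divide) auto
  have e_int: "integrable \<mu> (\<lambda>x. e x j k)" for j k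
    unfolding integrable_cong_AE[OF em hm e_eq] using hc(1) by simp
  have e_val: "(LINT x|\<mu>. e x j k) = hessian I \<theta>\<^sub>0 $ j $ k / (1 + \<alpha>)" for j k
    unfolding integral_cong_AE[OF em hm e_eq] by (simp add: hc(2)[symmetric] hv)
  note i_int = weighted_information_integrable
  have s_eq: "?F x * ?S x j k = (e x j k + ?F x * ?i x j k) / (1 + \<alpha>)" for x j k
    using \<alpha> by (simp add: e_def field_simps)
  have s_int: "integrable \<mu> (\<lambda>x. ?F x * ?S x j k)" for j k
    unfolding s_eq using e_int[of j k] i_int[of j k] by simp
  have split: "AE x in \<mu>. ((g x - f x \<theta>\<^sub>0) * f x \<theta>\<^sub>0 powr \<alpha>) * (?i x j k - \<alpha> * ?S x j k)
      = a x j k * g x - (?F x * ?i x j k - \<alpha> * (?F x * ?S x j k))" for j k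
    using AE_regular by eventually_elim (simp add: a_def f_powr_Suc algebra_simps)
  have rhs_int: "integrable \<mu> (\<lambda>x. a x j k * g x - (?F x * ?i x j k - \<alpha> * (?F x * ?S x j k)))" for j k
    using a_int[of j k] i_int[of j k] s_int[of j k] by simp
  have lhs_m: "(\<lambda>x. ((g x - f x \<theta>\<^sub>0) * f x \<theta>\<^sub>0 powr \<alpha>) * (?i x j k - \<alpha> * ?S x j k)) \<in> borel_measurable \<mu>" for j k
    by (rule measurable_\<mu>_AE[OF _ split]) (use rhs_int in auto)
  have M1: "integrable \<mu> (\<lambda>x. ?F x *\<^sub>R outer (score f x \<theta>\<^sub>0) (score f x \<theta>\<^sub>0))"
    using s_int by (intro integrable_vecI) (simp add: outer_def)
  have lhs_int: "integrable \<mu> (\<lambda>x. ((g x - f x \<theta>\<^sub>0) * f x \<theta>\<^sub>0 powr \<alpha>) * (?i x j k - \<alpha> * ?S x j k))" for j k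
    using integrable_cong_AE[OF lhs_m _ split] rhs_int by auto
  have M2: "integrable \<mu> (\<lambda>x. ((g x - f x \<theta>\<^sub>0) * f x \<theta>\<^sub>0 powr \<alpha>) *\<^sub>R
          (information f x \<theta>\<^sub>0 - \<alpha> *\<^sub>R outer (score f x \<theta>\<^sub>0) (score f x \<theta>\<^sub>0)))"
    using lhs_int by (intro integrable_vecI) (simp add: outer_def)
  have "dpd_J \<mu> g f \<alpha> \<theta>\<^sub>0 $ j $ k = (LINT x|\<mu>. ?F x * ?S x j k)
      + (LINT x|\<mu>. ((g x - f x \<theta>\<^sub>0) * f x \<theta>\<^sub>0 powr \<alpha>) * (?i x j k - \<alpha> * ?S x j k))"
    unfolding dpd_J_def vector_add_component integral_components(2)[OF M1] integral_components(2)[OF M2]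
    by (simp add: outer_def)
  also have "(LINT x|\<mu>. ((g x - f x \<theta>\<^sub>0) * f x \<theta>\<^sub>0 powr \<alpha>) * (?i x j k - \<alpha> * ?S x j k))
      = (LINT x|\<mu>. a x j k * g x - (?F x * ?i x j k - \<alpha> * (?F x * ?S x j k)))"
    using rhs_int by (intro integral_cong_AE lhs_m split) auto
  also have "\<dots> = (LINT x|\<mu>. a x j k * g x) - ((LINT x|\<mu>. ?F x * ?i x j k) - \<alpha> * (LINT x|\<mu>. ?F x * ?S x j k))"
    using a_int[of j k] i_int[of j k] s_int[of j k] by simp
  also have "(LINT x|\<mu>. ?F x * ?S x j k) + \<dots> =
      (LINT x|\<mu>. a x j k * g x) + ((1 + \<alpha>) * (LINT x|\<mu>. ?F x * ?S x j k) - (LINT x|\<mu>. ?F x * ?i x j k))"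
    by (simp add: algebra_simps)
  also have "(1 + \<alpha>) * (LINT x|\<mu>. ?F x * ?S x j k) - (LINT x|\<mu>. ?F x * ?i x j k) = (LINT x|\<mu>. e x j k)"
    unfolding s_eq using \<alpha> e_int[of j k] i_int[of j k] by simp
  finally show ?thesis unfolding a_val e_val .
qed

lemma integral_D\<Psi>: "(LINT x|G. D\<Psi> x) = (- (1 + \<alpha>)) *\<^sub>R dpd_J \<mu> g f \<alpha> \<theta>\<^sub>0"
  and integrable_D\<Psi>: "integrable G D\<Psi>"
proof -
  show int: "integrable G D\<Psi>" unfolding D\<Psi>_def[abs_def] using D_integrable by simp
  have "(LINT x|G. D\<Psi> x) = (1 + 1 / \<alpha>) *\<^sub>R (LINT x|G. D x) - hessian I \<theta>\<^sub>0"
    unfolding D\<Psi>_def using D_integrable by (simp add: G.prob_space)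
  then have "(LINT x|G. D\<Psi> x) $ j $ k = (1 + 1 / \<alpha>) * (LINT x|G. D x $ j $ k) - hessian I \<theta>\<^sub>0 $ j $ k" for j k
    by (simp add: integral_components(2)[OF D_integrable])
  moreover have "(1 + 1 / \<alpha>) * d - h = - (1 + \<alpha>) * (- d / \<alpha> + h / (1 + \<alpha>))" for d h
  proof -
    have "- (1 + \<alpha>) * (- u + v) = (1 + \<alpha>) * u - (1 + \<alpha>) * v" for u v by (simp add: algebra_simps)
    from this[of "d / \<alpha>" "h / (1 + \<alpha>)"]
    have "- (1 + \<alpha>) * (- d / \<alpha> + h / (1 + \<alpha>)) = (1 + \<alpha>) * (d / \<alpha>) - (1 + \<alpha>) * (h / (1 + \<alpha>))"
      by simp
    also have "(1 + \<alpha>) * (d / \<alpha>) = (1 + 1 / \<alpha>) * d" using \<alpha> by (simp add: field_simps)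
    also have "(1 + \<alpha>) * (h / (1 + \<alpha>)) = h" using \<alpha> by simp
    finally show ?thesis by simp
  qed
  ultimately have "(LINT x|G. D\<Psi> x) $ j $ k = - (1 + \<alpha>) * dpd_J \<mu> g f \<alpha> \<theta>\<^sub>0 $ j $ k" for j k
    unfolding dpd_J_entry by simp
  then show "(LINT x|G. D\<Psi> x) = (- (1 + \<alpha>)) *\<^sub>R dpd_J \<mu> g f \<alpha> \<theta>\<^sub>0" by (simp add: vec_eq_iff)
qed

lemma dpd_J_symmetric: "transpose (dpd_J \<mu> g f \<alpha> \<theta>\<^sub>0) = dpd_J \<mu> g f \<alpha> \<theta>\<^sub>0"
proof -
  have "(LINT x|G. D x $ j $ k) = (LINT x|G. D x $ k $ j)" for j k
  proof (rule integral_cong_AE)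
    show "AE x in G. D x $ j $ k = D x $ k $ j"
      using AE_G_regular
      by eventually_elim (simp add: D_entry_eq information_symmetric[OF _ B(2)] mult.commute)
  qed (use D_entry_meas in \<open>auto cong: measurable_cong_sets\<close>)
  moreover have "hessian I \<theta>\<^sub>0 $ j $ k = hessian I \<theta>\<^sub>0 $ k $ j" for j k
  proof -
    have "transpose (hessian I \<theta>\<^sub>0) = hessian I \<theta>\<^sub>0"
      by (rule hessian_symmetric[OF B(1,2)]) (use I_smooth B(2) in \<open>auto simp: twice_differentiable_on_def\<close>)
    then show ?thesis by (simp add: vec_eq_iff transpose_def)
  qed
  ultimately show ?thesis by (simp add: vec_eq_iff transpose_def dpd_J_entry)
qed

end

section \<open>Asymptotic normality of the MDPDE\<close>

context dpd_model
begin

lemma \<Psi>_meas: "\<theta> \<in> ball \<theta>\<^sub>0 radius \<Longrightarrow> (\<lambda>x. \<Psi> x \<theta>) \<in> borel_measurable borel"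
  unfolding \<Psi>_def using \<psi>_meas by measurable

lemma \<Psi>_continuous: "regular x \<Longrightarrow> continuous_on (ball \<theta>\<^sub>0 radius) (\<Psi> x)"
proof -
  assume x: "regular x"
  have "continuous_on B (\<psi> x)"
    by (intro continuous_at_imp_continuous_on ballI has_derivative_continuous) (rule \<psi>_has_derivative[OF x])
  moreover have "continuous_on B (gradient I)"
    using I_smooth by (intro differentiable_imp_continuous_on)
      (auto simp: twice_differentiable_on_def differentiable_on_def intro: differentiable_at_withinI)
  ultimately have "continuous_on B (\<Psi> x)" unfolding \<Psi>_def[abs_def] by (intro continuous_intros)
  then show ?thesis by (rule continuous_on_subset[OF _ ball_radius_subset])
qed

lemma \<Psi>_has_derivative: "regular x \<Longrightarrow> (\<Psi> x has_derivative (\<lambda>u. D\<Psi> x *v u)) (at \<theta>\<^sub>0)"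
proof -
  assume x: "regular x"
  have "(gradient I has_derivative (\<lambda>v. hessian I \<theta>\<^sub>0 *v v)) (at \<theta>\<^sub>0)"
    using I_smooth B(2) by (intro has_derivative_hessian) (auto simp: twice_differentiable_on_def)
  from has_derivative_diff[OF has_derivative_scaleR_right[OF \<psi>_has_derivative[OF x B(2)], of "1 + 1 / \<alpha>"] this]
  show ?thesis unfolding \<Psi>_def[abs_def]
    by (rule has_derivative_eq_rhs)
       (simp add: fun_eq_iff D\<Psi>_def D_eq x matrix_vector_mult_diff_rdistrib scaleR_matrix_vector_assoc)
qed

text \<open>
  Only differentiability of the gradient of \<open>I\<close> at \<open>\<theta>\<^sub>0\<close> is used, so the radius may have to shrink.
\<close>

lemma gradient_I_lipschitz:
  obtains r c where "r \<le> radius" "0 < r"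
    "\<And>\<theta>. \<theta> \<in> ball \<theta>\<^sub>0 r \<Longrightarrow> norm (gradient I \<theta> - gradient I \<theta>\<^sub>0) \<le> c * norm (\<theta> - \<theta>\<^sub>0)"
proof -
  let ?H = "hessian I \<theta>\<^sub>0"
  have "(gradient I has_derivative (\<lambda>v. ?H *v v)) (at \<theta>\<^sub>0)"
    using I_smooth B(2) by (intro has_derivative_hessian) (auto simp: twice_differentiable_on_def)
  from this[unfolded has_derivative_at_alt] obtain d where d: "d > 0"
    "\<And>y. norm (y - \<theta>\<^sub>0) < d \<Longrightarrow> norm (gradient I y - gradient I \<theta>\<^sub>0 - ?H *v (y - \<theta>\<^sub>0)) \<le> 1 * norm (y - \<theta>\<^sub>0)"
    using zero_less_one by blast
  show thesis
  proof (rule that)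
    show "min d radius \<le> radius" "0 < min d radius" using d(1) radius(1) by auto
    fix \<theta> assume "\<theta> \<in> ball \<theta>\<^sub>0 (min d radius)"
    then have "norm (\<theta> - \<theta>\<^sub>0) < d" by (simp add: dist_norm norm_minus_commute)
    from d(2)[OF this] norm_matrix_vector_mult_le[of ?H "\<theta> - \<theta>\<^sub>0"]
      norm_triangle_sub[of "gradient I \<theta> - gradient I \<theta>\<^sub>0" "?H *v (\<theta> - \<theta>\<^sub>0)"]
    show "norm (gradient I \<theta> - gradient I \<theta>\<^sub>0) \<le> ((\<Sum>i\<in>UNIV. \<Sum>j\<in>UNIV. \<bar>?H $ i $ j\<bar>) + 1) * norm (\<theta> - \<theta>\<^sub>0)"
      unfolding distrib_right by linarith
  qed
qed

lemma \<Psi>_lipschitz: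
  assumes "regular x" "\<theta> \<in> ball \<theta>\<^sub>0 radius"
    and gI: "norm (gradient I \<theta> - gradient I \<theta>\<^sub>0) \<le> c * norm (\<theta> - \<theta>\<^sub>0)"
  shows "norm (\<Psi> x \<theta> - \<Psi> x \<theta>\<^sub>0)
    \<le> ((1 + 1 / \<alpha>) * hessian_bound \<alpha> C (\<lambda>j k. \<phi> j k x) radius + c) * norm (\<theta> - \<theta>\<^sub>0)"
proof -
  let ?b = "hessian_bound \<alpha> C (\<lambda>j k. \<phi> j k x) radius"
  have "\<theta> \<in> B" using assms(2) ball_radius_subset by auto
  then have 1: "norm (\<psi> x \<theta> - \<psi> x \<theta>\<^sub>0) \<le> ?b * norm (\<theta> - \<theta>\<^sub>0)"
    using gradient_powr_lipschitz[OF assms(1,2)] assms(1) B(2) by (simp add: \<psi>_eq)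
  have "\<Psi> x \<theta> - \<Psi> x \<theta>\<^sub>0 = (1 + 1 / \<alpha>) *\<^sub>R (\<psi> x \<theta> - \<psi> x \<theta>\<^sub>0) - (gradient I \<theta> - gradient I \<theta>\<^sub>0)"
    by (simp add: \<Psi>_def scaleR_diff_right)
  then have "norm (\<Psi> x \<theta> - \<Psi> x \<theta>\<^sub>0) \<le> norm ((1 + 1 / \<alpha>) *\<^sub>R (\<psi> x \<theta> - \<psi> x \<theta>\<^sub>0)) + norm (gradient I \<theta> - gradient I \<theta>\<^sub>0)"
    by (simp only: norm_triangle_ineq4)
  also have "norm ((1 + 1 / \<alpha>) *\<^sub>R (\<psi> x \<theta> - \<psi> x \<theta>\<^sub>0)) = (1 + 1 / \<alpha>) * norm (\<psi> x \<theta> - \<psi> x \<theta>\<^sub>0)"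
    using c1_pos by simp
  also have "\<dots> \<le> (1 + 1 / \<alpha>) * (?b * norm (\<theta> - \<theta>\<^sub>0))"
    using 1 c1_pos by (intro mult_left_mono) auto
  also note gI
  finally show ?thesis by (simp only: distrib_right mult.assoc)
qed

text \<open>
  A maximiser over \<open>\<Theta>\<close> that lies in the open set \<open>B\<close> is a critical point.
\<close>

lemma \<Psi>_zero_at_maximizer:
  assumes reg: "\<And>i. i < n \<Longrightarrow> regular (xs i)" and n: "0 < n" and t: "t \<in> ball \<theta>\<^sub>0 radius"
    and max: "\<And>\<theta>. \<theta> \<in> \<Theta> \<Longrightarrow> dpd_mn \<mu> f \<alpha> n xs \<theta> \<le> dpd_mn \<mu> f \<alpha> n xs t"
  shows "(\<Sum>i<n. \<Psi> (xs i) t) = 0"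
proof -
  have tB: "t \<in> B" using t ball_radius_subset by auto
  have dI: "(I has_derivative (\<lambda>v. gradient I t \<bullet> v)) (at t)"
    using I_smooth tB by (intro has_derivative_gradient) (auto simp: twice_differentiable_on_def)
  have "(dpd_m \<mu> f \<alpha> (xs i) has_derivative (\<lambda>v. \<Psi> (xs i) t \<bullet> v)) (at t)" if "i < n" for i
    unfolding dpd_m_def[abs_def]
    by (rule has_derivative_eq_rhs[OF has_derivative_diff[OF
          has_derivative_mult_right[OF gradient_powr(1)[OF reg[OF that] tB], of "1 + 1 / \<alpha>"] dI]])
       (simp add: fun_eq_iff \<Psi>_def \<psi>_eq[OF reg[OF that] tB] inner_simps)
  then have d: "(dpd_mn \<mu> f \<alpha> n xs has_derivative (\<lambda>v. (1 / real n) * (\<Sum>i<n. \<Psi> (xs i) t \<bullet> v))) (at t)"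
    unfolding dpd_mn_def[abs_def] by (intro has_derivative_mult_right has_derivative_sum) auto
  have "(\<lambda>v. (1 / real n) * (\<Sum>i<n. \<Psi> (xs i) t \<bullet> v)) = (\<lambda>v. 0)"
    by (rule differential_zero_maxmin[OF tB B(1) d]) (use max B_subset_\<Theta> in auto)
  from fun_cong[OF this, of "\<Sum>i<n. \<Psi> (xs i) t"] n
  show ?thesis by (simp add: inner_sum_left[symmetric])
qed

lemma \<Psi>\<^sub>0_integrable: "integrable G (\<lambda>x. \<Psi> x \<theta>\<^sub>0)" and \<Psi>\<^sub>0_mean: "(LINT x|G. \<Psi> x \<theta>\<^sub>0) = 0"
  unfolding \<Psi>_def using \<psi>\<^sub>0_integrable by (simp_all add: gradient_I G.prob_space)

lemma \<Psi>\<^sub>0_square_integrable: "integrable G (\<lambda>x. (norm (\<Psi> x \<theta>\<^sub>0))\<^sup>2)"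
proof -
  have "integrable G (\<lambda>x. \<Sum>j\<in>UNIV. outer (\<Psi> x \<theta>\<^sub>0) (\<Psi> x \<theta>\<^sub>0) $ j $ j)"
    using integral_components(1)[OF integrable_outer_\<Psi>] by (intro Bochner_Integration.integrable_sum) auto
  then show ?thesis by (simp add: outer_def power2_norm_vec power2_eq_square[of "_ $ _"])
qed

text \<open>
  \<open>K\<close> is positive semidefinite as a multiple of a covariance, and conjugation by a symmetric matrix
  preserves this.
\<close>

lemma asymptotic_covariance_factorization:
  obtains A :: "real ^ 'p ^ 'p" where "A ** transpose A =
    matrix_inv (dpd_J \<mu> g f \<alpha> \<theta>\<^sub>0) ** dpd_K \<mu> g f \<alpha> \<theta>\<^sub>0 ** matrix_inv (dpd_J \<mu> g f \<alpha> \<theta>\<^sub>0)"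
proof -
  let ?L = "matrix_inv (dpd_J \<mu> g f \<alpha> \<theta>\<^sub>0)" and ?K = "dpd_K \<mu> g f \<alpha> \<theta>\<^sub>0"
  have L: "transpose ?L = ?L" by (rule transpose_matrix_inv[OF J_invertible dpd_J_symmetric])
  have \<alpha>2: "0 < (1 + \<alpha>)\<^sup>2" using \<alpha> by simp
  have K: "transpose ?K = ?K"
    using integral_outer_psd(1)[OF integrable_outer_\<Psi>] \<alpha>2 unfolding integral_outer_\<Psi>
    by (simp add: vec_eq_iff transpose_def)
  have Kpos: "0 \<le> z \<bullet> (?K *v z)" for z
    using integral_outer_psd(2)[OF integrable_outer_\<Psi>, of z] \<alpha>2 unfolding integral_outer_\<Psi>
    by (simp add: zero_le_mult_iff flip: scaleR_matrix_vector_assoc)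
  show thesis
  proof (rule psd_matrix_factorization[of "?L ** ?K ** ?L"])
    show "transpose (?L ** ?K ** ?L) = ?L ** ?K ** ?L"
      by (simp add: matrix_transpose_mul L K matrix_mul_assoc)
    show "0 \<le> z \<bullet> ((?L ** ?K ** ?L) *v z)" for z
    proof -
      have "z \<bullet> (?L *v v) = (?L *v z) \<bullet> v" for v
        using dot_lmul_matrix[of z ?L v] L by (metis transpose_matrix_vector)
      then have "z \<bullet> ((?L ** ?K ** ?L) *v z) = (?L *v z) \<bullet> (?K *v (?L *v z))"
        by (simp add: matrix_vector_mul_assoc[symmetric])
      then show ?thesis using Kpos by simp
    qed
  qed (rule that)
qed

text \<open>
  The general result on Z-estimators applies to \<open>\<Psi>\<close>. The factor \<open>- (1 + \<alpha>)\<close> of \<open>J\<close> in the mean derivative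
  cancels against the factor \<open>(1 + \<alpha>)\<^sup>2\<close> of \<open>K\<close>, and symmetry of \<open>J\<close> removes the transposition.
\<close>

theorem MDPDE_converges_in_distribution:
  fixes P :: "'w measure" and X :: "nat \<Rightarrow> 'w \<Rightarrow> 'x" and T :: "nat \<Rightarrow> (nat \<Rightarrow> 'x) \<Rightarrow> real ^ 'p"
    and A :: "real ^ 'p ^ 'p"
  assumes sample: "iid_sample P X G"
    and mdpde: "\<And>n. 0 < n \<Longrightarrow> is_mdpde P X \<mu> f \<alpha> \<Theta> n (T n)"
    and consistent: "tendsto_in_prob P (\<lambda>n \<omega>. T n (\<lambda>i\<in>{..<n}. X i \<omega>)) \<theta>\<^sub>0"
    and A: "A ** transpose A =
      matrix_inv (dpd_J \<mu> g f \<alpha> \<theta>\<^sub>0) ** dpd_K \<mu> g f \<alpha> \<theta>\<^sub>0 ** matrix_inv (dpd_J \<mu> g f \<alpha> \<theta>\<^sub>0)"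
  shows "converges_in_distribution P (\<lambda>n \<omega>. sqrt (real n) *\<^sub>R (T n (\<lambda>i\<in>{..<n}. X i \<omega>) - \<theta>\<^sub>0))
    (distr std_normal_vec borel (\<lambda>z. 0 + A *v z))"
proof -
  interpret iid_sample P X G by (rule sample)
  let ?J = "dpd_J \<mu> g f \<alpha> \<theta>\<^sub>0" and ?K = "dpd_K \<mu> g f \<alpha> \<theta>\<^sub>0"
  \<comment> \<open>Nothing is known about \<open>T 0\<close>, not even measurability.\<close>
  define est where "est n = (\<lambda>\<omega>. if n = 0 then \<theta>\<^sub>0 else T n (\<lambda>i\<in>{..<n}. X i \<omega>))" for n
  define V where "V = (- (1 + \<alpha>)) *\<^sub>R ?J"
  have \<alpha>1: "- (1 + \<alpha>) \<noteq> 0" using \<alpha> by simp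
  have Linv: "matrix_inv V = (1 / (- (1 + \<alpha>))) *\<^sub>R matrix_inv ?J"
    unfolding V_def by (rule matrix_inv_scaleR(2)[OF J_invertible \<alpha>1])
  have Lsym: "transpose (matrix_inv ?J) = matrix_inv ?J"
    by (rule transpose_matrix_inv[OF J_invertible dpd_J_symmetric])
  have cov: "A ** transpose A = matrix_inv V ** (LINT x|G. outer (\<Psi> x \<theta>\<^sub>0) (\<Psi> x \<theta>\<^sub>0)) ** transpose (matrix_inv V)"
  proof -
    have "transpose (c *\<^sub>R M) = c *\<^sub>R transpose M" for c and M :: "real ^ 'p ^ 'p"
      by (simp add: vec_eq_iff transpose_def)
    then have "matrix_inv V ** (LINT x|G. outer (\<Psi> x \<theta>\<^sub>0) (\<Psi> x \<theta>\<^sub>0)) ** transpose (matrix_inv V)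
       = ((1 / (- (1 + \<alpha>))) * (1 + \<alpha>)\<^sup>2 * (1 / (- (1 + \<alpha>)))) *\<^sub>R (matrix_inv ?J ** ?K ** matrix_inv ?J)"
      unfolding Linv integral_outer_\<Psi> by (simp add: Lsym matrix_scalar_ac scalar_matrix_assoc mult_ac flip: scalar_mult_eq_scaleR)
    also have "(1 / (- (1 + \<alpha>))) * (1 + \<alpha>)\<^sup>2 * (1 / (- (1 + \<alpha>))) = 1"
      using \<alpha> by (simp add: power2_eq_square) (simp add: algebra_simps)
    finally show ?thesis using A by simp
  qed
  obtain b where b: "b \<in> borel_measurable borel" "integrable G b"
    "AE x in G. b x = hessian_bound \<alpha> C (\<lambda>j k. \<phi> j k x) radius" by (rule dominating_function)
  obtain r c where r: "r \<le> radius" "0 < r"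
    and rI: "\<And>\<theta>. \<theta> \<in> ball \<theta>\<^sub>0 r \<Longrightarrow> norm (gradient I \<theta> - gradient I \<theta>\<^sub>0) \<le> c * norm (\<theta> - \<theta>\<^sub>0)"
    by (rule gradient_I_lipschitz) blast
  have r_sub: "ball \<theta>\<^sub>0 r \<subseteq> ball \<theta>\<^sub>0 radius" using r by (rule_tac subset_ball) simp
  have root: "AE \<omega> in P. est n \<omega> \<in> ball \<theta>\<^sub>0 r \<longrightarrow> (\<Sum>i<n. \<Psi> (X i \<omega>) (est n \<omega>)) = 0" if n: "0 < n" for n
  proof -
    have "AE \<omega> in P. \<forall>\<theta>\<in>\<Theta>. dpd_mn \<mu> f \<alpha> n (\<lambda>i\<in>{..<n}. X i \<omega>) \<theta> \<le> dpd_mn \<mu> f \<alpha> n (\<lambda>i\<in>{..<n}. X i \<omega>) (est n \<omega>)"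
      using mdpde[OF n] n by (auto simp: is_mdpde_def Let_def est_def elim: eventually_mono)
    with AE_comp[OF AE_G_regular] show ?thesis
    proof eventually_elim
      case (elim \<omega>)
      show ?case
      proof
        assume "est n \<omega> \<in> ball \<theta>\<^sub>0 r"
        then have "est n \<omega> \<in> ball \<theta>\<^sub>0 radius" using r_sub by auto
        from \<Psi>_zero_at_maximizer[OF _ n this, of "\<lambda>i\<in>{..<n}. X i \<omega>"] elim
        show "(\<Sum>i<n. \<Psi> (X i \<omega>) (est n \<omega>)) = 0" by simp
      qed
    qed
  qed
  have "converges_in_distribution P (\<lambda>n \<omega>. sqrt (real n) *\<^sub>R (est n \<omega> - \<theta>\<^sub>0)) (distr std_normal_vec borel (\<lambda>z. 0 + A *v z))"
  proof (rule Z_estimator_asymptotically_normal[where \<Psi>=\<Psi> and D=D\<Psi> and V=V and b="\<lambda>x. (1 + 1 / \<alpha>) * b x + c", OF r(2)])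
    show "(\<lambda>x. \<Psi> x \<theta>) \<in> borel_measurable borel" if "\<theta> \<in> ball \<theta>\<^sub>0 r" for \<theta>
      using that r_sub by (intro \<Psi>_meas) auto
    show "D\<Psi> \<in> borel_measurable borel" unfolding D\<Psi>_def[abs_def] using D_meas by measurable
    show "integrable G D\<Psi>" by (rule integrable_D\<Psi>)
    show "AE x in G. continuous_on (ball \<theta>\<^sub>0 r) (\<Psi> x)"
      using AE_G_regular by eventually_elim (rule continuous_on_subset[OF \<Psi>_continuous r_sub])
    show "AE x in G. (\<Psi> x has_derivative (\<lambda>u. D\<Psi> x *v u)) (at \<theta>\<^sub>0)"
      using AE_G_regular by eventually_elim (rule \<Psi>_has_derivative)
    show "AE x in G. \<forall>\<theta>\<in>ball \<theta>\<^sub>0 r. norm (\<Psi> x \<theta> - \<Psi> x \<theta>\<^sub>0) \<le> ((1 + 1 / \<alpha>) * b x + c) * norm (\<theta> - \<theta>\<^sub>0)"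
      using AE_G_regular b(3)
      by eventually_elim (use r_sub rI in \<open>simp add: \<Psi>_lipschitz subset_eq\<close>)
    show "integrable G (\<lambda>x. (1 + 1 / \<alpha>) * b x + c)" using b(2) by simp
    show "(LINT x|G. \<Psi> x \<theta>\<^sub>0) = 0" by (rule \<Psi>\<^sub>0_mean)
    show "integrable G (\<lambda>x. (norm (\<Psi> x \<theta>\<^sub>0))\<^sup>2)" by (rule \<Psi>\<^sub>0_square_integrable)
    show "invertible V" unfolding V_def by (rule matrix_inv_scaleR(1)[OF J_invertible \<alpha>1])
    show "V = (LINT x|G. D\<Psi> x)" by (simp add: V_def integral_D\<Psi>)
    show "est n \<in> borel_measurable P" for n
    proof (cases "n = 0")
      case False
      then have Tm: "T n \<in> borel_measurable (\<Pi>\<^sub>M i\<in>{..<n}. borel)" using mdpde[of n] by (simp add: is_mdpde_def)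
      have "(\<lambda>\<omega>. \<lambda>i\<in>{..<n}. X i \<omega>) \<in> P \<rightarrow>\<^sub>M (\<Pi>\<^sub>M i\<in>{..<n}. borel)" by measurable
      from measurable_compose[OF this Tm] show ?thesis using False by (simp add: est_def)
    qed (simp add: est_def)
    show "tendsto_in_prob P est \<theta>\<^sub>0"
      unfolding tendsto_in_prob_def
    proof (intro allI impI)
      fix \<epsilon> :: real assume "0 < \<epsilon>"
      with consistent have "(\<lambda>n. prob {\<omega> \<in> space P. \<epsilon> < dist (T n (\<lambda>i\<in>{..<n}. X i \<omega>)) \<theta>\<^sub>0}) \<longlonglongrightarrow> 0"
        by (simp add: tendsto_in_prob_def)
      then show "(\<lambda>n. prob {\<omega> \<in> space P. \<epsilon> < dist (est n \<omega>) \<theta>\<^sub>0}) \<longlonglongrightarrow> 0"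
        by (rule Lim_transform_eventually) (auto simp: est_def intro!: eventually_mono[OF eventually_gt_at_top[of 0]])
    qed
    show "\<forall>\<^sub>F n in sequentially. AE \<omega> in P. est n \<omega> \<in> ball \<theta>\<^sub>0 r \<longrightarrow> (\<Sum>i<n. \<Psi> (X i \<omega>) (est n \<omega>)) = 0"
      using root by (rule_tac eventually_mono[OF eventually_gt_at_top[of 0]]) simp
  qed (rule cov)
  moreover have "(\<lambda>n \<omega>. sqrt (real n) *\<^sub>R (est n \<omega> - \<theta>\<^sub>0)) = (\<lambda>n \<omega>. sqrt (real n) *\<^sub>R (T n (\<lambda>i\<in>{..<n}. X i \<omega>) - \<theta>\<^sub>0))"
    by (auto simp: fun_eq_iff est_def)
  ultimately show ?thesis by simp
qed

end

theorem theorem6: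
  fixes P :: "'w measure"
    and X :: "nat \<Rightarrow> 'w \<Rightarrow> 'x::polish_space"
    and \<nu> \<mu> G :: "'x measure"
    and \<X> :: "'x set"
    and g :: "'x \<Rightarrow> real"
    and \<Theta> B :: "(real ^ 'p) set"
    and d :: "real ^ 'p \<Rightarrow> real ^ 'p \<Rightarrow> real"
    and f :: "'x \<Rightarrow> real ^ 'p \<Rightarrow> real"
    and \<alpha> :: real
    and \<theta>\<^sub>0 :: "real ^ 'p"
    and C :: "'p \<Rightarrow> real"
    and \<phi> :: "'p \<Rightarrow> 'p \<Rightarrow> 'x \<Rightarrow> real"
    and T :: "nat \<Rightarrow> (nat \<Rightarrow> 'x) \<Rightarrow> real ^ 'p"
  \<comment> \<open>the distribution \<open>G\<close> with density \<open>g\<close> and support \<open>\<X>\<close>\<close>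
  assumes "sigma_finite_measure \<nu>" and "sets \<nu> = sets borel"
    and "g \<in> borel_measurable borel" and "\<And>x. 0 \<le> g x"
    and "G = density \<nu> (\<lambda>x. ennreal (g x))" and "prob_space G"
    and "\<X> = topological_support G"
    and mu: "\<mu> = completion (restrict_space \<nu> \<X>)"
  \<comment> \<open>the i.i.d. observations\<close>
    and "prob_space P"
    and "prob_space.indep_vars P (\<lambda>_. borel) X UNIV"
    and "\<And>i. distr P borel (X i) = G"
  \<comment> \<open>the compact parameter space and the identifiable family of densities\<close>
    and "Metric_space \<Theta> d" and "compact_space (Metric_space.mtopology \<Theta> d)"
    and "\<And>\<theta>. \<theta> \<in> \<Theta> \<Longrightarrow> (\<lambda>x. f x \<theta>) \<in> borel_measurable (restrict_space borel \<X>)"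
    and "\<And>x \<theta>. x \<in> \<X> \<Longrightarrow> \<theta> \<in> \<Theta> \<Longrightarrow> 0 \<le> f x \<theta>"
    and "\<And>\<theta>. \<theta> \<in> \<Theta> \<Longrightarrow> has_bochner_integral \<mu> (\<lambda>x. f x \<theta>) 1"
    and "\<And>\<theta>\<^sub>1 \<theta>\<^sub>2. \<theta>\<^sub>1 \<in> \<Theta> \<Longrightarrow> \<theta>\<^sub>2 \<in> \<Theta> \<Longrightarrow> (AE x in \<mu>. f x \<theta>\<^sub>1 = f x \<theta>\<^sub>2) \<Longrightarrow> \<theta>\<^sub>1 = \<theta>\<^sub>2"
  \<comment> \<open>\<open>m\<close> is real-valued\<close>
    and "0 < \<alpha>"
    and "\<And>\<theta>. \<theta> \<in> \<Theta> \<Longrightarrow> integrable \<mu> (\<lambda>y. f y \<theta> powr (1 + \<alpha>))"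
  \<comment> \<open>the target parameter\<close>
    and "{\<theta> \<in> \<Theta>. - \<infinity> < dpd_M \<mu> g f \<alpha> \<Theta> \<theta>
           \<and> dpd_M \<mu> g f \<alpha> \<Theta> \<theta> = (SUP t\<in>\<Theta>. dpd_M \<mu> g f \<alpha> \<Theta> t)
           \<and> (SUP t\<in>\<Theta>. dpd_M \<mu> g f \<alpha> \<Theta> t) < \<infinity>} = {\<theta>\<^sub>0}"
    and "\<theta>\<^sub>0 \<in> interior \<Theta>"
    and "invertible (dpd_J \<mu> g f \<alpha> \<theta>\<^sub>0)"
  \<comment> \<open>the neighbourhood \<open>B\<close>, on which score and information exist\<close>
    and "open B" and "\<theta>\<^sub>0 \<in> B" and "B \<subseteq> Theta_G \<mu> g f \<alpha> \<Theta>"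
    and "AE x in \<mu>. (\<forall>\<theta>\<in>B. 0 < f x \<theta>) \<and> twice_differentiable_on (\<lambda>\<theta>. ln (f x \<theta>)) B"
  \<comment> \<open>smoothness of the integral, differentiation under the integral sign\<close>
    and "twice_cont_differentiable_on (dpd_integral \<mu> f \<alpha>) B"
    and "\<And>\<theta>. \<theta> \<in> B \<Longrightarrow>
           has_bochner_integral \<mu> (\<lambda>x. gradient (\<lambda>t. f x t powr (1 + \<alpha>)) \<theta>)
             (gradient (dpd_integral \<mu> f \<alpha>) \<theta>)"
    and "\<And>\<theta>. \<theta> \<in> B \<Longrightarrow>
           has_bochner_integral \<mu> (\<lambda>x. hessian (\<lambda>t. f x t powr (1 + \<alpha>)) \<theta>)
             (hessian (dpd_integral \<mu> f \<alpha>) \<theta>)"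
  \<comment> \<open>boundedness of the weighted score\<close>
    and "\<And>j \<theta>. \<theta> \<in> B \<Longrightarrow> AE x in \<mu>. (score f x \<theta> $ j)\<^sup>2 * f x \<theta> powr (2 * \<alpha>) < C j"
  \<comment> \<open>domination of the weighted information\<close>
    and "\<And>j k. AE x in \<mu>. \<forall>\<theta>\<in>B. \<bar>information f x \<theta> $ j $ k * f x \<theta> powr \<alpha>\<bar> \<le> \<phi> j k x"
    and "\<And>j k \<theta>. \<theta> \<in> B \<Longrightarrow> integrable \<mu> (\<lambda>x. \<phi> j k x * f x \<theta>)"
    and "\<And>j k. integrable \<mu> (\<lambda>x. \<phi> j k x * g x)"
  \<comment> \<open>a consistent sequence of estimators\<close>
    and "\<And>n. 0 < n \<Longrightarrow> is_mdpde P X \<mu> f \<alpha> \<Theta> n (T n)"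
    and "tendsto_in_prob P (\<lambda>n \<omega>. T n (\<lambda>i\<in>{..<n}. X i \<omega>)) \<theta>\<^sub>0"
  shows "\<exists>N. is_multivariate_normal N 0
            (matrix_inv (dpd_J \<mu> g f \<alpha> \<theta>\<^sub>0) ** dpd_K \<mu> g f \<alpha> \<theta>\<^sub>0 ** matrix_inv (dpd_J \<mu> g f \<alpha> \<theta>\<^sub>0))
          \<and> converges_in_distribution P
              (\<lambda>n \<omega>. sqrt (real n) *\<^sub>R (T n (\<lambda>i\<in>{..<n}. X i \<omega>) - \<theta>\<^sub>0)) N"
proof -
  note asm = assms
  interpret dpd_model \<nu> \<mu> G \<X> g \<Theta> B f \<alpha> \<theta>\<^sub>0 C \<phi>
  proof (intro dpd_model.intro observed_law.intro dpd_model_axioms.intro)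
    show "dpd_M \<mu> g f \<alpha> \<Theta> \<theta> \<le> dpd_M \<mu> g f \<alpha> \<Theta> \<theta>\<^sub>0" if "\<theta> \<in> \<Theta>" for \<theta>
    proof -
      \<comment> \<open>Hypothesis 20 says that \<open>\<theta>\<^sub>0\<close> is the only maximiser.\<close>
      have "dpd_M \<mu> g f \<alpha> \<Theta> \<theta>\<^sub>0 = (SUP t\<in>\<Theta>. dpd_M \<mu> g f \<alpha> \<Theta> t)"
        using asm(20) by blast
      then show ?thesis using that by (simp add: SUP_upper)
    qed
    show "twice_differentiable_on (dpd_integral \<mu> f \<alpha>) B"
      using \<open>twice_cont_differentiable_on (dpd_integral \<mu> f \<alpha>) B\<close> by (simp add: twice_cont_differentiable_on_def)
  qed (fact asm | (rule asm, fact asm))+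
  have mdpde: "\<And>n. 0 < n \<Longrightarrow> is_mdpde P X \<mu> f \<alpha> \<Theta> n (T n)" by (fact asm)
  have sample: "iid_sample P X G"
    by (intro iid_sample.intro iid_sample_axioms.intro) (fact asm)+
  obtain A :: "real ^ 'p ^ 'p" where A: "A ** transpose A =
      matrix_inv (dpd_J \<mu> g f \<alpha> \<theta>\<^sub>0) ** dpd_K \<mu> g f \<alpha> \<theta>\<^sub>0 ** matrix_inv (dpd_J \<mu> g f \<alpha> \<theta>\<^sub>0)"
    by (rule asymptotic_covariance_factorization)
  show ?thesis
    unfolding is_multivariate_normal_def
    using A MDPDE_converges_in_distribution[OF sample mdpde \<open>tendsto_in_prob P _ \<theta>\<^sub>0\<close> A] by blast
qed

end
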